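(* Let $k\geq1$. For any $\lambda\in X_+$, the $\hat{\mathfrak g}_k$-module $\hat{\mathscr{E}}^0_{\lambda,k}$ (and hence any $\hat{\mathscr{E}}^{j}_{\lambda,k}$ for $0\le j<k$) has a unique irreducible quotient as a $\hat{\mathfrak g}_k$-module; this quotient is denoted $\hat{\mathscr{E}}^k_{\lambda,k}$.
   Context: $\mathfrak g$ is a simple Lie algebra over $\mathbb{C}$ with Cartan subalgebra $\mathfrak t$, highest root $\theta$, dual Coxeter number $h^\vee$; $X_+$ is the set of dominant integral weights and $V(\lambda)$ the irreducible finite-dimensional $\mathfrak g$-module of highest weight $\lambda\in X_+$. $\langle\,,\,\rangle$ is the invariant form on $\mathfrak g$ normalized so that $\langle\theta,\theta\rangle=2$ on $\mathfrak t^*$. $p$ is a fixed prime. For $k\ge 0$ let $A_k=\mathbb{C}[t_1^{\pm1},\dots,t_k^{\pm1}]$, ${\bf t}^{\bf n}=t_1^{n_1}\cdots t_k^{n_k}$, and $$\hat{\mathfrak g}_k=(\mathfrak g\otimes A_k)\oplus\bigoplus_{i=1}^k\mathbb{C}c_i\oplus\bigoplus_{i=1}^k\mathbb{C}d_i,$$ with $c_i$ central, $[x\otimes{\bf t}^{\bf n},y\otimes{\bf t}^{\bf m}]=[x,y]\otimes{\bf t}^{{\bf n}+{\bf m}}+\delta_{{\bf n}+{\bf m},0}\langle x,y\rangle\sum_i n_ic_i$, $[d_i,x\otimes{\bf t}^{\bf n}]=n_i\,x\otimes{\bf t}^{\bf n}$, $[d_i,d_j]=[d_i,c_j]=0$.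 For $k\ge1$ let $A_k^+=\mathbb{C}[t_1^{\pm1},\dots,t_{k-1}^{\pm1},t_k]$ and $\hat{\mathfrak g}_k^+=(\mathfrak g\otimes A_k^+)\oplus\bigoplus_{i=1}^k\mathbb{C}c_i\oplus\bigoplus_{i=1}^k\mathbb{C}d_i$. Induction: given a $\hat{\mathfrak g}_{k-1}$-module $M$ on which $c_i$ acts by $-p^i-h^\vee$ for $1\le i\le k-1$, regard $M$ as a $\hat{\mathfrak g}_k^+$-module by letting $\mathfrak g\otimes t_kA_k^+$ act by zero, $c_k$ act by $-p^k-h^\vee$ and $d_k$ act by zero, and set $\mathrm{Ind}^k_{k-1}(M)=U(\hat{\mathfrak g}_k)\otimes_{U(\hat{\mathfrak g}_k^+)}M$. The $\hat{\mathfrak g}_k$-modules $\hat{\mathscr{E}}^{j}_{\lambda,k}$ are defined by induction on $k$: $\hat{\mathscr{E}}^0_{\lambda,0}=V(\lambda)$; for $k\ge1$ and $0\le j\le k-1$, $\hat{\mathscr{E}}^{j}_{\lambda,k}=\mathrm{Ind}^k_{k-1}(\hat{\mathscr{E}}^{j}_{\lambda,k-1})$; and $\hat{\mathscr{E}}^{k}_{\lambda,k}$ is the irreducible quotient of $\hat{\mathscr{E}}^0_{\lambda,k}$ provided by the present lemma at level $k$. (So the lemma at level $k$ uses the objects $\hat{\mathscr{E}}^{j}_{\lambda,j}$, $1\le j<k$, given by the lemma at lower levels; equivalently, one may take $\hat{\mathscr{E}}^{j}_{\lambda,j}$ to be the quotient of $\hat{\mathscr{E}}^0_{\lambda,j}$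 by the sum of all its proper $\hat{\mathfrak g}_j$-submodules.) *)

theory Defs
  imports
    Complex_Main
    "HOL-Library.Multiset"
    "HOL-Library.Poly_Mapping"
    "HOL-Library.Product_Plus"
    "HOL-Computational_Algebra.Primes"
    "HOL-Algebra.QuotRing"
    "HOL-Algebra.Module"
    "HOL-Algebra.Algebraic_Closure_Type"
begin

section \<open>Lie algebras and their modules\<close>

text \<open>
  A Lie algebra is a linear subspace of an ambient complex vector space (a type), together with
  a bracket. The bracket need only make sense on the carrier.
\<close>

record 'l lie_alg = "'l partial_object" +
  lscale :: "complex \<Rightarrow> 'l \<Rightarrow> 'l"
  lbracket :: "'l \<Rightarrow> 'l \<Rightarrow> 'l"

locale lie_algebra = vector_space "lscale L" for L :: "'l::ab_group_add lie_alg" +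
  assumes carrier_subspace: "subspace (carrier L)"
    and bracket_closed: "\<lbrakk>x \<in> carrier L; y \<in> carrier L\<rbrakk> \<Longrightarrow> lbracket L x y \<in> carrier L"
    and bracket_add_left: "\<lbrakk>x \<in> carrier L; y \<in> carrier L; z \<in> carrier L\<rbrakk>
      \<Longrightarrow> lbracket L (x + y) z = lbracket L x z + lbracket L y z"
    and bracket_add_right: "\<lbrakk>x \<in> carrier L; y \<in> carrier L; z \<in> carrier L\<rbrakk>
      \<Longrightarrow> lbracket L x (y + z) = lbracket L x y + lbracket L x z"
    and bracket_scale_left: "\<lbrakk>x \<in> carrier L; y \<in> carrier L\<rbrakk>
      \<Longrightarrow> lbracket L (lscale L a x) y = lscale L a (lbracket L x y)"
    and bracket_scale_right: "\<lbrakk>x \<in> carrier L; y \<in> carrier L\<rbrakk>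
      \<Longrightarrow> lbracket L x (lscale L a y) = lscale L a (lbracket L x y)"
    and bracket_self: "x \<in> carrier L \<Longrightarrow> lbracket L x x = 0"
    and jacobi: "\<lbrakk>x \<in> carrier L; y \<in> carrier L; z \<in> carrier L\<rbrakk>
      \<Longrightarrow> lbracket L x (lbracket L y z) + lbracket L y (lbracket L z x)
        + lbracket L z (lbracket L x y) = 0"

definition lie_ideal :: "'l::ab_group_add lie_alg \<Rightarrow> 'l set \<Rightarrow> bool" where
  "lie_ideal L I \<longleftrightarrow> I \<subseteq> carrier L \<and> Modules.module.subspace (lscale L) I \<and>
    (\<forall>x\<in>carrier L. \<forall>y\<in>I. lbracket L x y \<in> I)"

locale simple_lie_algebra = lie_algebra L for L :: "'l::ab_group_add lie_alg" +
  assumes finite_dim: "\<exists>B. finite B \<and> carrier L = span B"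
    and nonabelian: "\<exists>x\<in>carrier L. \<exists>y\<in>carrier L. lbracket L x y \<noteq> 0"
    and ideals_trivial: "lie_ideal L I \<Longrightarrow> I = {0} \<or> I = carrier L"

abbreviation complex_ring :: "complex ring" where
  "complex_ring \<equiv> ring_of_type_algebra"

text \<open>
  Modules extend the record of HOL-Algebra modules over the field of complex numbers, whose
  \<open>mult\<close> and \<open>one\<close> fields play no role.
\<close>

record ('l, 'e) lie_rep = "(complex, 'e) module" +
  action :: "'l \<Rightarrow> 'e \<Rightarrow> 'e"

locale lie_module = lie_algebra L + Module.module complex_ring M
  for L :: "'l::ab_group_add lie_alg" and M :: "('l, 'e) lie_rep" (structure) +
  assumes action_closed: "\<lbrakk>x \<in> carrier L; m \<in> carrier M\<rbrakk> \<Longrightarrow> action M x m \<in> carrier M"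
    and action_add: "\<lbrakk>x \<in> carrier L; m \<in> carrier M; n \<in> carrier M\<rbrakk>
      \<Longrightarrow> action M x (m \<oplus>\<^bsub>M\<^esub> n) = action M x m \<oplus>\<^bsub>M\<^esub> action M x n"
    and action_smult: "\<lbrakk>x \<in> carrier L; m \<in> carrier M\<rbrakk>
      \<Longrightarrow> action M x (a \<odot>\<^bsub>M\<^esub> m) = a \<odot>\<^bsub>M\<^esub> action M x m"
    and add_action: "\<lbrakk>x \<in> carrier L; y \<in> carrier L; m \<in> carrier M\<rbrakk>
      \<Longrightarrow> action M (x + y) m = action M x m \<oplus>\<^bsub>M\<^esub> action M y m"
    and scale_action: "\<lbrakk>x \<in> carrier L; m \<in> carrier M\<rbrakk>
      \<Longrightarrow> action M (lscale L a x) m = a \<odot>\<^bsub>M\<^esub> action M x m"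
    and bracket_action: "\<lbrakk>x \<in> carrier L; y \<in> carrier L; m \<in> carrier M\<rbrakk>
      \<Longrightarrow> action M (lbracket L x y) m
        = action M x (action M y m) \<ominus>\<^bsub>M\<^esub> action M y (action M x m)"

definition lie_submodule :: "'l lie_alg \<Rightarrow> ('l, 'e) lie_rep \<Rightarrow> 'e set \<Rightarrow> bool" where
  "lie_submodule L M N \<longleftrightarrow> submodule N complex_ring M \<and>
    (\<forall>x\<in>carrier L. \<forall>m\<in>N. action M x m \<in> N)"

definition irreducible_lie_module :: "'l::ab_group_add lie_alg \<Rightarrow> ('l, 'e) lie_rep \<Rightarrow> bool" where
  "irreducible_lie_module L M \<longleftrightarrow> lie_module L M \<and> carrier M \<noteq> {\<zero>\<^bsub>M\<^esub>} \<and>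
    (\<forall>N. lie_submodule L M N \<longrightarrow> N = {\<zero>\<^bsub>M\<^esub>} \<or> N = carrier M)"

definition lie_module_iso :: "'l lie_alg \<Rightarrow> ('l, 'e) lie_rep \<Rightarrow> ('l, 'f) lie_rep \<Rightarrow> bool" where
  "lie_module_iso L M M' \<longleftrightarrow> (\<exists>\<phi>. bij_betw \<phi> (carrier M) (carrier M') \<and>
    (\<forall>m\<in>carrier M. \<forall>n\<in>carrier M. \<phi> (m \<oplus>\<^bsub>M\<^esub> n) = \<phi> m \<oplus>\<^bsub>M'\<^esub> \<phi> n) \<and>
    (\<forall>a. \<forall>m\<in>carrier M. \<phi> (a \<odot>\<^bsub>M\<^esub> m) = a \<odot>\<^bsub>M'\<^esub> \<phi> m) \<and>
    (\<forall>x\<in>carrier L. \<forall>m\<in>carrier M. \<phi> (action M x m) = action M' x (\<phi> m)))"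

text \<open>
  The quotient \<open>M/N\<close>, with every coset replaced by a chosen representative: unlike the type
  of cosets, this stays within the type of \<open>M\<close>, so that quotients can be iterated in a
  recursion.
\<close>

definition coset_rep :: "('l, 'e) lie_rep \<Rightarrow> 'e set \<Rightarrow> 'e \<Rightarrow> 'e" where
  "coset_rep M N m = (SOME n. n \<in> N +>\<^bsub>M\<^esub> m)"

definition quotient_module :: "('l, 'e) lie_rep \<Rightarrow> 'e set \<Rightarrow> ('l, 'e) lie_rep" where
  "quotient_module M N =
    \<lparr>carrier = coset_rep M N ` carrier M,
     monoid.mult = undefined,
     one = undefined,
     zero = coset_rep M N \<zero>\<^bsub>M\<^esub>,
     add = (\<lambda>m n. coset_rep M N (m \<oplus>\<^bsub>M\<^esub> n)),
     module.smult = (\<lambda>a m. coset_rep M N (a \<odot>\<^bsub>M\<^esub> m)),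
     action = (\<lambda>x m. coset_rep M N (action M x m))\<rparr>"

definition has_unique_irreducible_quotient ::
    "'l::ab_group_add lie_alg \<Rightarrow> ('l, 'e) lie_rep \<Rightarrow> bool" where
  "has_unique_irreducible_quotient L M \<longleftrightarrow> lie_module L M \<and>
    (\<exists>!N. lie_submodule L M N \<and> irreducible_lie_module L (quotient_module M N))"

text \<open>The sum of all proper submodules, i.e. the smallest submodule containing all of them:\<close>

definition sum_proper_submodules :: "'l lie_alg \<Rightarrow> ('l, 'e) lie_rep \<Rightarrow> 'e set" where
  "sum_proper_submodules L M =
    \<Inter>{S. lie_submodule L M S \<and> (\<forall>N. lie_submodule L M N \<and> N \<noteq> carrier M \<longrightarrow> N \<subseteq> S)}"


section \<open>Cartan subalgebras, roots and weights\<close>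

definition normalizer :: "'l lie_alg \<Rightarrow> 'l set \<Rightarrow> 'l set" where
  "normalizer L T = {x \<in> carrier L. \<forall>y\<in>T. lbracket L x y \<in> T}"

primrec lower_central :: "'l::ab_group_add lie_alg \<Rightarrow> 'l set \<Rightarrow> nat \<Rightarrow> 'l set" where
  "lower_central L T 0 = T"
| "lower_central L T (Suc n) =
    Modules.module.span (lscale L) {lbracket L x y | x y. x \<in> T \<and> y \<in> lower_central L T n}"

definition cartan_subalgebra :: "'l::ab_group_add lie_alg \<Rightarrow> 'l set \<Rightarrow> bool" where
  "cartan_subalgebra L T \<longleftrightarrow> T \<subseteq> carrier L \<and> Modules.module.subspace (lscale L) T \<and>
    (\<forall>x\<in>T. \<forall>y\<in>T. lbracket L x y \<in> T) \<and>
    (\<exists>n. lower_central L T n = {0}) \<and> normalizer L T = T"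

text \<open>Linear forms on \<open>T\<close> are extended by zero outside \<open>T\<close>, so that they are equal as
  functions if and only if they agree on \<open>T\<close>.\<close>

definition linear_forms :: "'l::ab_group_add lie_alg \<Rightarrow> 'l set \<Rightarrow> ('l \<Rightarrow> complex) set" where
  "linear_forms L T = {\<alpha>. (\<forall>x\<in>T. \<forall>y\<in>T. \<alpha> (x + y) = \<alpha> x + \<alpha> y) \<and>
    (\<forall>a. \<forall>x\<in>T. \<alpha> (lscale L a x) = a * \<alpha> x) \<and> (\<forall>x. x \<notin> T \<longrightarrow> \<alpha> x = 0)}"

definition root_space :: "'l lie_alg \<Rightarrow> 'l set \<Rightarrow> ('l \<Rightarrow> complex) \<Rightarrow> 'l set" where
  "root_space L T \<alpha> = {x \<in> carrier L. \<forall>h\<in>T. lbracket L h x = lscale L (\<alpha> h) x}"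

definition roots :: "'l::ab_group_add lie_alg \<Rightarrow> 'l set \<Rightarrow> ('l \<Rightarrow> complex) set" where
  "roots L T = {\<alpha> \<in> linear_forms L T. \<alpha> \<noteq> (\<lambda>_. 0) \<and> root_space L T \<alpha> \<noteq> {0}}"

definition nonneg_combination :: "('l \<Rightarrow> complex) set \<Rightarrow> ('l \<Rightarrow> complex) \<Rightarrow> bool" where
  "nonneg_combination \<Delta> \<beta> \<longleftrightarrow> (\<exists>c :: _ \<Rightarrow> nat. \<beta> = (\<lambda>h. \<Sum>\<alpha>\<in>\<Delta>. of_nat (c \<alpha>) * \<alpha> h))"

definition root_base :: "'l::ab_group_add lie_alg \<Rightarrow> 'l set \<Rightarrow> ('l \<Rightarrow> complex) set \<Rightarrow> bool" where
  "root_base L T \<Delta> \<longleftrightarrow> finite \<Delta> \<and> \<Delta> \<subseteq> roots L T \<and>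
    (\<forall>c :: _ \<Rightarrow> complex. (\<lambda>h. \<Sum>\<alpha>\<in>\<Delta>. c \<alpha> * \<alpha> h) = (\<lambda>_. 0) \<longrightarrow> (\<forall>\<alpha>\<in>\<Delta>. c \<alpha> = 0)) \<and>
    (\<forall>\<beta>\<in>roots L T. nonneg_combination \<Delta> \<beta> \<or> nonneg_combination \<Delta> (\<lambda>h. - \<beta> h))"

definition positive_roots ::
    "'l::ab_group_add lie_alg \<Rightarrow> 'l set \<Rightarrow> ('l \<Rightarrow> complex) set \<Rightarrow> ('l \<Rightarrow> complex) set" where
  "positive_roots L T \<Delta> = {\<beta> \<in> roots L T. nonneg_combination \<Delta> \<beta>}"

definition highest_root ::
    "'l::ab_group_add lie_alg \<Rightarrow> 'l set \<Rightarrow> ('l \<Rightarrow> complex) set \<Rightarrow> ('l \<Rightarrow> complex) \<Rightarrow> bool" where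
  "highest_root L T \<Delta> \<theta> \<longleftrightarrow>
    \<theta> \<in> roots L T \<and> (\<forall>\<beta>\<in>roots L T. nonneg_combination \<Delta> (\<lambda>h. \<theta> h - \<beta> h))"

definition invariant_form :: "'l::ab_group_add lie_alg \<Rightarrow> ('l \<Rightarrow> 'l \<Rightarrow> complex) \<Rightarrow> bool" where
  "invariant_form L B \<longleftrightarrow>
    (\<forall>x\<in>carrier L. \<forall>y\<in>carrier L. B x y = B y x) \<and>
    (\<forall>x\<in>carrier L. \<forall>y\<in>carrier L. \<forall>z\<in>carrier L. B (x + y) z = B x z + B y z) \<and>
    (\<forall>a. \<forall>x\<in>carrier L. \<forall>y\<in>carrier L. B (lscale L a x) y = a * B x y) \<and>
    (\<forall>x\<in>carrier L. \<forall>y\<in>carrier L. \<forall>z\<in>carrier L. B (lbracket L x y) z = B x (lbracket L y z))"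

text \<open>The form induced on \<open>T\<^sup>*\<close> by a form \<open>B\<close> that is nondegenerate on \<open>T\<close>:\<close>

definition dual_vector :: "'l set \<Rightarrow> ('l \<Rightarrow> 'l \<Rightarrow> complex) \<Rightarrow> ('l \<Rightarrow> complex) \<Rightarrow> 'l" where
  "dual_vector T B \<alpha> = (THE h. h \<in> T \<and> (\<forall>h'\<in>T. B h h' = \<alpha> h'))"

definition dual_form ::
    "'l set \<Rightarrow> ('l \<Rightarrow> 'l \<Rightarrow> complex) \<Rightarrow> ('l \<Rightarrow> complex) \<Rightarrow> ('l \<Rightarrow> complex) \<Rightarrow> complex" where
  "dual_form T B \<alpha> \<beta> = B (dual_vector T B \<alpha>) (dual_vector T B \<beta>)"

definition nondegenerate_on :: "'l::ab_group_add set \<Rightarrow> ('l \<Rightarrow> 'l \<Rightarrow> complex) \<Rightarrow> bool" where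
  "nondegenerate_on S B \<longleftrightarrow> (\<forall>x\<in>S. (\<forall>y\<in>S. B x y = 0) \<longrightarrow> x = 0)"

definition normalized_form ::
    "'l::ab_group_add lie_alg \<Rightarrow> 'l set \<Rightarrow> ('l \<Rightarrow> complex) \<Rightarrow> ('l \<Rightarrow> 'l \<Rightarrow> complex) \<Rightarrow> bool" where
  "normalized_form L T \<theta> B \<longleftrightarrow>
    invariant_form L B \<and> nondegenerate_on (carrier L) B \<and> dual_form T B \<theta> \<theta> = 2"

text \<open>\<open>1 + \<rho>(\<theta>\<^sup>\<or>)\<close>, where \<open>\<rho>\<close> is the half-sum of the positive roots and \<open>\<theta>\<^sup>\<or>\<close> the coroot of
  the highest root:\<close>

definition dual_coxeter ::
    "'l::ab_group_add lie_alg \<Rightarrow> 'l set \<Rightarrow> ('l \<Rightarrow> complex) set \<Rightarrow> ('l \<Rightarrow> complex)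
      \<Rightarrow> ('l \<Rightarrow> 'l \<Rightarrow> complex) \<Rightarrow> complex" where
  "dual_coxeter L T \<Delta> \<theta> B =
    1 + 2 * dual_form T B (\<lambda>h. (\<Sum>\<beta>\<in>positive_roots L T \<Delta>. \<beta> h) / 2) \<theta> / dual_form T B \<theta> \<theta>"

definition dominant_integral ::
    "'l::ab_group_add lie_alg \<Rightarrow> 'l set \<Rightarrow> ('l \<Rightarrow> complex) set \<Rightarrow> ('l \<Rightarrow> 'l \<Rightarrow> complex)
      \<Rightarrow> ('l \<Rightarrow> complex) set" where
  "dominant_integral L T \<Delta> B = {\<Lambda> \<in> linear_forms L T.
    \<forall>\<alpha>\<in>\<Delta>. 2 * dual_form T B \<Lambda> \<alpha> / dual_form T B \<alpha> \<alpha> \<in> \<nat>}"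

definition finite_dim_module :: "('l, 'e) lie_rep \<Rightarrow> bool" where
  "finite_dim_module V \<longleftrightarrow> (\<exists>S. finite S \<and> S \<subseteq> carrier V \<and>
    (\<forall>N. submodule N complex_ring V \<and> S \<subseteq> N \<longrightarrow> N = carrier V))"

text \<open>\<open>V\<close> is a realisation of the irreducible module \<open>V(\<Lambda>)\<close>, which is unique up to isomorphism:\<close>

definition irreducible_highest_weight ::
    "'l::ab_group_add lie_alg \<Rightarrow> 'l set \<Rightarrow> ('l \<Rightarrow> complex) set \<Rightarrow> ('l \<Rightarrow> complex)
      \<Rightarrow> ('l, 'e) lie_rep \<Rightarrow> bool" where
  "irreducible_highest_weight L T \<Delta> \<Lambda> V \<longleftrightarrow>
    irreducible_lie_module L V \<and> finite_dim_module V \<and>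
    (\<exists>v\<in>carrier V. v \<noteq> \<zero>\<^bsub>V\<^esub> \<and> (\<forall>h\<in>T. action V h v = \<Lambda> h \<odot>\<^bsub>V\<^esub> v) \<and>
      (\<forall>\<beta>\<in>positive_roots L T \<Delta>. \<forall>x\<in>root_space L T \<beta>. action V x v = \<zero>\<^bsub>V\<^esub>))"


section \<open>Universal enveloping algebras\<close>

text \<open>Words form a monoid under concatenation, so that finitely supported functions on words
  with the convolution product form the free associative algebra.\<close>

datatype 'a word = Word "'a list"

instantiation word :: (type) monoid_add
begin

definition zero_word :: "'a word" where "zero_word = Word []"

fun plus_word :: "'a word \<Rightarrow> 'a word \<Rightarrow> 'a word" where
  "plus_word (Word xs) (Word ys) = Word (xs @ ys)"

instance
proof
  fix a b c :: "'a word"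
  show "a + b + c = a + (b + c)" by (cases a; cases b; cases c) simp
  show "0 + a = a" by (cases a) (simp add: zero_word_def)
  show "a + 0 = a" by (cases a) (simp add: zero_word_def)
qed

end

type_synonym 'a free_poly = "'a word \<Rightarrow>\<^sub>0 complex"

definition scalar :: "complex \<Rightarrow> 'a free_poly" where
  "scalar a = Poly_Mapping.single 0 a"

definition gen :: "'a \<Rightarrow> 'a free_poly" where
  "gen x = Poly_Mapping.single (Word [x]) 1"

definition free_algebra :: "'a set \<Rightarrow> 'a free_poly ring" where
  "free_algebra S =
    ring_of_type_algebra\<lparr>carrier := {p. \<forall>w\<in>Poly_Mapping.keys p. \<exists>xs\<in>lists S. w = Word xs}\<rparr>"

text \<open>The tensor algebra is the quotient of the free algebra on the set \<open>carrier L\<close> by the first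
  two families of relations.\<close>

definition uea_relations :: "'l::ab_group_add lie_alg \<Rightarrow> 'l free_poly set" where
  "uea_relations L =
    {gen (x + y) - (gen x + gen y) | x y. x \<in> carrier L \<and> y \<in> carrier L} \<union>
    {gen (lscale L a x) - scalar a * gen x | a x. x \<in> carrier L} \<union>
    {gen x * gen y - gen y * gen x - gen (lbracket L x y) | x y. x \<in> carrier L \<and> y \<in> carrier L}"

definition uea_ideal :: "'l::ab_group_add lie_alg \<Rightarrow> 'l free_poly set" where
  "uea_ideal L = Idl\<^bsub>free_algebra (carrier L)\<^esub> (uea_relations L)"

type_synonym 'l uea = "'l free_poly set"

definition uea :: "'l::ab_group_add lie_alg \<Rightarrow> 'l uea ring" where
  "uea L = free_algebra (carrier L) Quot uea_ideal L"

definition uea_class :: "'l::ab_group_add lie_alg \<Rightarrow> 'l free_poly \<Rightarrow> 'l uea" where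
  "uea_class L p = uea_ideal L +>\<^bsub>free_algebra (carrier L)\<^esub> p"

text \<open>The homomorphism from the enveloping algebra of a subalgebra to that of \<open>L\<close>:\<close>

definition uea_incl :: "'l::ab_group_add lie_alg \<Rightarrow> 'l uea \<Rightarrow> 'l uea" where
  "uea_incl L r = uea_class L (SOME p. p \<in> r)"

text \<open>The action of the enveloping algebra on a module:\<close>

fun word_action :: "('l, 'e) lie_rep \<Rightarrow> 'l word \<Rightarrow> 'e \<Rightarrow> 'e" where
  "word_action M (Word xs) m = foldr (action M) xs m"

definition free_poly_action :: "('l, 'e) lie_rep \<Rightarrow> 'l free_poly \<Rightarrow> 'e \<Rightarrow> 'e" where
  "free_poly_action M p m =
    finsum M (\<lambda>w. Poly_Mapping.lookup p w \<odot>\<^bsub>M\<^esub> word_action M w m) (Poly_Mapping.keys p)"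

definition uea_action :: "('l, 'e) lie_rep \<Rightarrow> 'l uea \<Rightarrow> 'e \<Rightarrow> 'e" where
  "uea_action M r m = free_poly_action M (SOME p. p \<in> r) m"


section \<open>Tensor products and extension of scalars\<close>

text \<open>
  The tensor product of a right module \<open>A\<close> (with action \<open>ra\<close>) and a left module \<open>M\<close> (with
  action \<open>la\<close>) over a ring with carrier \<open>R\<close>: the multiset of pairs \<open>(u\<^sub>i, m\<^sub>i)\<close> stands for the
  formal sum of the \<open>u\<^sub>i \<otimes> m\<^sub>i\<close>, and the following congruence on formal sums is imposed. Negatives
  need no separate treatment, since \<open>(-u) \<otimes> m\<close> is a negative of \<open>u \<otimes> m\<close>.
\<close>

inductive tensor_eq ::
    "('u, 'a) ring_scheme \<Rightarrow> ('u \<Rightarrow> 'r \<Rightarrow> 'u) \<Rightarrow> 'r set \<Rightarrow> ('b, 'e, 'c) module_scheme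
      \<Rightarrow> ('r \<Rightarrow> 'e \<Rightarrow> 'e) \<Rightarrow> ('u \<times> 'e) multiset \<Rightarrow> ('u \<times> 'e) multiset \<Rightarrow> bool"
  for A ra R M la where
  tensor_refl: "set_mset F \<subseteq> carrier A \<times> carrier M \<Longrightarrow> tensor_eq A ra R M la F F"
| tensor_sym: "tensor_eq A ra R M la F G \<Longrightarrow> tensor_eq A ra R M la G F"
| tensor_trans: "\<lbrakk>tensor_eq A ra R M la F G; tensor_eq A ra R M la G H\<rbrakk>
    \<Longrightarrow> tensor_eq A ra R M la F H"
| tensor_cong: "\<lbrakk>tensor_eq A ra R M la F F'; tensor_eq A ra R M la G G'\<rbrakk>
    \<Longrightarrow> tensor_eq A ra R M la (F + G) (F' + G')"
| tensor_zero: "m \<in> carrier M \<Longrightarrow> tensor_eq A ra R M la {#(\<zero>\<^bsub>A\<^esub>, m)#} {#}"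
| tensor_add_left: "\<lbrakk>u \<in> carrier A; v \<in> carrier A; m \<in> carrier M\<rbrakk>
    \<Longrightarrow> tensor_eq A ra R M la {#(u \<oplus>\<^bsub>A\<^esub> v, m)#} {#(u, m), (v, m)#}"
| tensor_add_right: "\<lbrakk>u \<in> carrier A; m \<in> carrier M; n \<in> carrier M\<rbrakk>
    \<Longrightarrow> tensor_eq A ra R M la {#(u, m \<oplus>\<^bsub>M\<^esub> n)#} {#(u, m), (u, n)#}"
| tensor_balanced: "\<lbrakk>u \<in> carrier A; r \<in> R; m \<in> carrier M\<rbrakk>
    \<Longrightarrow> tensor_eq A ra R M la {#(ra u r, m)#} {#(u, la r m)#}"

text \<open>
  A type of elements closed under the formation of formal sums of pairs. It contains all iterated
  tensor products over a module with elements in \<open>'v\<close>, a tensor being represented by a chosen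
  member of its congruence class of formal sums.
\<close>

datatype ('u, 'v) elt =
    Base (base_elt: 'v)
  | Tensor (terms: "('u \<times> ('u, 'v) elt) multiset")

text \<open>The \<open>L\<close>-module \<open>U(L) \<otimes>\<^bsub>U(P)\<^esub> M\<close> for a subalgebra \<open>P\<close> of \<open>L\<close> and a \<open>P\<close>-module \<open>M\<close>:\<close>

definition uea_tensor_eq :: "'l::ab_group_add lie_alg \<Rightarrow> 'l lie_alg \<Rightarrow> ('l, 'e) lie_rep
    \<Rightarrow> ('l uea \<times> 'e) multiset \<Rightarrow> ('l uea \<times> 'e) multiset \<Rightarrow> bool" where
  "uea_tensor_eq L P M =
    tensor_eq (uea L) (\<lambda>u r. u \<otimes>\<^bsub>uea L\<^esub> uea_incl L r) (carrier (uea P)) M (uea_action M)"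

definition tensor_class :: "'l::ab_group_add lie_alg \<Rightarrow> 'l lie_alg \<Rightarrow> ('l, ('l uea, 'v) elt) lie_rep
    \<Rightarrow> ('l uea \<times> ('l uea, 'v) elt) multiset \<Rightarrow> ('l uea, 'v) elt" where
  "tensor_class L P M F = Tensor (SOME G. uea_tensor_eq L P M F G)"

definition left_mult_terms ::
    "'l::ab_group_add lie_alg \<Rightarrow> 'l free_poly \<Rightarrow> ('l uea, 'v) elt
      \<Rightarrow> ('l uea \<times> ('l uea, 'v) elt) multiset" where
  "left_mult_terms L p s = image_mset (\<lambda>(u, m). (uea_class L p \<otimes>\<^bsub>uea L\<^esub> u, m)) (terms s)"

definition extend_scalars :: "'l::ab_group_add lie_alg \<Rightarrow> 'l lie_alg
    \<Rightarrow> ('l, ('l uea, 'v) elt) lie_rep \<Rightarrow> ('l, ('l uea, 'v) elt) lie_rep" where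
  "extend_scalars L P M =
    \<lparr>carrier = tensor_class L P M ` {F. set_mset F \<subseteq> carrier (uea L) \<times> carrier M},
     monoid.mult = undefined,
     one = undefined,
     zero = tensor_class L P M {#},
     add = (\<lambda>s t. tensor_class L P M (terms s + terms t)),
     module.smult = (\<lambda>a s. tensor_class L P M (left_mult_terms L (scalar a) s)),
     action = (\<lambda>x s. tensor_class L P M (left_mult_terms L (gen x) s))\<rparr>"


section \<open>Toroidal Lie algebras\<close>

text \<open>
  A triple \<open>(f, c, d)\<close> stands for the sum of all \<open>f(n) \<otimes> t\<^sup>n\<close>, \<open>c(i) c\<^sub>i\<close> and \<open>d(i) d\<^sub>i\<close>. The
  multi-exponents \<open>n\<close> are finitely supported on \<open>{1, 2, ...}\<close>; the algebras for the different
  values of \<open>k\<close> are subspaces of the same type.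
\<close>

type_synonym exponent = "nat \<Rightarrow>\<^sub>0 int"

type_synonym 'g affine =
  "(exponent \<Rightarrow>\<^sub>0 'g) \<times> (nat \<Rightarrow>\<^sub>0 complex) \<times> (nat \<Rightarrow>\<^sub>0 complex)"

definition affine_scale :: "'g::zero lie_alg \<Rightarrow> complex \<Rightarrow> 'g affine \<Rightarrow> 'g affine" where
  "affine_scale g a = (\<lambda>(f, c, d).
    (Poly_Mapping.map (lscale g a) f, Poly_Mapping.map ((*) a) c, Poly_Mapping.map ((*) a) d))"

text \<open>The eigenvalue of the sum of all \<open>d(i) d\<^sub>i\<close> on \<open>x \<otimes> t\<^sup>n\<close>:\<close>

definition d_weight :: "(nat \<Rightarrow>\<^sub>0 complex) \<Rightarrow> exponent \<Rightarrow> complex" where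
  "d_weight d n =
    (\<Sum>i\<in>Poly_Mapping.keys d. Poly_Mapping.lookup d i * of_int (Poly_Mapping.lookup n i))"

definition affine_bracket :: "'g::ab_group_add lie_alg \<Rightarrow> ('g \<Rightarrow> 'g \<Rightarrow> complex)
    \<Rightarrow> 'g affine \<Rightarrow> 'g affine \<Rightarrow> 'g affine" where
  "affine_bracket g B = (\<lambda>(f, c, d) (f', c', d').
    ((\<Sum>n\<in>Poly_Mapping.keys f. \<Sum>m\<in>Poly_Mapping.keys f'. Poly_Mapping.single (n + m)
          (lbracket g (Poly_Mapping.lookup f n) (Poly_Mapping.lookup f' m)))
      + (\<Sum>m\<in>Poly_Mapping.keys f'. Poly_Mapping.single m
          (lscale g (d_weight d m) (Poly_Mapping.lookup f' m)))
      - (\<Sum>n\<in>Poly_Mapping.keys f. Poly_Mapping.single n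
          (lscale g (d_weight d' n) (Poly_Mapping.lookup f n))),
     \<Sum>n\<in>Poly_Mapping.keys f. \<Sum>i\<in>Poly_Mapping.keys n. Poly_Mapping.single i
        (of_int (Poly_Mapping.lookup n i)
          * B (Poly_Mapping.lookup f n) (Poly_Mapping.lookup f' (- n))),
     0))"

definition ghat :: "'g::ab_group_add lie_alg \<Rightarrow> ('g \<Rightarrow> 'g \<Rightarrow> complex) \<Rightarrow> nat \<Rightarrow> 'g affine lie_alg" where
  "ghat g B k =
    \<lparr>carrier = {(f, c, d).
       (\<forall>n\<in>Poly_Mapping.keys f. Poly_Mapping.keys n \<subseteq> {1..k} \<and> Poly_Mapping.lookup f n \<in> carrier g) \<and>
       Poly_Mapping.keys c \<subseteq> {1..k} \<and> Poly_Mapping.keys d \<subseteq> {1..k}},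
     lscale = affine_scale g,
     lbracket = affine_bracket g B\<rparr>"

definition ghat_plus :: "'g::ab_group_add lie_alg \<Rightarrow> ('g \<Rightarrow> 'g \<Rightarrow> complex) \<Rightarrow> nat \<Rightarrow> 'g affine lie_alg"
  where
  "ghat_plus g B k = (ghat g B k)\<lparr>carrier := {(f, c, d) \<in> carrier (ghat g B k).
      \<forall>n\<in>Poly_Mapping.keys f. Poly_Mapping.lookup n k \<ge> 0}\<rparr>"

text \<open>The bracket on the elements \<open>x \<otimes> t\<^sup>n\<close> and \<open>d\<^sub>i\<close>:\<close>

lemma bracket_zero:
  assumes "lie_algebra g" "y \<in> carrier g"
  shows "lbracket g 0 y = 0" "lbracket g y 0 = 0"
proof -
  interpret lie_algebra g by fact
  have z: "0 \<in> carrier g" using carrier_subspace subspace_0 by blast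
  show "lbracket g 0 y = 0" using bracket_add_left[OF z z assms(2)] by simp
  show "lbracket g y 0 = 0" using bracket_add_right[OF assms(2) z z] by simp
qed

lemma form_zero:
  assumes "lie_algebra g" "invariant_form g B" "y \<in> carrier g"
  shows "B 0 y = 0" "B y 0 = 0"
proof -
  interpret lie_algebra g by fact
  have z: "0 \<in> carrier g" using carrier_subspace subspace_0 by blast
  have "B (0+0) y = B 0 y + B 0 y" using assms z unfolding invariant_form_def by blast
  then show "B 0 y = 0" by simp
  moreover have "B y 0 = B 0 y" using assms z unfolding invariant_form_def by blast
  ultimately show "B y 0 = 0" by simp
qed

lemma affine_bracket_loop_loop:
  assumes "lie_algebra g" "invariant_form g B" "x \<in> carrier g" "y \<in> carrier g"
  shows "affine_bracket g B (Poly_Mapping.single n x, 0, 0) (Poly_Mapping.single m y, 0, 0)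
   = (Poly_Mapping.single (n + m) (lbracket g x y),
      \<Sum>i\<in>Poly_Mapping.keys n. Poly_Mapping.single i
        (if n + m = 0 then of_int (Poly_Mapping.lookup n i) * B x y else 0), 0)"
proof -
  interpret lie_algebra g by fact
  have e: "m = - n \<longleftrightarrow> n + m = 0" by (metis add_eq_0_iff)
  have e': "(- n = m) \<longleftrightarrow> n + m = 0" using e by auto
  show ?thesis
    using assms
    by (cases "x = 0"; cases "y = 0")
      (auto simp: affine_bracket_def d_weight_def bracket_zero form_zero lookup_single when_def e e'
        intro!: sum.cong sum.neutral)
qed

lemma affine_bracket_d_loop:
  assumes "lie_algebra g" "x \<in> carrier g"
  shows "affine_bracket g B (0, 0, Poly_Mapping.single i 1) (Poly_Mapping.single n x, 0, 0)
   = (Poly_Mapping.single n (lscale g (of_int (Poly_Mapping.lookup n i)) x), 0, 0)"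
proof -
  interpret lie_algebra g by fact
  show ?thesis by (cases "x = 0") (auto simp: affine_bracket_def d_weight_def)
qed

text \<open>Before induction to level \<open>k\<close>, a module over the algebra at level \<open>k - 1\<close> is extended
  by zero on \<open>g \<otimes> t\<^sub>k A\<^sub>k\<^sup>+\<close>, by \<open>a\<close> on \<open>c\<^sub>k\<close> and by zero on \<open>d\<^sub>k\<close>:\<close>

definition extend_to_plus :: "nat \<Rightarrow> complex \<Rightarrow> ('g::ab_group_add affine, 'e) lie_rep
    \<Rightarrow> ('g affine, 'e) lie_rep" where
  "extend_to_plus k a M = M\<lparr>action := (\<lambda>(f, c, d) m.
    action M
      (\<Sum>n\<in>{n \<in> Poly_Mapping.keys f. Poly_Mapping.lookup n k = 0}.
          Poly_Mapping.single n (Poly_Mapping.lookup f n),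
       Poly_Mapping.update k 0 c, Poly_Mapping.update k 0 d) m
    \<oplus>\<^bsub>M\<^esub> (a * Poly_Mapping.lookup c k) \<odot>\<^bsub>M\<^esub> m)\<rparr>"

definition induced_module :: "'g::ab_group_add lie_alg \<Rightarrow> ('g \<Rightarrow> 'g \<Rightarrow> complex) \<Rightarrow> nat \<Rightarrow> complex
    \<Rightarrow> ('g affine, ('g affine uea, 'v) elt) lie_rep
    \<Rightarrow> ('g affine, ('g affine uea, 'v) elt) lie_rep" where
  "induced_module g B k a M =
    extend_scalars (ghat g B k) (ghat_plus g B k) (extend_to_plus k a M)"

text \<open>A module over \<open>g\<close>, regarded as a module over \<open>ghat g B 0\<close>, which is \<open>g \<otimes> t\<^sup>0\<close>:\<close>

definition level_zero_module :: "('g::zero, 'v) lie_rep \<Rightarrow> ('g affine, ('u, 'v) elt) lie_rep" where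
  "level_zero_module V =
    \<lparr>carrier = Base ` carrier V,
     monoid.mult = undefined,
     one = undefined,
     zero = Base \<zero>\<^bsub>V\<^esub>,
     add = (\<lambda>v w. Base (base_elt v \<oplus>\<^bsub>V\<^esub> base_elt w)),
     module.smult = (\<lambda>a v. Base (a \<odot>\<^bsub>V\<^esub> base_elt v)),
     action = (\<lambda>(f, c, d) v. Base (action V (Poly_Mapping.lookup f 0) (base_elt v)))\<rparr>"

text \<open>
  The modules \<open>\<E>\<^sup>j\<^sub>\<Lambda>\<^sub>,\<^sub>k\<close>, meaningful for \<open>j \<le> k\<close>. Here \<open>V\<close> is \<open>V(\<Lambda>)\<close> and \<open>h\<close> is the dual Coxeter
  number. For \<open>j = k > 0\<close> it is the quotient of \<open>\<E>\<^sup>0\<^sub>\<Lambda>\<^sub>,\<^sub>k\<close> by the sum of its proper submodules.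
\<close>

primrec E_module :: "'g::ab_group_add lie_alg \<Rightarrow> ('g \<Rightarrow> 'g \<Rightarrow> complex) \<Rightarrow> complex \<Rightarrow> nat
    \<Rightarrow> ('g, 'v) lie_rep \<Rightarrow> nat \<Rightarrow> nat \<Rightarrow> ('g affine, ('g affine uea, 'v) elt) lie_rep" where
  "E_module g B h p V j 0 = level_zero_module V"
| "E_module g B h p V j (Suc k) =
    (if j \<le> k then induced_module g B (Suc k) (- of_nat (p ^ Suc k) - h) (E_module g B h p V j k)
     else let M = induced_module g B (Suc k) (- of_nat (p ^ Suc k) - h) (E_module g B h p V 0 k)
       in quotient_module M (sum_proper_submodules (ghat g B (Suc k)) M))"

end

theory Submission
  imports Defs
begin

text \<open>
  Each of the modules contains a copy of \<open>V(\<Lambda>)\<close> that generates it and that the derivations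
  \<open>d\<^sub>1\<close>, \<dots>, \<open>d\<^sub>k\<close> split off: it is their common kernel, and the component of a vector in it is
  obtained from the vector by a polynomial in the derivations. A submodule is stable under the
  derivations, so it contains the components of its elements. As \<open>V(\<Lambda>)\<close> is irreducible over \<open>g\<close>, a
  submodule in which a nonzero component occurs contains \<open>V(\<Lambda>)\<close> and is everything. The proper
  submodules are therefore those on which the projection to \<open>V(\<Lambda>)\<close> vanishes, and there is a largest
  one. The locale \<open>top_component\<close> carries out this argument, and also shows that every surjection
  from such a module onto an irreducible one has this largest submodule as its kernel. Since the module
  with index \<open>0\<close> maps onto the one with index \<open>j\<close>, all irreducible quotients at level \<open>k\<close> are
  isomorphic.

  The point that needs work is that the structure survives induction, in particular that the copy
  of \<open>V(\<Lambda>)\<close> does not collapse in \<open>U(L) \<otimes>\<^bsub>U(P)\<^esub> M\<close>. This follows from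
  the existence of an additive map from the induced module to \<open>M\<close> that sends \<open>1 \<otimes> m\<close> to \<open>m\<close>. Here
  \<open>L\<close> is the direct sum of \<open>P\<close> and a complementary subalgebra \<open>N\<close>, the loops of negative degree in
  \<open>t\<^sub>k\<close>, and the map is the projection with kernel \<open>N U(L) \<otimes> M\<close>. It can be computed on
  \<open>x\<^sub>1 \<cdots> x\<^sub>n \<otimes> m\<close> by recursion on \<open>n\<close>: split \<open>x\<^sub>n\<close> into its parts in \<open>P\<close> and \<open>N\<close>, let the former act
  on \<open>m\<close>, and move the latter to the left end of the word, where it contributes nothing; on its way
  it acts on the remaining letters as a derivation. That this recursion is compatible
  with the relations of the enveloping algebra is a calculation with the Jacobi identity
  (\<open>hc_relation\<close>), and yields \<open>top_proj\<close>.

  The derivation \<open>d\<^sub>k\<close> acts by zero on \<open>1 \<otimes> M\<close> and grades \<open>N\<close> by negative integers. A vector of degree at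
  least \<open>-r\<close> is brought into \<open>1 \<otimes> M\<close> by \<open>(d\<^sub>k + 1) \<cdots> (d\<^sub>k + r)\<close>, and the result is a nonzero
  multiple of its projection (\<open>top_proj_stable\<close>). Composed with the projection of \<open>M\<close> onto
  \<open>V(\<Lambda>)\<close>, this gives the projection for the induced module (\<open>extended_top_component\<close>).
\<close>

section \<open>Modules over Lie algebras: submodules, homomorphisms, quotients\<close>

lemma complex_ring_simps [simp]:
  "carrier complex_ring = UNIV" "a \<oplus>\<^bsub>complex_ring\<^esub> b = a + b" "a \<otimes>\<^bsub>complex_ring\<^esub> b = a * b"
  "\<zero>\<^bsub>complex_ring\<^esub> = 0" "\<one>\<^bsub>complex_ring\<^esub> = 1"
  by (simp_all add: ring_of_type_algebra_def)

lemma cring_complex_ring: "cring complex_ring"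
  by (rule cring_from_type_algebra)

definition linear_subspace :: "('l, 'e) lie_rep \<Rightarrow> 'e set \<Rightarrow> bool" where
  "linear_subspace M W \<longleftrightarrow> W \<subseteq> carrier M \<and> \<zero>\<^bsub>M\<^esub> \<in> W \<and>
    (\<forall>m\<in>W. \<forall>n\<in>W. m \<oplus>\<^bsub>M\<^esub> n \<in> W) \<and> (\<forall>a. \<forall>m\<in>W. a \<odot>\<^bsub>M\<^esub> m \<in> W)"

text \<open>The set \<open>S\<close> of operators varies: submodules are the case \<open>S = carrier L\<close>, but the irreducible
  top component is stable only under \<open>g\<close>, and weight arguments use only derivations.\<close>

definition stable_subspace :: "('l, 'e) lie_rep \<Rightarrow> 'l set \<Rightarrow> 'e set \<Rightarrow> bool" where
  "stable_subspace M S W \<longleftrightarrow> linear_subspace M W \<and> (\<forall>x\<in>S. \<forall>m\<in>W. action M x m \<in> W)"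

lemma stable_subspaceD:
  assumes "stable_subspace M S W"
  shows "W \<subseteq> carrier M" "m \<in> W \<Longrightarrow> m \<in> carrier M" "\<zero>\<^bsub>M\<^esub> \<in> W"
    "m \<in> W \<Longrightarrow> n \<in> W \<Longrightarrow> m \<oplus>\<^bsub>M\<^esub> n \<in> W"
    "m \<in> W \<Longrightarrow> a \<odot>\<^bsub>M\<^esub> m \<in> W" "x \<in> S \<Longrightarrow> m \<in> W \<Longrightarrow> action M x m \<in> W"
  using assms by (auto simp: stable_subspace_def linear_subspace_def)

lemma stable_subspaceI:
  assumes "W \<subseteq> carrier M" "\<zero>\<^bsub>M\<^esub> \<in> W"
    "\<And>m n. m \<in> W \<Longrightarrow> n \<in> W \<Longrightarrow> m \<oplus>\<^bsub>M\<^esub> n \<in> W"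
    "\<And>a m. m \<in> W \<Longrightarrow> a \<odot>\<^bsub>M\<^esub> m \<in> W" "\<And>x m. x \<in> S \<Longrightarrow> m \<in> W \<Longrightarrow> action M x m \<in> W"
  shows "stable_subspace M S W"
  using assms by (auto simp: stable_subspace_def linear_subspace_def)

lemma lie_moduleI:
  fixes L :: "'l::ab_group_add lie_alg" and M :: "('l, 'e) lie_rep"
  assumes "lie_algebra L"
    and zero: "\<zero>\<^bsub>M\<^esub> \<in> carrier M"
    and closed: "\<And>m n. m \<in> carrier M \<Longrightarrow> n \<in> carrier M \<Longrightarrow> m \<oplus>\<^bsub>M\<^esub> n \<in> carrier M"
    and assoc: "\<And>l m n. l \<in> carrier M \<Longrightarrow> m \<in> carrier M \<Longrightarrow> n \<in> carrier M \<Longrightarrow>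
      (l \<oplus>\<^bsub>M\<^esub> m) \<oplus>\<^bsub>M\<^esub> n = l \<oplus>\<^bsub>M\<^esub> (m \<oplus>\<^bsub>M\<^esub> n)"
    and comm: "\<And>m n. m \<in> carrier M \<Longrightarrow> n \<in> carrier M \<Longrightarrow> m \<oplus>\<^bsub>M\<^esub> n = n \<oplus>\<^bsub>M\<^esub> m"
    and l_zero: "\<And>m. m \<in> carrier M \<Longrightarrow> \<zero>\<^bsub>M\<^esub> \<oplus>\<^bsub>M\<^esub> m = m"
    and smult_closed: "\<And>a m. m \<in> carrier M \<Longrightarrow> a \<odot>\<^bsub>M\<^esub> m \<in> carrier M"
    and smult_l_distr: "\<And>a b m. m \<in> carrier M \<Longrightarrow> (a + b) \<odot>\<^bsub>M\<^esub> m = a \<odot>\<^bsub>M\<^esub> m \<oplus>\<^bsub>M\<^esub> b \<odot>\<^bsub>M\<^esub> m"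
    and smult_r_distr: "\<And>a m n. m \<in> carrier M \<Longrightarrow> n \<in> carrier M \<Longrightarrow>
      a \<odot>\<^bsub>M\<^esub> (m \<oplus>\<^bsub>M\<^esub> n) = a \<odot>\<^bsub>M\<^esub> m \<oplus>\<^bsub>M\<^esub> a \<odot>\<^bsub>M\<^esub> n"
    and smult_assoc: "\<And>a b m. m \<in> carrier M \<Longrightarrow> (a * b) \<odot>\<^bsub>M\<^esub> m = a \<odot>\<^bsub>M\<^esub> (b \<odot>\<^bsub>M\<^esub> m)"
    and smult_one: "\<And>m. m \<in> carrier M \<Longrightarrow> 1 \<odot>\<^bsub>M\<^esub> m = m"
    and smult_zero: "\<And>m. m \<in> carrier M \<Longrightarrow> 0 \<odot>\<^bsub>M\<^esub> m = \<zero>\<^bsub>M\<^esub>"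
    and action_closed: "\<And>x m. x \<in> carrier L \<Longrightarrow> m \<in> carrier M \<Longrightarrow> action M x m \<in> carrier M"
    and action_add: "\<And>x m n. x \<in> carrier L \<Longrightarrow> m \<in> carrier M \<Longrightarrow> n \<in> carrier M
      \<Longrightarrow> action M x (m \<oplus>\<^bsub>M\<^esub> n) = action M x m \<oplus>\<^bsub>M\<^esub> action M x n"
    and action_smult: "\<And>x a m. x \<in> carrier L \<Longrightarrow> m \<in> carrier M
      \<Longrightarrow> action M x (a \<odot>\<^bsub>M\<^esub> m) = a \<odot>\<^bsub>M\<^esub> action M x m"
    and add_action: "\<And>x y m. x \<in> carrier L \<Longrightarrow> y \<in> carrier L \<Longrightarrow> m \<in> carrier M
      \<Longrightarrow> action M (x + y) m = action M x m \<oplus>\<^bsub>M\<^esub> action M y m"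
    and scale_action: "\<And>x a m. x \<in> carrier L \<Longrightarrow> m \<in> carrier M
      \<Longrightarrow> action M (lscale L a x) m = a \<odot>\<^bsub>M\<^esub> action M x m"
    and bracket_action: "\<And>x y m. x \<in> carrier L \<Longrightarrow> y \<in> carrier L \<Longrightarrow> m \<in> carrier M
      \<Longrightarrow> action M (lbracket L x y) m \<oplus>\<^bsub>M\<^esub> action M y (action M x m) = action M x (action M y m)"
  shows "lie_module L M"
proof -
  interpret L: lie_algebra L by fact
  have inv: "(-1) \<odot>\<^bsub>M\<^esub> m \<oplus>\<^bsub>M\<^esub> m = \<zero>\<^bsub>M\<^esub>" if "m \<in> carrier M" for m
    using smult_l_distr[of m "-1" 1] smult_one smult_zero that by simp
  have ab: "abelian_group M"
  proof (rule abelian_groupI)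
    show "\<exists>y\<in>carrier M. y \<oplus>\<^bsub>M\<^esub> x = \<zero>\<^bsub>M\<^esub>" if "x \<in> carrier M" for x
      using inv[OF that] smult_closed[OF that] by blast
  qed (use zero closed assoc comm l_zero in auto)
  have mo: "Module.module complex_ring M"
    by (rule moduleI[OF cring_complex_ring ab])
      (simp_all add: smult_closed smult_l_distr smult_r_distr smult_assoc smult_one)
  interpret Module.module complex_ring M by (rule mo)
  show ?thesis
  proof
    fix x y m assume a: "x \<in> carrier L" "y \<in> carrier L" "m \<in> carrier M"
    have c: "action M x (action M y m) \<in> carrier M" "action M y (action M x m) \<in> carrier M"
      "action M (lbracket L x y) m \<in> carrier M"
      using a action_closed L.bracket_closed by auto
    show "action M (lbracket L x y) m = action M x (action M y m) \<ominus>\<^bsub>M\<^esub> action M y (action M x m)"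
      unfolding bracket_action[OF a, symmetric] using c by (simp add: M.minus_eq M.a_assoc M.r_neg)
  qed (use action_closed action_add action_smult add_action scale_action in auto)
qed

context lie_algebra
begin

lemma carrier_zero: "0 \<in> carrier L"
  using carrier_subspace subspace_0 by blast

lemma carrier_add: "x \<in> carrier L \<Longrightarrow> y \<in> carrier L \<Longrightarrow> x + y \<in> carrier L"
  using carrier_subspace subspace_add by blast

lemma bracket_swap: "x \<in> carrier L \<Longrightarrow> y \<in> carrier L \<Longrightarrow> lbracket L x y = - lbracket L y x"
  using bracket_self[of "x + y"] bracket_self[of x] bracket_self[of y] carrier_add[of x y]
  by (simp add: bracket_add_left bracket_add_right eq_neg_iff_add_eq_0 add.commute)

lemma carrier_scale: "x \<in> carrier L \<Longrightarrow> lscale L a x \<in> carrier L"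
  using carrier_subspace subspace_scale by blast

end

context lie_module
begin

lemmas msimps = smult_l_distr[simplified] smult_r_distr[simplified] smult_assoc1[simplified]
  smult_one[simplified] smult_l_null[simplified] smult_r_null[simplified]

lemma smult_carrier [simp]: "m \<in> carrier M \<Longrightarrow> a \<odot>\<^bsub>M\<^esub> m \<in> carrier M"
  using smult_closed by simp

lemma neg_eq_smult: "m \<in> carrier M \<Longrightarrow> \<ominus>\<^bsub>M\<^esub> m = (-1) \<odot>\<^bsub>M\<^esub> m"
  by (metis M.minus_equality add.left_inverse smult_carrier msimps(1,4,5))

lemma minus_eq_zero_iff:
  assumes "m \<in> carrier M" "n \<in> carrier M"
  shows "m \<ominus>\<^bsub>M\<^esub> n = \<zero>\<^bsub>M\<^esub> \<longleftrightarrow> m = n"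
proof
  assume "m \<ominus>\<^bsub>M\<^esub> n = \<zero>\<^bsub>M\<^esub>"
  then have "(m \<oplus>\<^bsub>M\<^esub> \<ominus>\<^bsub>M\<^esub> n) \<oplus>\<^bsub>M\<^esub> n = \<zero>\<^bsub>M\<^esub> \<oplus>\<^bsub>M\<^esub> n" by (simp add: M.minus_eq)
  then show "m = n" using assms by (simp add: M.a_assoc M.l_neg)
qed (use assms in \<open>simp add: M.minus_eq M.r_neg\<close>)

lemma bracket_action': "x \<in> carrier L \<Longrightarrow> y \<in> carrier L \<Longrightarrow> m \<in> carrier M
      \<Longrightarrow> action M (lbracket L x y) m \<oplus>\<^bsub>M\<^esub> action M y (action M x m) = action M x (action M y m)"
  by (simp add: bracket_action M.minus_eq M.a_assoc M.l_neg action_closed)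


lemma action_null [simp]: "x \<in> carrier L \<Longrightarrow> action M x \<zero>\<^bsub>M\<^esub> = \<zero>\<^bsub>M\<^esub>"
  using action_smult[of x "\<zero>\<^bsub>M\<^esub>" 0] action_closed[of x "\<zero>\<^bsub>M\<^esub>"] by (simp add: msimps)

lemma null_action [simp]: "m \<in> carrier M \<Longrightarrow> action M 0 m = \<zero>\<^bsub>M\<^esub>"
  using scale_action[of 0 m 0] action_closed[of 0 m] carrier_zero by (simp add: msimps)

lemma lie_submodule_iff: "lie_submodule L M W \<longleftrightarrow> stable_subspace M (carrier L) W"
proof
  assume a: "lie_submodule L M W"
  then have s: "submodule W complex_ring M" by (simp add: lie_submodule_def)
  note e = submoduleE[OF s]
  have "\<zero>\<^bsub>M\<^esub> \<in> W" by (metis a_inv_def e(1,2,3,5) equals0I M.r_neg in_mono)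
  then show "stable_subspace M (carrier L) W"
    using e a by (auto simp: stable_subspace_def linear_subspace_def lie_submodule_def)
next
  assume a: "stable_subspace M (carrier L) W"
  note d = stable_subspaceD[OF a]
  have "submodule W complex_ring M"
    by (rule submoduleI) (use d in \<open>auto simp: neg_eq_smult subset_iff\<close>)
  then show "lie_submodule L M W" using d by (simp add: lie_submodule_def)
qed

lemma stable_carrier: "S \<subseteq> carrier L \<Longrightarrow> stable_subspace M S (carrier M)"
  by (rule stable_subspaceI) (auto intro: action_closed)

lemma stable_zero: "S \<subseteq> carrier L \<Longrightarrow> stable_subspace M S {\<zero>\<^bsub>M\<^esub>}"
  by (rule stable_subspaceI) (auto simp: msimps)

lemma stable_sum:
  assumes "stable_subspace M S U" "stable_subspace M S W" "S \<subseteq> carrier L"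
  shows "stable_subspace M S {u \<oplus>\<^bsub>M\<^esub> w | u w. u \<in> U \<and> w \<in> W}"
proof -
  note d = stable_subspaceD[OF assms(1)] stable_subspaceD[OF assms(2)]
  show ?thesis
  proof (rule stable_subspaceI)
    show "{u \<oplus>\<^bsub>M\<^esub> w |u w. u \<in> U \<and> w \<in> W} \<subseteq> carrier M" using d(2,8) by auto
    show "\<zero>\<^bsub>M\<^esub> \<in> {u \<oplus>\<^bsub>M\<^esub> w |u w. u \<in> U \<and> w \<in> W}" using d(3,9) by force
  next
    fix m n assume "m \<in> {u \<oplus>\<^bsub>M\<^esub> w |u w. u \<in> U \<and> w \<in> W}" "n \<in> {u \<oplus>\<^bsub>M\<^esub> w |u w. u \<in> U \<and> w \<in> W}"
    then obtain u w u' w' where e: "m = u \<oplus>\<^bsub>M\<^esub> w" "n = u' \<oplus>\<^bsub>M\<^esub> w'" "u \<in> U" "u' \<in> U" "w \<in> W" "w' \<in> W"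
      by blast
    have "m \<oplus>\<^bsub>M\<^esub> n = (u \<oplus>\<^bsub>M\<^esub> u') \<oplus>\<^bsub>M\<^esub> (w \<oplus>\<^bsub>M\<^esub> w')"
      using e d(2,8) by (simp add: M.a_ac)
    then show "m \<oplus>\<^bsub>M\<^esub> n \<in> {u \<oplus>\<^bsub>M\<^esub> w |u w. u \<in> U \<and> w \<in> W}" using e d(4,10) by blast
  next
    fix a m assume "m \<in> {u \<oplus>\<^bsub>M\<^esub> w |u w. u \<in> U \<and> w \<in> W}"
    then show "a \<odot>\<^bsub>M\<^esub> m \<in> {u \<oplus>\<^bsub>M\<^esub> w |u w. u \<in> U \<and> w \<in> W}"
      using d(2,5,8,11) msimps(2) by (smt (verit) mem_Collect_eq)
  next
    fix x m assume "x \<in> S" "m \<in> {u \<oplus>\<^bsub>M\<^esub> w |u w. u \<in> U \<and> w \<in> W}"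
    then show "action M x m \<in> {u \<oplus>\<^bsub>M\<^esub> w |u w. u \<in> U \<and> w \<in> W}"
      using d(2,6,8,12) action_add assms(3) by (smt (verit) mem_Collect_eq subsetD)
  qed
qed

end

definition lie_hom ::
    "'l lie_alg \<Rightarrow> ('l, 'e) lie_rep \<Rightarrow> ('l, 'f) lie_rep \<Rightarrow> ('e \<Rightarrow> 'f) \<Rightarrow> bool" where
  "lie_hom L M M' \<psi> \<longleftrightarrow> \<psi> ` carrier M \<subseteq> carrier M' \<and>
    (\<forall>m\<in>carrier M. \<forall>n\<in>carrier M. \<psi> (m \<oplus>\<^bsub>M\<^esub> n) = \<psi> m \<oplus>\<^bsub>M'\<^esub> \<psi> n) \<and>
    (\<forall>a. \<forall>m\<in>carrier M. \<psi> (a \<odot>\<^bsub>M\<^esub> m) = a \<odot>\<^bsub>M'\<^esub> \<psi> m) \<and>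
    (\<forall>x\<in>carrier L. \<forall>m\<in>carrier M. \<psi> (action M x m) = action M' x (\<psi> m))"

lemma lie_homD:
  assumes "lie_hom L M M' \<psi>"
  shows "m \<in> carrier M \<Longrightarrow> \<psi> m \<in> carrier M'"
    "m \<in> carrier M \<Longrightarrow> n \<in> carrier M \<Longrightarrow> \<psi> (m \<oplus>\<^bsub>M\<^esub> n) = \<psi> m \<oplus>\<^bsub>M'\<^esub> \<psi> n"
    "m \<in> carrier M \<Longrightarrow> \<psi> (a \<odot>\<^bsub>M\<^esub> m) = a \<odot>\<^bsub>M'\<^esub> \<psi> m"
    "x \<in> carrier L \<Longrightarrow> m \<in> carrier M \<Longrightarrow> \<psi> (action M x m) = action M' x (\<psi> m)"
  using assms by (auto simp: lie_hom_def)

lemma lie_hom_comp: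
  assumes "lie_hom L M M' \<psi>" "lie_hom L M' M'' \<psi>'"
  shows "lie_hom L M M'' (\<psi>' \<circ> \<psi>)"
  using assms by (simp add: lie_hom_def image_subset_iff)

lemma lie_hom_zero:
  assumes "lie_hom L M M' \<psi>" "lie_module L M" "lie_module L M'"
  shows "\<psi> \<zero>\<^bsub>M\<^esub> = \<zero>\<^bsub>M'\<^esub>"
proof -
  interpret M: lie_module L M by fact
  interpret M': lie_module L M' by fact
  have "\<psi> (0 \<odot>\<^bsub>M\<^esub> \<zero>\<^bsub>M\<^esub>) = 0 \<odot>\<^bsub>M'\<^esub> \<psi> \<zero>\<^bsub>M\<^esub>" using lie_homD(3)[OF assms(1)] M.zero_closed by blast
  then show ?thesis using lie_homD(1)[OF assms(1) M.zero_closed] by (simp add: M.msimps M'.msimps)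
qed

lemma stable_image:
  assumes "lie_hom L M M' \<psi>" "lie_module L M" "lie_module L M'" "stable_subspace M S W" "S \<subseteq> carrier L"
  shows "stable_subspace M' S (\<psi> ` W)"
proof -
  note h = lie_homD[OF assms(1)] note d = stable_subspaceD[OF assms(4)]
  show ?thesis
  proof (rule stable_subspaceI)
    show "\<zero>\<^bsub>M'\<^esub> \<in> \<psi> ` W" using lie_hom_zero[OF assms(1-3)] d(3) by force
    show "m \<oplus>\<^bsub>M'\<^esub> n \<in> \<psi> ` W" if "m \<in> \<psi> ` W" "n \<in> \<psi> ` W" for m n
      using that h(2) d(2,4) by (smt (verit) image_iff)
    show "a \<odot>\<^bsub>M'\<^esub> m \<in> \<psi> ` W" if "m \<in> \<psi> ` W" for a m
      using that h(3) d(2,5) by (smt (verit) image_iff)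
    show "action M' x m \<in> \<psi> ` W" if "x \<in> S" "m \<in> \<psi> ` W" for x m
      using that h(4) d(2,6) assms(5) by (smt (verit) image_iff subsetD)
  qed (use h(1) d(2) in auto)
qed

lemma stable_vimage:
  assumes "lie_hom L M M' \<psi>" "lie_module L M" "lie_module L M'" "stable_subspace M' S W" "S \<subseteq> carrier L"
  shows "stable_subspace M S {m \<in> carrier M. \<psi> m \<in> W}"
proof -
  interpret M: lie_module L M by fact
  note h = lie_homD[OF assms(1)] note d = stable_subspaceD[OF assms(4)]
  show ?thesis
    by (rule stable_subspaceI)
      (use h d assms(5) M.action_closed lie_hom_zero[OF assms(1-3)] in auto)
qed

text \<open>Module axioms pass to any surjective image, which spares their verification for quotients.\<close>

lemma lie_module_image:
  assumes "lie_module L M" "lie_hom L M M' \<psi>" "carrier M' = \<psi> ` carrier M" "\<zero>\<^bsub>M'\<^esub> = \<psi> \<zero>\<^bsub>M\<^esub>"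
  shows "lie_module L M'"
proof -
  interpret M: lie_module L M by fact
  have h: "m \<in> carrier M \<Longrightarrow> n \<in> carrier M \<Longrightarrow> \<psi> m \<oplus>\<^bsub>M'\<^esub> \<psi> n = \<psi> (m \<oplus>\<^bsub>M\<^esub> n)"
    "m \<in> carrier M \<Longrightarrow> a \<odot>\<^bsub>M'\<^esub> \<psi> m = \<psi> (a \<odot>\<^bsub>M\<^esub> m)"
    "x \<in> carrier L \<Longrightarrow> m \<in> carrier M \<Longrightarrow> action M' x (\<psi> m) = \<psi> (action M x m)" for m n a x
    using lie_homD[OF assms(2)] by auto
  have br: "action M y (action M x m) \<oplus>\<^bsub>M\<^esub> action M (lbracket L x y) m = action M x (action M y m)"
    if "x \<in> carrier L" "y \<in> carrier L" "m \<in> carrier M" for x y m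
    using M.bracket_action'[OF that] that by (simp add: M.a_comm M.action_closed M.bracket_closed)
  show ?thesis
    by (rule lie_moduleI[OF M.lie_algebra_axioms])
      (auto simp: assms(3,4) h br M.a_ac M.action_closed M.msimps M.action_add M.action_smult
        M.add_action M.scale_action M.bracket_action' M.bracket_closed M.carrier_add M.carrier_scale)
qed

lemma coset_rep_in:
  assumes "lie_module L M" "stable_subspace M (carrier L) N" "m \<in> carrier M"
  shows "\<exists>n\<in>N. coset_rep M N m = n \<oplus>\<^bsub>M\<^esub> m"
proof -
  have "\<zero>\<^bsub>M\<^esub> \<oplus>\<^bsub>M\<^esub> m \<in> N +>\<^bsub>M\<^esub> m"
    using stable_subspaceD[OF assms(2)] by (auto simp: a_r_coset_def')
  then have "coset_rep M N m \<in> N +>\<^bsub>M\<^esub> m" unfolding coset_rep_def by (rule someI)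
  then show ?thesis by (auto simp: a_r_coset_def')
qed

text \<open>The two cosets are equal as sets, hence so are the representatives chosen from them.\<close>

lemma coset_rep_absorb:
  assumes "lie_module L M" "stable_subspace M (carrier L) N" "m \<in> carrier M" "n \<in> N"
  shows "coset_rep M N (n \<oplus>\<^bsub>M\<^esub> m) = coset_rep M N m"
proof -
  interpret M: lie_module L M by fact
  note d = stable_subspaceD[OF assms(2)]
  have n: "n \<in> carrier M" using d assms by auto
  have i: "\<ominus>\<^bsub>M\<^esub> n \<in> N" using d(5)[OF assms(4), of "-1"] n by (simp add: M.neg_eq_smult)
  have "N +>\<^bsub>M\<^esub> (n \<oplus>\<^bsub>M\<^esub> m) = N +>\<^bsub>M\<^esub> m"
  proof
    show "N +>\<^bsub>M\<^esub> (n \<oplus>\<^bsub>M\<^esub> m) \<subseteq> N +>\<^bsub>M\<^esub> m"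
    proof
      fix x assume "x \<in> N +>\<^bsub>M\<^esub> (n \<oplus>\<^bsub>M\<^esub> m)"
      then obtain k where k: "k \<in> N" "x = k \<oplus>\<^bsub>M\<^esub> (n \<oplus>\<^bsub>M\<^esub> m)" by (auto simp: a_r_coset_def')
      then have "x = (k \<oplus>\<^bsub>M\<^esub> n) \<oplus>\<^bsub>M\<^esub> m" using n d(2) assms(3) by (simp add: M.a_assoc)
      then show "x \<in> N +>\<^bsub>M\<^esub> m" using d(4)[OF k(1) assms(4)] by (auto simp: a_r_coset_def')
    qed
    show "N +>\<^bsub>M\<^esub> m \<subseteq> N +>\<^bsub>M\<^esub> (n \<oplus>\<^bsub>M\<^esub> m)"
    proof
      fix x assume "x \<in> N +>\<^bsub>M\<^esub> m"
      then obtain k where k: "k \<in> N" "x = k \<oplus>\<^bsub>M\<^esub> m" by (auto simp: a_r_coset_def')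
      then have "x = (k \<oplus>\<^bsub>M\<^esub> \<ominus>\<^bsub>M\<^esub> n) \<oplus>\<^bsub>M\<^esub> (n \<oplus>\<^bsub>M\<^esub> m)" using n d(2) assms(3)
        by (simp add: M.a_assoc M.r_neg2 M.r_neg1)
      then show "x \<in> N +>\<^bsub>M\<^esub> (n \<oplus>\<^bsub>M\<^esub> m)" using d(4)[OF k(1) i] by (auto simp: a_r_coset_def')
    qed
  qed
  then show ?thesis by (simp add: coset_rep_def)
qed

lemma quotient_module_hom:
  assumes "lie_module L M" "stable_subspace M (carrier L) N"
  shows "lie_hom L M (quotient_module M N) (coset_rep M N)"
proof -
  interpret M: lie_module L M by fact
  note d = stable_subspaceD[OF assms(2)]
  show ?thesis unfolding lie_hom_def
  proof (intro conjI ballI allI)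
    fix m n assume mn: "m \<in> carrier M" "n \<in> carrier M"
    obtain k l where kl: "k \<in> N" "l \<in> N" "coset_rep M N m = k \<oplus>\<^bsub>M\<^esub> m" "coset_rep M N n = l \<oplus>\<^bsub>M\<^esub> n"
      using coset_rep_in[OF assms] mn by meson
    have "(k \<oplus>\<^bsub>M\<^esub> m) \<oplus>\<^bsub>M\<^esub> (l \<oplus>\<^bsub>M\<^esub> n) = (k \<oplus>\<^bsub>M\<^esub> l) \<oplus>\<^bsub>M\<^esub> (m \<oplus>\<^bsub>M\<^esub> n)" using kl mn d(2)
      by (simp add: M.a_ac)
    then show "coset_rep M N (m \<oplus>\<^bsub>M\<^esub> n)
        = coset_rep M N m \<oplus>\<^bsub>quotient_module M N\<^esub> coset_rep M N n"
      using kl mn d by (simp add: quotient_module_def coset_rep_absorb[OF assms])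
  next
    fix a m assume m: "m \<in> carrier M"
    obtain k where k: "k \<in> N" "coset_rep M N m = k \<oplus>\<^bsub>M\<^esub> m" using coset_rep_in[OF assms m] by blast
    then show "coset_rep M N (a \<odot>\<^bsub>M\<^esub> m) = a \<odot>\<^bsub>quotient_module M N\<^esub> coset_rep M N m"
      using m d by (simp add: quotient_module_def M.msimps coset_rep_absorb[OF assms])
  next
    fix x m assume m: "x \<in> carrier L" "m \<in> carrier M"
    obtain k where k: "k \<in> N" "coset_rep M N m = k \<oplus>\<^bsub>M\<^esub> m" using coset_rep_in[OF assms m(2)] by blast
    then show "coset_rep M N (action M x m) = action (quotient_module M N) x (coset_rep M N m)"
      using m d by (simp add: quotient_module_def M.action_add M.action_closed coset_rep_absorb[OF assms])
  qed (simp add: quotient_module_def)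
qed

lemma quotient_module_lie_module:
  assumes "lie_module L M" "stable_subspace M (carrier L) N"
  shows "lie_module L (quotient_module M N)"
  by (rule lie_module_image[OF assms(1) quotient_module_hom[OF assms]]) (simp_all add: quotient_module_def)

lemma coset_rep_eq_zero_iff:
  assumes "lie_module L M" "stable_subspace M (carrier L) N" "m \<in> carrier M"
  shows "coset_rep M N m = \<zero>\<^bsub>quotient_module M N\<^esub> \<longleftrightarrow> m \<in> N"
proof -
  interpret M: lie_module L M by fact
  note d = stable_subspaceD[OF assms(2)]
  have z: "\<zero>\<^bsub>quotient_module M N\<^esub> = coset_rep M N \<zero>\<^bsub>M\<^esub>" by (simp add: quotient_module_def)
  show ?thesis
  proof
    assume "m \<in> N"
    then show "coset_rep M N m = \<zero>\<^bsub>quotient_module M N\<^esub>"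
      using coset_rep_absorb[OF assms(1,2), of "\<zero>\<^bsub>M\<^esub>" m] d z by simp
  next
    assume e: "coset_rep M N m = \<zero>\<^bsub>quotient_module M N\<^esub>"
    obtain k l where kl: "k \<in> N" "l \<in> N" "coset_rep M N m = k \<oplus>\<^bsub>M\<^esub> m"
        "coset_rep M N \<zero>\<^bsub>M\<^esub> = l \<oplus>\<^bsub>M\<^esub> \<zero>\<^bsub>M\<^esub>"
      using coset_rep_in[OF assms(1,2)] assms(3) M.zero_closed by meson
    then have "k \<oplus>\<^bsub>M\<^esub> m = l" using e z d by auto
    then have "m = (-1) \<odot>\<^bsub>M\<^esub> k \<oplus>\<^bsub>M\<^esub> l"
      using kl d(2) assms(3) M.r_neg1[of k m] by (auto simp: M.neg_eq_smult)
    then show "m \<in> N" using kl d by auto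
  qed
qed

lemma kernel_stable:
  assumes "lie_hom L M M' \<psi>" "lie_module L M" "lie_module L M'"
  shows "stable_subspace M (carrier L) {m \<in> carrier M. \<psi> m = \<zero>\<^bsub>M'\<^esub>}"
  using stable_vimage[OF assms lie_module.stable_zero[OF assms(3) subset_refl]] by simp

text \<open>The isomorphism goes from the image to the quotient, which is the direction in which the
  irreducible quotients are compared later: a point is sent to the representative of the coset that
  is its fibre.\<close>

lemma first_isomorphism:
  assumes \<psi>: "lie_hom L M M' \<psi>" and M: "lie_module L M" and M': "lie_module L M'"
    and surj: "carrier M' = \<psi> ` carrier M"
  defines "K \<equiv> {m \<in> carrier M. \<psi> m = \<zero>\<^bsub>M'\<^esub>}"
  shows "lie_module_iso L M' (quotient_module M K)"
proof -
  interpret M: lie_module L M by fact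
  interpret M': lie_module L M' by fact
  have K: "stable_subspace M (carrier L) K" unfolding K_def by (rule kernel_stable[OF \<psi> M M'])
  let ?Q = "quotient_module M K"
  let ?q = "coset_rep M K"
  note h = lie_homD[OF \<psi>] and q = lie_homD[OF quotient_module_hom[OF M K]]
  define \<chi> where "\<chi> y = ?q (SOME m. m \<in> carrier M \<and> \<psi> m = y)" for y
  have eq: "?q m = ?q n \<longleftrightarrow> \<psi> m = \<psi> n" if mn: "m \<in> carrier M" "n \<in> carrier M" for m n
  proof -
    have eqs: "\<psi> (m \<oplus>\<^bsub>M\<^esub> (-1) \<odot>\<^bsub>M\<^esub> n) = \<psi> m \<ominus>\<^bsub>M'\<^esub> \<psi> n" using mn h
      by (simp add: M'.minus_eq M'.neg_eq_smult)
    interpret Q: lie_module L ?Q by (rule quotient_module_lie_module[OF M K])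
    have eqq: "?q (m \<oplus>\<^bsub>M\<^esub> (-1) \<odot>\<^bsub>M\<^esub> n) = ?q m \<ominus>\<^bsub>?Q\<^esub> ?q n" using mn q
      by (simp add: Q.minus_eq Q.neg_eq_smult)
    have "?q m = ?q n \<longleftrightarrow> ?q m \<ominus>\<^bsub>?Q\<^esub> ?q n = \<zero>\<^bsub>?Q\<^esub>"
      using Q.minus_eq_zero_iff q(1) mn by simp
    also have "\<dots> \<longleftrightarrow> m \<oplus>\<^bsub>M\<^esub> (-1) \<odot>\<^bsub>M\<^esub> n \<in> K"
      unfolding eqq[symmetric] by (rule coset_rep_eq_zero_iff[OF M K]) (use mn in simp)
    also have "\<dots> \<longleftrightarrow> \<psi> m \<ominus>\<^bsub>M'\<^esub> \<psi> n = \<zero>\<^bsub>M'\<^esub>" using mn by (simp add: K_def eqs)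
    also have "\<dots> \<longleftrightarrow> \<psi> m = \<psi> n" using M'.minus_eq_zero_iff h(1) mn by simp
    finally show ?thesis .
  qed
  have \<chi>: "\<chi> (\<psi> m) = ?q m" if "m \<in> carrier M" for m
  proof -
    have "(SOME n. n \<in> carrier M \<and> \<psi> n = \<psi> m) \<in> carrier M \<and> \<psi> (SOME n. n \<in> carrier M \<and> \<psi> n = \<psi> m) = \<psi> m"
      by (rule someI[of _ m]) (use that in simp)
    then show ?thesis using eq that unfolding \<chi>_def by blast
  qed
  have cQ: "carrier ?Q = ?q ` carrier M" by (simp add: quotient_module_def)
  show ?thesis unfolding lie_module_iso_def
  proof (intro exI conjI ballI allI)
    show "bij_betw \<chi> (carrier M') (carrier ?Q)"
      unfolding bij_betw_def cQ surj inj_on_def using \<chi> eq by (auto simp: image_image)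
  qed (unfold surj, auto simp: \<chi> q h(2-4)[symmetric] M.action_closed)
qed

section \<open>Modules generated by an irreducible top component\<close>

text \<open>A union rather than a sum: under the assumptions of the following locale the proper submodules
  form a directed family.\<close>

definition maximal_submodule :: "'l lie_alg \<Rightarrow> ('l, 'e) lie_rep \<Rightarrow> 'e set" where
  "maximal_submodule L M = \<Union>{N. stable_subspace M (carrier L) N \<and> N \<noteq> carrier M}"

text \<open>The situation of a highest weight module, with weight spaces replaced by what is needed of them.
  The algebra \<open>H\<close> acts irreducibly on the top component \<open>V0\<close>, and the operators in \<open>D\<close> split it off:
  \<open>\<pi> m\<close> is the component of \<open>m\<close> in \<open>V0\<close>, which a polynomial in the operators \<open>D\<close> extracts from \<open>m\<close>.
  The last assumption says this without mentioning weights.\<close>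

locale top_component = lie_module L M
  for L :: "'l::ab_group_add lie_alg" and M :: "('l, 'e) lie_rep" (structure) +
  fixes H D :: "'l set" and V0 :: "'e set" and \<pi> :: "'e \<Rightarrow> 'e"
  assumes H: "H \<subseteq> carrier L" and D: "D \<subseteq> carrier L"
    and V0_stable: "stable_subspace M H V0" and V0_nonzero: "V0 \<noteq> {\<zero>\<^bsub>M\<^esub>}"
    and V0_irreducible: "\<lbrakk>stable_subspace M H W; W \<subseteq> V0\<rbrakk> \<Longrightarrow> W = {\<zero>\<^bsub>M\<^esub>} \<or> W = V0"
    and V0_generates: "\<lbrakk>stable_subspace M (carrier L) W; V0 \<subseteq> W\<rbrakk> \<Longrightarrow> W = carrier M"
    and \<pi>_V0: "m \<in> carrier M \<Longrightarrow> \<pi> m \<in> V0"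
    and \<pi>_add: "\<lbrakk>m \<in> carrier M; n \<in> carrier M\<rbrakk> \<Longrightarrow> \<pi> (m \<oplus>\<^bsub>M\<^esub> n) = \<pi> m \<oplus>\<^bsub>M\<^esub> \<pi> n"
    and \<pi>_id: "m \<in> V0 \<Longrightarrow> \<pi> m = m"
    and \<pi>_stable: "\<lbrakk>stable_subspace M D W; m \<in> W\<rbrakk> \<Longrightarrow> \<pi> m \<in> W"
begin

lemma stable_mono: "S \<subseteq> S' \<Longrightarrow> stable_subspace M S' W \<Longrightarrow> stable_subspace M S W"
  by (auto simp: stable_subspace_def)

lemma stable_Int:
  "stable_subspace M S U \<Longrightarrow> stable_subspace M S W \<Longrightarrow> stable_subspace M S (U \<inter> W)"
  unfolding stable_subspace_def linear_subspace_def by blast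

lemma zero_V0: "\<zero>\<^bsub>M\<^esub> \<in> V0" by (rule stable_subspaceD(3)[OF V0_stable])

text \<open>A submodule \<open>N\<close> contains \<open>\<pi> N\<close>. Since \<open>N \<inter> V0\<close> is zero or \<open>V0\<close> by irreducibility, and the
  second case forces \<open>N\<close> to be everything, \<open>\<pi>\<close> vanishes on a proper \<open>N\<close>. The condition \<open>\<pi> = 0\<close>
  is linear, so it is inherited by sums of proper submodules; this is why there is a largest one.\<close>

lemma proper_iff:
  assumes "stable_subspace M (carrier L) N"
  shows "N \<noteq> carrier M \<longleftrightarrow> (\<forall>m\<in>N. \<pi> m = \<zero>\<^bsub>M\<^esub>)"
proof
  assume n: "N \<noteq> carrier M"
  note d = stable_subspaceD[OF assms] stable_subspaceD[OF V0_stable]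
  have "stable_subspace M H (N \<inter> V0)"
    by (rule stable_Int[OF stable_mono[OF H assms] V0_stable])
  moreover have "N \<inter> V0 \<noteq> V0" using V0_generates[OF assms] n by blast
  ultimately have z: "N \<inter> V0 = {\<zero>\<^bsub>M\<^esub>}" using V0_irreducible by blast
  show "\<forall>m\<in>N. \<pi> m = \<zero>\<^bsub>M\<^esub>"
  proof
    fix m assume "m \<in> N"
    then have "\<pi> m \<in> N \<inter> V0" using \<pi>_stable[OF stable_mono[OF D assms]] \<pi>_V0 d(2) by blast
    then show "\<pi> m = \<zero>\<^bsub>M\<^esub>" using z by blast
  qed
next
  assume "\<forall>m\<in>N. \<pi> m = \<zero>\<^bsub>M\<^esub>"
  moreover obtain v where "v \<in> V0" "v \<noteq> \<zero>\<^bsub>M\<^esub>" using V0_nonzero zero_V0 by blast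
  ultimately show "N \<noteq> carrier M" using \<pi>_id stable_subspaceD(2)[OF V0_stable] by metis
qed

lemma proper_sum:
  assumes "stable_subspace M (carrier L) N" "N \<noteq> carrier M"
    and "stable_subspace M (carrier L) N'" "N' \<noteq> carrier M"
  shows "{u \<oplus>\<^bsub>M\<^esub> w | u w. u \<in> N \<and> w \<in> N'} \<noteq> carrier M"
proof -
  have "\<forall>m\<in>{u \<oplus>\<^bsub>M\<^esub> w | u w. u \<in> N \<and> w \<in> N'}. \<pi> m = \<zero>\<^bsub>M\<^esub>"
  proof safe
    fix u w assume uw: "u \<in> N" "w \<in> N'"
    then have "u \<in> carrier M" "w \<in> carrier M" using assms(1,3) by (auto dest: stable_subspaceD)
    then show "\<pi> (u \<oplus>\<^bsub>M\<^esub> w) = \<zero>\<^bsub>M\<^esub>"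
      using uw \<pi>_add proper_iff assms by simp
  qed
  then show ?thesis using proper_iff[OF stable_sum[OF assms(1,3)]] by blast
qed

lemma maximal_submodule_stable: "stable_subspace M (carrier L) (maximal_submodule L M)"
proof (rule stable_subspaceI)
  let ?S = "maximal_submodule L M"
  show "?S \<subseteq> carrier M" by (auto simp: maximal_submodule_def dest: stable_subspaceD)
  have "carrier M \<noteq> {\<zero>\<^bsub>M\<^esub>}" using V0_nonzero zero_V0 stable_subspaceD(1)[OF V0_stable] by auto
  then show "\<zero>\<^bsub>M\<^esub> \<in> ?S" unfolding maximal_submodule_def
    using stable_zero[OF subset_refl] by blast
next
  fix m n assume "m \<in> maximal_submodule L M" "n \<in> maximal_submodule L M"
  then obtain N N' where N: "stable_subspace M (carrier L) N" "N \<noteq> carrier M" "m \<in> N"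
    "stable_subspace M (carrier L) N'" "N' \<noteq> carrier M" "n \<in> N'" by (auto simp: maximal_submodule_def)
  then show "m \<oplus>\<^bsub>M\<^esub> n \<in> maximal_submodule L M" unfolding maximal_submodule_def
    using proper_sum[OF N(1,2,4,5)] stable_sum[OF N(1,4) subset_refl] by blast
qed (auto simp: maximal_submodule_def dest: stable_subspaceD)

lemma maximal_submodule_proper: "maximal_submodule L M \<noteq> carrier M"
  unfolding proper_iff[OF maximal_submodule_stable]
  using proper_iff by (auto simp: maximal_submodule_def)

lemma proper_le_maximal:
  "stable_subspace M (carrier L) N \<Longrightarrow> N \<noteq> carrier M \<Longrightarrow> N \<subseteq> maximal_submodule L M"
  by (auto simp: maximal_submodule_def)

lemma sum_proper_submodules_eq: "sum_proper_submodules L M = maximal_submodule L M"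
proof
  show "sum_proper_submodules L M \<subseteq> maximal_submodule L M"
    unfolding sum_proper_submodules_def lie_submodule_iff
    using maximal_submodule_stable proper_le_maximal by blast
  show "maximal_submodule L M \<subseteq> sum_proper_submodules L M"
    unfolding sum_proper_submodules_def lie_submodule_iff
    using maximal_submodule_stable maximal_submodule_proper by blast
qed

lemma quotient_maximal_irreducible:
  "irreducible_lie_module L (quotient_module M (maximal_submodule L M))"
proof -
  let ?S = "maximal_submodule L M"
  let ?Q = "quotient_module M ?S"
  note mod = lie_module_axioms
  note S = maximal_submodule_stable
  note hom = quotient_module_hom[OF mod S]
  have Q: "lie_module L ?Q" by (rule quotient_module_lie_module[OF mod S])
  have cQ: "carrier ?Q = coset_rep M ?S ` carrier M" by (simp add: quotient_module_def)
  note zero_iff = coset_rep_eq_zero_iff[OF mod S]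
  show ?thesis unfolding irreducible_lie_module_def lie_module.lie_submodule_iff[OF Q]
  proof (intro conjI allI impI Q)
    obtain m where "m \<in> carrier M" "m \<notin> ?S"
      using maximal_submodule_proper stable_subspaceD(1)[OF S] by blast
    then show "carrier ?Q \<noteq> {\<zero>\<^bsub>?Q\<^esub>}" unfolding cQ using zero_iff by blast
  next
    fix W assume W: "stable_subspace ?Q (carrier L) W"
    let ?U = "{m \<in> carrier M. coset_rep M ?S m \<in> W}"
    have U: "stable_subspace M (carrier L) ?U" by (rule stable_vimage[OF hom mod Q W]) simp
    have WU: "W = coset_rep M ?S ` ?U" using stable_subspaceD(1)[OF W] unfolding cQ by blast
    show "W = {\<zero>\<^bsub>?Q\<^esub>} \<or> W = carrier ?Q"
    proof (cases "?U = carrier M")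
      case True then show ?thesis using WU cQ by simp
    next
      case False
      then have "?U \<subseteq> ?S" by (rule proper_le_maximal[OF U])
      then have "\<forall>m\<in>?U. coset_rep M ?S m = \<zero>\<^bsub>?Q\<^esub>" using zero_iff by blast
      then have "coset_rep M ?S ` ?U \<subseteq> {\<zero>\<^bsub>?Q\<^esub>}" by blast
      then have "W \<subseteq> {\<zero>\<^bsub>?Q\<^esub>}" by (simp only: WU[symmetric])
      then show ?thesis using stable_subspaceD(3)[OF W] by blast
    qed
  qed
qed

text \<open>The kernel is proper, so it lies in the maximal submodule. The image of the maximal submodule is
  zero or everything; in the latter case kernel and maximal submodule together would span the
  module, although the former lies in the latter.\<close>

lemma kernel_eq_maximal:
  assumes \<psi>: "lie_hom L M M' \<psi>" and M': "irreducible_lie_module L M'" and surj: "carrier M' = \<psi> ` carrier M"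
  shows "{m \<in> carrier M. \<psi> m = \<zero>\<^bsub>M'\<^esub>} = maximal_submodule L M" (is "?K = ?S")
proof
  have mX: "lie_module L M'" and nz: "carrier M' \<noteq> {\<zero>\<^bsub>M'\<^esub>}"
    and irr: "\<And>N. stable_subspace M' (carrier L) N \<Longrightarrow> N = {\<zero>\<^bsub>M'\<^esub>} \<or> N = carrier M'"
    using M' by (auto simp: irreducible_lie_module_def lie_module.lie_submodule_iff)
  interpret M': lie_module L M' by (rule mX)
  note mod = lie_module_axioms
  note h = lie_homD[OF \<psi>]
  have K: "stable_subspace M (carrier L) ?K" by (rule kernel_stable[OF \<psi> mod mX])
  have "?K \<noteq> carrier M"
  proof
    assume "?K = carrier M"
    then have "carrier M' \<subseteq> {\<zero>\<^bsub>M'\<^esub>}" unfolding surj by blast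
    then show False using nz M'.zero_closed by blast
  qed
  then show "?K \<subseteq> ?S" by (rule proper_le_maximal[OF K])
  note S = maximal_submodule_stable
  have "\<psi> ` ?S \<noteq> carrier M'"
  proof
    assume e: "\<psi> ` ?S = carrier M'"
    have "carrier M \<subseteq> ?S"
    proof
      fix m assume m: "m \<in> carrier M"
      then obtain s where s: "s \<in> ?S" "\<psi> s = \<psi> m" using e surj by (metis imageE imageI)
      have sc: "s \<in> carrier M" using s S by (auto dest: stable_subspaceD)
      have "\<psi> (m \<oplus>\<^bsub>M\<^esub> (-1) \<odot>\<^bsub>M\<^esub> s) = \<zero>\<^bsub>M'\<^esub>"
        using m sc h s by (simp add: M'.neg_eq_smult[symmetric] M'.r_neg)
      then have "m \<oplus>\<^bsub>M\<^esub> (-1) \<odot>\<^bsub>M\<^esub> s \<in> ?S" using \<open>?K \<subseteq> ?S\<close> m sc by auto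
      then have "(m \<oplus>\<^bsub>M\<^esub> (-1) \<odot>\<^bsub>M\<^esub> s) \<oplus>\<^bsub>M\<^esub> s \<in> ?S" using s(1) S by (auto dest: stable_subspaceD)
      then show "m \<in> ?S" using m sc by (simp add: neg_eq_smult[symmetric] M.a_assoc M.l_neg)
    qed
    then show False using maximal_submodule_proper stable_subspaceD(1)[OF S] by blast
  qed
  then have "\<psi> ` ?S = {\<zero>\<^bsub>M'\<^esub>}" using irr[OF stable_image[OF \<psi> mod mX S subset_refl]] by blast
  then show "?S \<subseteq> ?K" using stable_subspaceD(1)[OF S] by blast
qed

lemma irreducible_quotient_iso:
  assumes "lie_hom L M M' \<psi>" and M': "irreducible_lie_module L M'" and "carrier M' = \<psi> ` carrier M"
  shows "lie_module_iso L M' (quotient_module M (maximal_submodule L M))"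
  using first_isomorphism[OF assms(1) lie_module_axioms _ assms(3)] M'
  unfolding kernel_eq_maximal[OF assms] irreducible_lie_module_def by blast

lemma unique_irreducible_quotient: "has_unique_irreducible_quotient L M"
  unfolding has_unique_irreducible_quotient_def lie_submodule_iff
proof (intro conjI ex1I lie_module_axioms)
  fix N assume N: "stable_subspace M (carrier L) N \<and> irreducible_lie_module L (quotient_module M N)"
  have "{m \<in> carrier M. coset_rep M N m = \<zero>\<^bsub>quotient_module M N\<^esub>} = maximal_submodule L M"
    by (rule kernel_eq_maximal[OF quotient_module_hom[OF lie_module_axioms]])
      (use N in \<open>auto simp: quotient_module_def\<close>)
  then show "N = maximal_submodule L M"
    using coset_rep_eq_zero_iff[OF lie_module_axioms] N stable_subspaceD(1) by blast
qed (rule maximal_submodule_stable quotient_maximal_irreducible)+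

text \<open>A quotient by the maximal submodule keeps the top component because \<open>\<pi>\<close> vanishes on it. This
  allows induction to be applied to an irreducible quotient again.\<close>

lemma quotient_top_component:
  defines "q \<equiv> coset_rep M (maximal_submodule L M)"
  shows "top_component L (quotient_module M (maximal_submodule L M)) H D (q ` V0) (\<lambda>y. q (\<pi> y))"
proof -
  let ?S = "maximal_submodule L M"
  let ?Q = "quotient_module M ?S"
  note mod = lie_module_axioms
  note S = maximal_submodule_stable
  have hom: "lie_hom L M ?Q q" unfolding q_def by (rule quotient_module_hom[OF mod S])
  have Q: "lie_module L ?Q" by (rule quotient_module_lie_module[OF mod S])
  interpret Q: lie_module L ?Q by (rule Q)
  have cQ: "carrier ?Q = q ` carrier M" by (simp add: quotient_module_def q_def)
  note zero_iff = coset_rep_eq_zero_iff[OF mod S, folded q_def]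
  note h = lie_homD[OF hom]
  have V0c: "v \<in> V0 \<Longrightarrow> v \<in> carrier M" for v using stable_subspaceD[OF V0_stable] by blast
  have \<pi>c: "m \<in> carrier M \<Longrightarrow> \<pi> m \<in> carrier M" for m using V0c \<pi>_V0 by blast
  have \<pi>q: "\<pi> (q m) = \<pi> m" if m: "m \<in> carrier M" for m
  proof -
    obtain s where s: "s \<in> ?S" "q m = s \<oplus>\<^bsub>M\<^esub> m" unfolding q_def using coset_rep_in[OF mod S m] by blast
    have "\<pi> s = \<zero>\<^bsub>M\<^esub>" using s proper_iff[OF S] maximal_submodule_proper by blast
    then show ?thesis using s m stable_subspaceD(2)[OF S] \<pi>c by (simp add: \<pi>_add)
  qed
  show ?thesis
  proof
    show "stable_subspace ?Q H (q ` V0)" by (rule stable_image[OF hom mod Q V0_stable H])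
    obtain v where v: "v \<in> V0" "v \<noteq> \<zero>\<^bsub>M\<^esub>" using V0_nonzero zero_V0 by blast
    have "v \<notin> ?S" using proper_iff[OF S] maximal_submodule_proper \<pi>_id v by auto
    then have "q v \<noteq> \<zero>\<^bsub>?Q\<^esub>" using zero_iff V0c v by simp
    then show "q ` V0 \<noteq> {\<zero>\<^bsub>?Q\<^esub>}" using v by blast
  next
    fix W assume W: "stable_subspace ?Q H W" "W \<subseteq> q ` V0"
    let ?U = "{m \<in> carrier M. q m \<in> W} \<inter> V0"
    have "stable_subspace M H {m \<in> carrier M. q m \<in> W}" by (rule stable_vimage[OF hom mod Q W(1) H])
    then have "stable_subspace M H ?U" using V0_stable by (rule stable_Int)
    moreover have "?U \<subseteq> V0" by blast
    ultimately have u: "?U = {\<zero>\<^bsub>M\<^esub>} \<or> ?U = V0" by (rule V0_irreducible)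
    have WU: "W = q ` ?U" using W(2) V0c by auto
    show "W = {\<zero>\<^bsub>?Q\<^esub>} \<or> W = q ` V0"
      using u
    proof
      assume u0: "?U = {\<zero>\<^bsub>M\<^esub>}"
      have "W = {q \<zero>\<^bsub>M\<^esub>}" using WU unfolding u0 by simp
      then show ?thesis using lie_hom_zero[OF hom mod Q] by simp
    next
      assume u0: "?U = V0"
      show ?thesis using WU unfolding u0 by blast
    qed
  next
    fix W assume W: "stable_subspace ?Q (carrier L) W" "q ` V0 \<subseteq> W"
    have "stable_subspace M (carrier L) {m \<in> carrier M. q m \<in> W}"
      by (rule stable_vimage[OF hom mod Q W(1)]) simp
    then have "{m \<in> carrier M. q m \<in> W} = carrier M" by (rule V0_generates) (use W(2) V0c in auto)
    from equalityD2[OF this] have "carrier ?Q \<subseteq> W" unfolding cQ by blast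
    then show "W = carrier ?Q" using stable_subspaceD(1)[OF W(1)] by simp
  next
    fix m assume "m \<in> carrier ?Q"
    then show "q (\<pi> m) \<in> q ` V0" unfolding cQ using \<pi>q \<pi>_V0 by auto
  next
    fix m n assume "m \<in> carrier ?Q" "n \<in> carrier ?Q"
    then obtain m' n' where "m = q m'" "n = q n'" "m' \<in> carrier M" "n' \<in> carrier M"
      unfolding cQ by blast
    then show "q (\<pi> (m \<oplus>\<^bsub>?Q\<^esub> n)) = q (\<pi> m) \<oplus>\<^bsub>?Q\<^esub> q (\<pi> n)"
      by (simp add: h(2)[symmetric] \<pi>q \<pi>_add \<pi>c)
  next
    fix m assume "m \<in> q ` V0"
    then show "q (\<pi> m) = m" using \<pi>q \<pi>_id V0c by auto
  next
    fix W m assume W: "stable_subspace ?Q D W" "m \<in> W"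
    obtain m' where m': "m' \<in> carrier M" "m = q m'" using W stable_subspaceD(1)[OF W(1)] cQ by blast
    have "stable_subspace M D {m \<in> carrier M. q m \<in> W}" by (rule stable_vimage[OF hom mod Q W(1) D])
    from \<pi>_stable[OF this, of m'] show "q (\<pi> m) \<in> W" using m' W \<pi>q by simp
  qed (rule H D)+
qed

end

section \<open>The free algebra and linear extension\<close>

abbreviation words :: "'a set \<Rightarrow> 'a word set" where
  "words S \<equiv> Word ` lists S"

lemma words_add: "v \<in> words S \<Longrightarrow> w \<in> words S \<Longrightarrow> v + w \<in> words S"
  by (auto simp: image_iff)

lemma words_zero: "0 \<in> words S"
  by (auto simp: zero_word_def)

lemma carrier_free_algebra: "carrier (free_algebra S) = {p. Poly_Mapping.keys p \<subseteq> words S}"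
  by (auto simp: free_algebra_def)

lemma free_algebra_simps [simp]:
  "p \<oplus>\<^bsub>free_algebra S\<^esub> q = p + q" "p \<otimes>\<^bsub>free_algebra S\<^esub> q = p * q"
  "\<zero>\<^bsub>free_algebra S\<^esub> = 0" "\<one>\<^bsub>free_algebra S\<^esub> = 1"
  by (simp_all add: free_algebra_def ring_of_type_algebra_def)

lemma free_algebra_closed:
  shows "0 \<in> carrier (free_algebra S)" "1 \<in> carrier (free_algebra S)" "scalar a \<in> carrier (free_algebra S)"
    "p \<in> carrier (free_algebra S) \<Longrightarrow> q \<in> carrier (free_algebra S) \<Longrightarrow> p + q \<in> carrier (free_algebra S)"
    "p \<in> carrier (free_algebra S) \<Longrightarrow> q \<in> carrier (free_algebra S) \<Longrightarrow> p * q \<in> carrier (free_algebra S)"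
    "p \<in> carrier (free_algebra S) \<Longrightarrow> - p \<in> carrier (free_algebra S)"
    "p \<in> carrier (free_algebra S) \<Longrightarrow> q \<in> carrier (free_algebra S) \<Longrightarrow> p - q \<in> carrier (free_algebra S)"
    "x \<in> S \<Longrightarrow> gen x \<in> carrier (free_algebra S)"
    "w \<in> words S \<Longrightarrow> Poly_Mapping.single w c \<in> carrier (free_algebra S)"
proof -
  show "p * q \<in> carrier (free_algebra S)"
    if pq: "p \<in> carrier (free_algebra S)" "q \<in> carrier (free_algebra S)"
    unfolding carrier_free_algebra
  proof (rule CollectI, rule subsetI)
    fix w assume "w \<in> Poly_Mapping.keys (p * q)"
    then obtain u v where "w = u + v" "u \<in> Poly_Mapping.keys p" "v \<in> Poly_Mapping.keys q"
      using keys_mult[of p q] by blast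
    then show "w \<in> words S" using pq words_add[of u S v] by (auto simp: carrier_free_algebra)
  qed
  have "0 \<in> words S" by (rule words_zero)
  then show "1 \<in> carrier (free_algebra S)" "scalar a \<in> carrier (free_algebra S)"
    by (simp_all add: carrier_free_algebra scalar_def single_one[symmetric] del: single_one)
  show "p + q \<in> carrier (free_algebra S)"
    if "p \<in> carrier (free_algebra S)" "q \<in> carrier (free_algebra S)"
    using subset_trans[OF keys_add Un_least] that by (simp add: carrier_free_algebra)
  show "p - q \<in> carrier (free_algebra S)"
    if "p \<in> carrier (free_algebra S)" "q \<in> carrier (free_algebra S)"
    using subset_trans[OF keys_diff Un_least] that by (simp add: carrier_free_algebra)
  show "gen x \<in> carrier (free_algebra S)" if "x \<in> S"
    using that by (simp add: carrier_free_algebra gen_def)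
qed (simp_all add: carrier_free_algebra)

lemma ring_free_algebra: "ring (free_algebra S)"
proof (rule ringI)
  show "abelian_group (free_algebra S)"
  proof (rule abelian_groupI)
    show "\<exists>y\<in>carrier (free_algebra S). y \<oplus>\<^bsub>free_algebra S\<^esub> x = \<zero>\<^bsub>free_algebra S\<^esub>"
      if "x \<in> carrier (free_algebra S)" for x
      using free_algebra_closed(6)[OF that] by (intro bexI[of _ "- x"]) simp_all
  qed (auto simp: free_algebra_closed add.assoc add.commute)
  show "Group.monoid (free_algebra S)"
    by (rule monoidI) (auto simp: free_algebra_closed mult.assoc)
qed (auto simp: distrib_left distrib_right)

lemma free_algebra_a_inv:
  assumes "p \<in> carrier (free_algebra S)"
  shows "\<ominus>\<^bsub>free_algebra S\<^esub> p = - p"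
proof -
  interpret R: ring "free_algebra S" by (rule ring_free_algebra)
  show ?thesis by (rule R.minus_equality) (use assms free_algebra_closed(6)[OF assms] in auto)
qed

lemma free_poly_eq_sum:
  fixes p :: "'a \<Rightarrow>\<^sub>0 'b::comm_monoid_add"
  shows "p = (\<Sum>w\<in>Poly_Mapping.keys p. Poly_Mapping.single w (Poly_Mapping.lookup p w))"
proof (rule poly_mapping_eqI)
  fix v
  have "Poly_Mapping.lookup (\<Sum>w\<in>Poly_Mapping.keys p. Poly_Mapping.single w (Poly_Mapping.lookup p w)) v
    = (\<Sum>w\<in>Poly_Mapping.keys p. if w = v then Poly_Mapping.lookup p w else 0)"
    unfolding lookup_sum by (intro sum.cong) (auto simp: lookup_single when_def)
  also have "\<dots> = Poly_Mapping.lookup p v"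
    by (simp add: sum.delta' in_keys_iff)
  finally show "Poly_Mapping.lookup p v =
    Poly_Mapping.lookup (\<Sum>w\<in>Poly_Mapping.keys p. Poly_Mapping.single w (Poly_Mapping.lookup p w)) v" ..
qed

text \<open>Elements of the free algebra on a subset are built from monomials in the words over that subset;
  \<open>K\<close> keeps track of these words.\<close>

lemma free_poly_induct [consumes 1, case_names zero single_add]:
  assumes "Poly_Mapping.keys p \<subseteq> K" "P 0"
    and step: "\<And>p w a. \<lbrakk>Poly_Mapping.keys p \<subseteq> K; w \<in> K; a \<noteq> 0; P p\<rbrakk> \<Longrightarrow> P (Poly_Mapping.single w a + p)"
  shows "P (p :: 'k \<Rightarrow>\<^sub>0 'b::comm_monoid_add)"
proof -
  have "A \<subseteq> K \<Longrightarrow> (\<And>w. w \<in> A \<Longrightarrow> c w \<noteq> 0) \<Longrightarrow> Poly_Mapping.keys (\<Sum>w\<in>A. Poly_Mapping.single w (c w)) \<subseteq> K \<and>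
      P (\<Sum>w\<in>A. Poly_Mapping.single w (c w))" if "finite A" for A and c :: "'k \<Rightarrow> 'b"
    using that
  proof (induction A)
    case empty then show ?case using assms by simp
  next
    case (insert x A)
    then have "Poly_Mapping.keys (\<Sum>w\<in>A. Poly_Mapping.single w (c w)) \<subseteq> K \<and>
      P (\<Sum>w\<in>A. Poly_Mapping.single w (c w))" by simp
    then show ?case
      using insert step keys_add[of "Poly_Mapping.single x (c x)" "\<Sum>w\<in>A. Poly_Mapping.single w (c w)"]
      by (auto split: if_splits)
  qed
  from this[OF finite_keys, of p "Poly_Mapping.lookup p"] show ?thesis
    using free_poly_eq_sum[of p] assms(1) by (simp add: in_keys_iff)
qed

text \<open>A function on words extends linearly to the free algebra. Both the action of the enveloping
  algebra on a module and the projection onto the top of an extended module arise in this way.\<close>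

definition lin_ext :: "('l, 'e) lie_rep \<Rightarrow> ('w \<Rightarrow> 'e) \<Rightarrow> ('w \<Rightarrow>\<^sub>0 complex) \<Rightarrow> 'e" where
  "lin_ext M h p = finsum M (\<lambda>w. Poly_Mapping.lookup p w \<odot>\<^bsub>M\<^esub> h w) (Poly_Mapping.keys p)"

context lie_module
begin

lemma lin_ext_superset:
  assumes "finite A" "Poly_Mapping.keys p \<subseteq> A" "h \<in> A \<rightarrow> carrier M"
  shows "lin_ext M h p = finsum M (\<lambda>w. Poly_Mapping.lookup p w \<odot>\<^bsub>M\<^esub> h w) A"
  unfolding lin_ext_def
  by (rule M.add.finprod_mono_neutral_cong_left) (use assms in \<open>auto simp: in_keys_iff msimps Pi_iff\<close>)

lemma lin_ext_zero [simp]: "lin_ext M h 0 = \<zero>\<^bsub>M\<^esub>"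
  by (simp add: lin_ext_def)

lemma lin_ext_closed:
  assumes "Poly_Mapping.keys p \<subseteq> K" "h \<in> K \<rightarrow> carrier M"
  shows "lin_ext M h p \<in> carrier M"
  unfolding lin_ext_def by (rule M.finsum_closed) (use assms in \<open>auto simp: Pi_iff\<close>)

lemma lin_ext_add:
  assumes "Poly_Mapping.keys p \<subseteq> K" "Poly_Mapping.keys q \<subseteq> K" "h \<in> K \<rightarrow> carrier M"
  shows "lin_ext M h (p + q) = lin_ext M h p \<oplus>\<^bsub>M\<^esub> lin_ext M h q"
proof -
  let ?A = "Poly_Mapping.keys p \<union> Poly_Mapping.keys q"
  have h: "h \<in> ?A \<rightarrow> carrier M" using assms by auto
  have "lin_ext M h (p + q) = finsum M (\<lambda>w. Poly_Mapping.lookup (p + q) w \<odot>\<^bsub>M\<^esub> h w) ?A"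
    by (rule lin_ext_superset[OF _ keys_add h]) simp
  also have "\<dots> = finsum M (\<lambda>w. Poly_Mapping.lookup p w \<odot>\<^bsub>M\<^esub> h w \<oplus>\<^bsub>M\<^esub> Poly_Mapping.lookup q w \<odot>\<^bsub>M\<^esub> h w) ?A"
    by (rule M.finsum_cong') (use h in \<open>auto simp: lookup_add msimps Pi_iff\<close>)
  also have "\<dots> = finsum M (\<lambda>w. Poly_Mapping.lookup p w \<odot>\<^bsub>M\<^esub> h w) ?A
      \<oplus>\<^bsub>M\<^esub> finsum M (\<lambda>w. Poly_Mapping.lookup q w \<odot>\<^bsub>M\<^esub> h w) ?A"
    by (rule M.finsum_addf) (use h in \<open>auto simp: Pi_iff\<close>)
  also have "\<dots> = lin_ext M h p \<oplus>\<^bsub>M\<^esub> lin_ext M h q"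
    using h by (simp add: lin_ext_superset[of ?A])
  finally show ?thesis .
qed

lemma lin_ext_single:
  assumes "h w \<in> carrier M"
  shows "lin_ext M h (Poly_Mapping.single w a) = a \<odot>\<^bsub>M\<^esub> h w"
proof -
  have "lin_ext M h (Poly_Mapping.single w a) = finsum M (\<lambda>v. Poly_Mapping.lookup (Poly_Mapping.single w a) v \<odot>\<^bsub>M\<^esub> h v) {w}"
    by (rule lin_ext_superset) (use assms in auto)
  then show ?thesis using assms by (simp add: lookup_single)
qed

lemma lin_ext_cong:
  assumes "Poly_Mapping.keys p \<subseteq> K" "\<And>w. w \<in> K \<Longrightarrow> h w = h' w" "\<And>w. w \<in> K \<Longrightarrow> h' w \<in> carrier M"
  shows "lin_ext M h p = lin_ext M h' p"
  unfolding lin_ext_def by (rule M.finsum_cong') (use assms in auto)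

lemma lin_ext_fun_zero: "Poly_Mapping.keys p \<subseteq> K \<Longrightarrow> (\<And>w. w \<in> K \<Longrightarrow> h w = \<zero>\<^bsub>M\<^esub>) \<Longrightarrow> lin_ext M h p = \<zero>\<^bsub>M\<^esub>"
  unfolding lin_ext_def by (rule M.add.finprod_one_eqI) (auto simp: msimps)

lemma lin_ext_diff:
  assumes "Poly_Mapping.keys p \<subseteq> K" "Poly_Mapping.keys q \<subseteq> K" "h \<in> K \<rightarrow> carrier M"
  shows "lin_ext M h (p - q) = \<zero>\<^bsub>M\<^esub> \<longleftrightarrow> lin_ext M h p = lin_ext M h q"
proof -
  have k: "Poly_Mapping.keys (p - q) \<subseteq> K" using keys_diff[of p q] assms by blast
  have "lin_ext M h p = lin_ext M h ((p - q) + q)" by simp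
  also have "\<dots> = lin_ext M h (p - q) \<oplus>\<^bsub>M\<^esub> lin_ext M h q" by (rule lin_ext_add[OF k assms(2,3)])
  finally show ?thesis
    using lin_ext_closed[OF k assms(3)] lin_ext_closed[OF assms(2,3)] by simp
qed

lemma lin_ext_mult:
  fixes h :: "'a word \<Rightarrow> 'e"
  assumes "Poly_Mapping.keys p \<subseteq> words S" "Poly_Mapping.keys q \<subseteq> words S" "h \<in> words S \<rightarrow> carrier M"
  shows "lin_ext M h (p * q) = lin_ext M (\<lambda>v. lin_ext M (\<lambda>w. h (v + w)) q) p"
  using assms(1)
proof (induction rule: free_poly_induct)
  case zero then show ?case by simp
next
  case (single_add p v a)
  have hv: "(\<lambda>w. h (v + w)) \<in> words S \<rightarrow> carrier M" if "v \<in> words S" for v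
  proof
    fix w assume "w \<in> words S"
    from words_add[OF that this] assms(3) show "h (v + w) \<in> carrier M" by (rule funcset_mem[rotated])
  qed
  have c: "(\<lambda>v. lin_ext M (\<lambda>w. h (v + w)) q) \<in> words S \<rightarrow> carrier M"
    by (rule funcsetI, rule lin_ext_closed[OF assms(2) hv])
  have kf: "Poly_Mapping.keys (r * q) \<subseteq> words S" if "Poly_Mapping.keys r \<subseteq> words S" for r
    using that assms(2) free_algebra_closed(5)[of r S q] by (simp add: carrier_free_algebra)
  have ks: "Poly_Mapping.keys (Poly_Mapping.single v a) \<subseteq> words S" using single_add by simp
  note v = \<open>v \<in> words S\<close>
  have 1: "lin_ext M h (Poly_Mapping.single v a * q) = a \<odot>\<^bsub>M\<^esub> lin_ext M (\<lambda>w. h (v + w)) q"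
    using assms(2)
  proof (induction rule: free_poly_induct)
    case zero then show ?case by (simp add: msimps)
  next
    case (single_add q w b)
    have w: "h (v + w) \<in> carrier M" using funcset_mem[OF hv[OF v] single_add(2)] .
    have e: "Poly_Mapping.single v a * (Poly_Mapping.single w b + q)
       = Poly_Mapping.single (v + w) (a * b) + Poly_Mapping.single v a * q"
      by (simp add: distrib_left mult_single)
    have k1: "Poly_Mapping.keys (Poly_Mapping.single v a * q) \<subseteq> words S"
      using single_add v free_algebra_closed(5)[of "Poly_Mapping.single v a" S q]
      by (simp add: carrier_free_algebra)
    have k2: "Poly_Mapping.keys (Poly_Mapping.single (v + w) (a * b)) \<subseteq> words S"
      using words_add[OF v single_add(2)] by simp
    have k3: "Poly_Mapping.keys (Poly_Mapping.single w b) \<subseteq> words S" using single_add by simp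
    have c': "lin_ext M (\<lambda>w. h (v + w)) q \<in> carrier M" by (rule lin_ext_closed[OF single_add(1) hv[OF v]])
    show ?case
      unfolding e lin_ext_add[OF k2 k1 assms(3)] single_add.IH lin_ext_add[OF k3 single_add(1) hv[OF v]]
      using w c' by (simp add: lin_ext_single msimps)
  qed
  show ?case
    unfolding distrib_right lin_ext_add[OF kf[OF ks] kf[OF single_add(1)] assms(3)] 1
      lin_ext_add[OF ks single_add(1) c] single_add.IH
    using funcset_mem[OF c v] by (simp add: lin_ext_single)
qed

end

lemma lin_ext_hom:
  assumes "lie_module L M" "lie_module L' M'" "Poly_Mapping.keys p \<subseteq> K"
    and c: "h \<in> K \<rightarrow> carrier M"
    and Fc: "\<And>m. m \<in> carrier M \<Longrightarrow> F m \<in> carrier M'"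
    and add: "\<And>m n. m \<in> carrier M \<Longrightarrow> n \<in> carrier M \<Longrightarrow> F (m \<oplus>\<^bsub>M\<^esub> n) = F m \<oplus>\<^bsub>M'\<^esub> F n"
    and smult: "\<And>a m. m \<in> carrier M \<Longrightarrow> F (a \<odot>\<^bsub>M\<^esub> m) = a \<odot>\<^bsub>M'\<^esub> F m"
  shows "F (lin_ext M h p) = lin_ext M' (\<lambda>w. F (h w)) p"
proof -
  interpret M: lie_module L M by fact
  interpret M': lie_module L' M' by fact
  show ?thesis using assms(3)
  proof (induction rule: free_poly_induct)
    case zero
    have "F (0 \<odot>\<^bsub>M\<^esub> \<zero>\<^bsub>M\<^esub>) = 0 \<odot>\<^bsub>M'\<^esub> F \<zero>\<^bsub>M\<^esub>" using smult M.zero_closed by blast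
    then show ?case using Fc[of "\<zero>\<^bsub>M\<^esub>"] by (simp add: M.msimps M'.msimps)
  next
    case (single_add p w a)
    have k: "Poly_Mapping.keys (Poly_Mapping.single w a) \<subseteq> K" using single_add by simp
    have c': "(\<lambda>w. F (h w)) \<in> K \<rightarrow> carrier M'" using c Fc by blast
    have "h w \<in> carrier M" "F (h w) \<in> carrier M'" using c Fc single_add(2) by blast+
    then
    show ?case
      unfolding M.lin_ext_add[OF k single_add(1) c] M'.lin_ext_add[OF k single_add(1) c'] single_add.IH[symmetric]
      using M.lin_ext_closed[OF single_add(1) c]
      by (simp add: add smult M.lin_ext_single M'.lin_ext_single)
  qed
qed

section \<open>Enveloping algebras and their action on modules\<close>

context lie_algebra
begin

lemma uea_relations_subset: "uea_relations L \<subseteq> carrier (free_algebra (carrier L))"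
  unfolding uea_relations_def
  using carrier_add carrier_scale bracket_closed by (auto simp: free_algebra_closed)

sublocale FA: ring "free_algebra (carrier L)" by (rule ring_free_algebra)

sublocale UI: ideal "uea_ideal L" "free_algebra (carrier L)"
  unfolding uea_ideal_def by (rule FA.genideal_ideal[OF uea_relations_subset])

sublocale U: ring "uea L"
  unfolding uea_def by (rule UI.quotient_is_ring)

lemma uea_class_hom: "uea_class L \<in> ring_hom (free_algebra (carrier L)) (uea L)"
  using UI.rcos_ring_hom unfolding uea_def uea_class_def[abs_def] .

lemma uea_class_simps:
  assumes "p \<in> carrier (free_algebra (carrier L))" "q \<in> carrier (free_algebra (carrier L))"
  shows "uea_class L p \<oplus>\<^bsub>uea L\<^esub> uea_class L q = uea_class L (p + q)"
    "uea_class L p \<otimes>\<^bsub>uea L\<^esub> uea_class L q = uea_class L (p * q)"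
    "uea_class L p \<in> carrier (uea L)"
  using ring_hom_add[OF uea_class_hom assms] ring_hom_mult[OF uea_class_hom assms]
    ring_hom_closed[OF uea_class_hom assms(1)] by simp_all

lemma uea_class_zero: "\<zero>\<^bsub>uea L\<^esub> = uea_class L 0" and uea_class_one: "\<one>\<^bsub>uea L\<^esub> = uea_class L 1"
proof -
  show "\<one>\<^bsub>uea L\<^esub> = uea_class L 1" using ring_hom_one[OF uea_class_hom] by simp
  have "uea_class L 0 \<oplus>\<^bsub>uea L\<^esub> uea_class L 0 = uea_class L 0" "uea_class L 0 \<in> carrier (uea L)"
    using uea_class_simps[OF free_algebra_closed(1) free_algebra_closed(1)] by simp_all
  then show "\<zero>\<^bsub>uea L\<^esub> = uea_class L 0" using U.add.r_cancel_one by metis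
qed

lemma carrier_uea: "carrier (uea L) = uea_class L ` carrier (free_algebra (carrier L))"
  by (auto simp: uea_def FactRing_def uea_class_def A_RCOSETS_defs a_r_coset_def)

lemma uea_class_eq_iff:
  assumes "p \<in> carrier (free_algebra (carrier L))" "q \<in> carrier (free_algebra (carrier L))"
  shows "uea_class L p = uea_class L q \<longleftrightarrow> p - q \<in> uea_ideal L"
proof
  assume "uea_class L p = uea_class L q"
  then have "p \<in> uea_ideal L +>\<^bsub>free_algebra (carrier L)\<^esub> q"
    using UI.a_rcos_self[OF assms(1)] by (simp add: uea_class_def)
  then show "p - q \<in> uea_ideal L" by (auto simp: a_r_coset_def')
next
  assume i: "p - q \<in> uea_ideal L"
  have "uea_class L p = uea_class L ((p - q) + q)" by simp
  also have "\<dots> = uea_class L (p - q) \<oplus>\<^bsub>uea L\<^esub> uea_class L q"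
    using assms by (intro uea_class_simps(1)[symmetric] free_algebra_closed)
  also have "uea_class L (p - q) = \<zero>\<^bsub>uea L\<^esub>"
    unfolding uea_class_def uea_def FactRing_def using UI.a_rcos_const[OF i] by simp
  finally show "uea_class L p = uea_class L q" using uea_class_simps(3)[OF assms(2,2)] by simp
qed

lemma uea_class_some:
  assumes "p \<in> carrier (free_algebra (carrier L))"
  shows "(SOME q. q \<in> uea_class L p) \<in> carrier (free_algebra (carrier L))"
    "uea_class L (SOME q. q \<in> uea_class L p) = uea_class L p"
    "(SOME q. q \<in> uea_class L p) - p \<in> uea_ideal L"
proof -
  let ?q = "SOME q. q \<in> uea_class L p"
  have "p \<in> uea_class L p" unfolding uea_class_def by (rule UI.a_rcos_self[OF assms])
  then have "?q \<in> uea_class L p" by (rule someI)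
  then obtain i where i: "i \<in> uea_ideal L" "?q = i + p" unfolding uea_class_def by (auto simp: a_r_coset_def')
  then show c: "?q \<in> carrier (free_algebra (carrier L))"
    using UI.a_Hcarr assms free_algebra_closed by metis
  show "?q - p \<in> uea_ideal L" using i by simp
  then show "uea_class L ?q = uea_class L p" using uea_class_eq_iff[OF c assms] by simp
qed

lemma uea_class_relation:
  assumes "p \<in> carrier (free_algebra (carrier L))" "q \<in> carrier (free_algebra (carrier L))"
    "p - q \<in> uea_relations L"
  shows "uea_class L p = uea_class L q"
  using FA.genideal_self[OF uea_relations_subset] assms uea_class_eq_iff
  unfolding uea_ideal_def by blast

lemma uea_class_gen:
  assumes "x \<in> carrier L" "y \<in> carrier L"
  shows "uea_class L (gen (x + y)) = uea_class L (gen x + gen y)"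
    "uea_class L (gen (lscale L a x)) = uea_class L (scalar a * gen x)"
    "uea_class L (gen x * gen y) = uea_class L (gen (lbracket L x y) + gen y * gen x)"
proof -
  note c = free_algebra_closed carrier_add carrier_scale bracket_closed
  show "uea_class L (gen (x + y)) = uea_class L (gen x + gen y)"
    by (rule uea_class_relation) (use assms in \<open>auto simp: uea_relations_def intro!: c\<close>)
  show "uea_class L (gen (lscale L a x)) = uea_class L (scalar a * gen x)"
    by (rule uea_class_relation) (use assms in \<open>auto simp: uea_relations_def intro!: c\<close>)
  show "uea_class L (gen x * gen y) = uea_class L (gen (lbracket L x y) + gen y * gen x)"
  proof (rule uea_class_relation)
    have "gen x * gen y - gen y * gen x - gen (lbracket L x y) \<in> uea_relations L"
      unfolding uea_relations_def using assms by blast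
    then show "gen x * gen y - (gen (lbracket L x y) + gen y * gen x) \<in> uea_relations L"
      by (simp add: algebra_simps)
  qed (use assms in \<open>auto intro!: c\<close>)
qed

end

text \<open>The condition on a function of words under which its linear extension vanishes on the ideal that
  defines the enveloping algebra. It is stated for the three kinds of generators of the ideal inside
  an arbitrary word, as the ideal is two-sided.\<close>

definition respects_relations ::
    "'l::ab_group_add lie_alg \<Rightarrow> ('k, 'e) lie_rep \<Rightarrow> ('l word \<Rightarrow> 'e) \<Rightarrow> bool" where
  "respects_relations L M h \<longleftrightarrow> (\<forall>w\<in>words (carrier L). h w \<in> carrier M) \<and>
    (\<forall>u\<in>lists (carrier L). \<forall>v\<in>lists (carrier L). \<forall>x\<in>carrier L. \<forall>y\<in>carrier L.
      h (Word (u @ (x + y) # v)) = h (Word (u @ x # v)) \<oplus>\<^bsub>M\<^esub> h (Word (u @ y # v)) \<and>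
      (\<forall>a. h (Word (u @ lscale L a x # v)) = a \<odot>\<^bsub>M\<^esub> h (Word (u @ x # v))) \<and>
      h (Word (u @ x # y # v)) = h (Word (u @ lbracket L x y # v)) \<oplus>\<^bsub>M\<^esub> h (Word (u @ y # x # v)))"

text \<open>The elements that are annihilated in every context \<open>u _ v\<close> form a two-sided ideal, which contains
  the defining relations.\<close>

lemma lin_ext_uea_ideal:
  assumes L: "lie_algebra L" and "lie_module L' M" and h: "respects_relations L M h" and p: "p \<in> uea_ideal L"
  shows "lin_ext M h p = \<zero>\<^bsub>M\<^esub>"
proof -
  interpret L: lie_algebra L by fact
  interpret M: lie_module L' M by fact
  let ?F = "free_algebra (carrier L)"
  define J where "J = {p \<in> carrier ?F. \<forall>u\<in>words (carrier L). \<forall>v\<in>words (carrier L).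
     lin_ext M (\<lambda>w. h (u + w + v)) p = \<zero>\<^bsub>M\<^esub>}"
  have hc: "h (u + w + v) \<in> carrier M"
    if "u \<in> words (carrier L)" "w \<in> words (carrier L)" "v \<in> words (carrier L)" for u v w
    using h that words_add unfolding respects_relations_def by metis
  have hcP: "(\<lambda>w. h (u + w + v)) \<in> words (carrier L) \<rightarrow> carrier M"
    if "u \<in> words (carrier L)" "v \<in> words (carrier L)" for u v
    by (rule funcsetI) (rule hc[OF that(1) _ that(2)])
  have k: "Poly_Mapping.keys p \<subseteq> words (carrier L)" if "p \<in> carrier ?F" for p
    using that by (simp add: carrier_free_algebra)
  have J_D: "lin_ext M (\<lambda>w. h (u + w + v)) p = \<zero>\<^bsub>M\<^esub>"
    if "p \<in> J" "u \<in> words (carrier L)" "v \<in> words (carrier L)" for p u v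
    using that unfolding J_def by blast
  have J_add: "p + q \<in> J" if "p \<in> J" "q \<in> J" for p q
  proof -
    have pq: "p \<in> carrier ?F" "q \<in> carrier ?F" using that by (auto simp: J_def)
    have "lin_ext M (\<lambda>w. h (u + w + v)) (p + q) = \<zero>\<^bsub>M\<^esub>"
      if uv: "u \<in> words (carrier L)" "v \<in> words (carrier L)" for u v
    proof -
      have "lin_ext M (\<lambda>w. h (u + w + v)) p = \<zero>\<^bsub>M\<^esub>" "lin_ext M (\<lambda>w. h (u + w + v)) q = \<zero>\<^bsub>M\<^esub>"
        using J_D uv \<open>p \<in> J\<close> \<open>q \<in> J\<close> by blast+
      then show ?thesis by (simp add: M.lin_ext_add[OF k[OF pq(1)] k[OF pq(2)] hcP[OF uv]])
    qed
    then show ?thesis using free_algebra_closed(4)[OF pq] by (simp add: J_def)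
  qed
  have J_l: "q * p \<in> J" if "p \<in> J" "q \<in> carrier ?F" for p q
  proof -
    have pq: "p \<in> carrier ?F" "q \<in> carrier ?F" using that by (auto simp: J_def)
    have "lin_ext M (\<lambda>w. h (u + w + v)) (q * p) = \<zero>\<^bsub>M\<^esub>"
      if uv: "u \<in> words (carrier L)" "v \<in> words (carrier L)" for u v
    proof (subst M.lin_ext_mult[OF k[OF pq(2)] k[OF pq(1)] hcP[OF uv]])
      show "lin_ext M (\<lambda>w. lin_ext M (\<lambda>w'. h (u + (w + w') + v)) p) q = \<zero>\<^bsub>M\<^esub>"
      proof (rule M.lin_ext_fun_zero[OF k[OF pq(2)]])
        fix w assume "w \<in> words (carrier L)"
        then have "u + w \<in> words (carrier L)" using uv words_add by metis
        then show "lin_ext M (\<lambda>w'. h (u + (w + w') + v)) p = \<zero>\<^bsub>M\<^esub>"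
          using J_D[OF \<open>p \<in> J\<close> _ uv(2)] by (simp add: add.assoc[symmetric])
      qed
    qed
    then show ?thesis using free_algebra_closed(5)[OF pq(2,1)] by (simp add: J_def)
  qed
  have J_r: "p * q \<in> J" if "p \<in> J" "q \<in> carrier ?F" for p q
  proof -
    have pq: "p \<in> carrier ?F" "q \<in> carrier ?F" using that by (auto simp: J_def)
    have "lin_ext M (\<lambda>w. h (u + w + v)) (p * q) = \<zero>\<^bsub>M\<^esub>"
      if uv: "u \<in> words (carrier L)" "v \<in> words (carrier L)" for u v
      using k[OF pq(2)]
    proof (induction rule: free_poly_induct)
      case zero then show ?case by simp
    next
      case (single_add q w a)
      have w: "w + v \<in> words (carrier L)" using single_add uv words_add by metis
      have s: "Poly_Mapping.single w a \<in> carrier ?F" "q \<in> carrier ?F"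
        using single_add by (auto simp: carrier_free_algebra)
      have c: "Poly_Mapping.keys (p * Poly_Mapping.single w a) \<subseteq> words (carrier L)"
          "Poly_Mapping.keys (p * q) \<subseteq> words (carrier L)"
        using k free_algebra_closed(5)[OF pq(1)] s by blast+
      have "lin_ext M (\<lambda>w. h (u + w + v)) (p * Poly_Mapping.single w a)
        = lin_ext M (\<lambda>w'. a \<odot>\<^bsub>M\<^esub> h (u + w' + (w + v))) p"
        by (subst M.lin_ext_mult[OF k[OF pq(1)] k[OF s(1)] hcP[OF uv]],
            rule M.lin_ext_cong[OF k[OF pq(1)]])
          (use hc[OF uv(1) _ w] single_add(2) words_add in \<open>simp_all add: M.lin_ext_single add.assoc\<close>)
      also have "\<dots> = a \<odot>\<^bsub>M\<^esub> lin_ext M (\<lambda>w'. h (u + w' + (w + v))) p"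
        by (rule lin_ext_hom[OF assms(2,2) k[OF pq(1)], symmetric]) (use hc[OF uv(1) _ w] in \<open>simp_all add: M.msimps mult.commute flip: M.msimps(3)\<close>)
      also have "\<dots> = \<zero>\<^bsub>M\<^esub>" using J_D[OF \<open>p \<in> J\<close> uv(1) w] by (simp add: M.msimps)
      finally show ?case unfolding distrib_left
        by (subst M.lin_ext_add[OF c hcP[OF uv]]) (use single_add in simp)
    qed
    then show ?thesis using free_algebra_closed(5)[OF pq] by (simp add: J_def)
  qed
  have J0: "0 \<in> J" by (simp add: J_def free_algebra_closed)
  have J_sub: "J \<subseteq> carrier ?F" by (auto simp: J_def)
  have "ideal J ?F"
  proof (rule idealI[OF ring_free_algebra])
    show "subgroup J (add_monoid ?F)"
    proof (rule L.FA.add.subgroupI)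
      show "\<ominus>\<^bsub>?F\<^esub> p \<in> J" if "p \<in> J" for p
        using J_l[OF that, of "-1"] that J_sub free_algebra_closed(2,6)
        by (subst free_algebra_a_inv) auto
    qed (use J0 J_add J_sub in auto)
  qed (use J_l J_r in auto)
  moreover have "uea_relations L \<subseteq> J"
  proof
    fix r assume "r \<in> uea_relations L"
    note c = free_algebra_closed L.carrier_add L.carrier_scale L.bracket_closed
    have rc: "r \<in> carrier ?F" using \<open>r \<in> uea_relations L\<close> L.uea_relations_subset by blast
    have "lin_ext M (\<lambda>w. h (u + w + v)) r = \<zero>\<^bsub>M\<^esub>"
      if uv: "u \<in> words (carrier L)" "v \<in> words (carrier L)" for u v
    proof -
      obtain u' v' where e: "u = Word u'" "v = Word v'" "u' \<in> lists (carrier L)" "v' \<in> lists (carrier L)"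
        using uv by blast
      note hr = h[unfolded respects_relations_def, THEN conjunct2, rule_format, OF e(3,4)]
      note hcc = hcP[OF uv]
      have le: "lin_ext M (\<lambda>w. h (u + w + v)) (Poly_Mapping.single (Word xs) b) = b \<odot>\<^bsub>M\<^esub> h (Word (u' @ xs @ v'))"
        "h (Word (u' @ xs @ v')) \<in> carrier M" if "xs \<in> lists (carrier L)" for xs b
        using hc[OF uv(1) _ uv(2), of "Word xs"] that e by (auto simp: M.lin_ext_single)
      have le1: "lin_ext M (\<lambda>w. h (u + w + v)) (gen x) = h (Word (u' @ x # v'))" if "x \<in> carrier L" for x
        using le(1)[of "[x]" 1] le(2)[of "[x]"] that by (simp add: gen_def M.msimps)
      have le1': "lin_ext M (\<lambda>w. h (u + w + v)) (scalar a * gen x) = a \<odot>\<^bsub>M\<^esub> h (Word (u' @ x # v'))"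
        if "x \<in> carrier L" for a x
        using le(1)[of "[x]" a] le(2)[of "[x]"] that by (simp add: gen_def scalar_def mult_single)
      have le2: "lin_ext M (\<lambda>w. h (u + w + v)) (gen x * gen y) = h (Word (u' @ x # y # v'))"
        if "x \<in> carrier L" "y \<in> carrier L" for x y
        using le(1)[of "[x, y]" 1] le(2)[of "[x, y]"] that by (simp add: gen_def mult_single M.msimps)
      note la = M.lin_ext_add[OF k k hcc] and ld = M.lin_ext_diff[OF k k hcc, THEN iffD2]
      consider (add) x y where "r = gen (x + y) - (gen x + gen y)" "x \<in> carrier L" "y \<in> carrier L"
        | (scale) a x where "r = gen (lscale L a x) - scalar a * gen x" "x \<in> carrier L"
        | (br) x y where "r = gen x * gen y - gen y * gen x - gen (lbracket L x y)" "x \<in> carrier L" "y \<in> carrier L"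
        using \<open>r \<in> uea_relations L\<close> unfolding uea_relations_def by blast
      then show ?thesis
      proof cases
        case add
        show ?thesis unfolding add
          by (rule ld) (use add hr[OF add(2,3)] in \<open>simp_all add: c la le1\<close>)
      next
        case scale
        show ?thesis unfolding scale
          by (rule ld) (use scale hr[OF scale(2,2)] in \<open>simp_all add: c le1 le1'\<close>)
      next
        case br
        have "lin_ext M (\<lambda>w. h (u + w + v)) (gen x * gen y - (gen (lbracket L x y) + gen y * gen x)) = \<zero>\<^bsub>M\<^esub>"
          by (rule ld) (use br hr[OF br(2,3)] in \<open>simp_all add: c la le1 le2\<close>)
        then show ?thesis unfolding br by (simp add: algebra_simps)
      qed
    qed
    then show "r \<in> J" using rc by (simp add: J_def)
  qed
  ultimately have "uea_ideal L \<subseteq> J" unfolding uea_ideal_def by (rule L.FA.genideal_minimal)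
  then have "lin_ext M (\<lambda>w. h (0 + w + 0)) p = \<zero>\<^bsub>M\<^esub>" using J_D[OF _ words_zero words_zero] p by blast
  then show ?thesis by simp
qed

lemma lin_ext_uea_class_eq:
  assumes "lie_algebra L" and "lie_module L' M" and h: "respects_relations L M h"
    and "p \<in> carrier (free_algebra (carrier L))" "q \<in> carrier (free_algebra (carrier L))" "uea_class L p = uea_class L q"
  shows "lin_ext M h p = lin_ext M h q"
proof -
  interpret L: lie_algebra L by fact
  interpret M: lie_module L' M by fact
  have "lin_ext M h (p - q) = \<zero>\<^bsub>M\<^esub>"
    using lin_ext_uea_ideal[OF assms(1-3)] L.uea_class_eq_iff assms by blast
  then show ?thesis
    using h assms(4,5) by (subst (asm) M.lin_ext_diff[of _ "words (carrier L)"])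
      (auto simp: carrier_free_algebra respects_relations_def)
qed

context lie_module
begin

lemma foldr_action_closed:
  "xs \<in> lists (carrier L) \<Longrightarrow> m \<in> carrier M \<Longrightarrow> foldr (action M) xs m \<in> carrier M"
  by (induction xs) (auto intro: action_closed)

lemma foldr_action_add:
  "xs \<in> lists (carrier L) \<Longrightarrow> m \<in> carrier M \<Longrightarrow> n \<in> carrier M \<Longrightarrow>
    foldr (action M) xs (m \<oplus>\<^bsub>M\<^esub> n) = foldr (action M) xs m \<oplus>\<^bsub>M\<^esub> foldr (action M) xs n"
  by (induction xs) (auto simp: action_add foldr_action_closed)

lemma foldr_action_smult:
  "xs \<in> lists (carrier L) \<Longrightarrow> m \<in> carrier M \<Longrightarrow>
    foldr (action M) xs (a \<odot>\<^bsub>M\<^esub> m) = a \<odot>\<^bsub>M\<^esub> foldr (action M) xs m"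
  by (induction xs) (auto simp: action_smult foldr_action_closed)

lemma word_action_respects:
  assumes "m \<in> carrier M"
  shows "respects_relations L M (\<lambda>w. word_action M w m)"
  unfolding respects_relations_def
  using assms
  by (auto simp: foldr_action_closed add_action scale_action bracket_action' action_closed bracket_closed
      carrier_add carrier_scale in_lists_conv_set simp flip: foldr_action_add foldr_action_smult)

lemma uea_action_class:
  assumes "p \<in> carrier (free_algebra (carrier L))" "m \<in> carrier M"
  shows "uea_action M (uea_class L p) m = lin_ext M (\<lambda>w. word_action M w m) p"
  unfolding uea_action_def free_poly_action_def lin_ext_def[symmetric]
  by (rule lin_ext_uea_class_eq[OF lie_algebra_axioms lie_module_axioms word_action_respects])
    (use assms uea_class_some in auto)

lemma uea_action_closed:
  assumes "r \<in> carrier (uea L)" "m \<in> carrier M"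
  shows "uea_action M r m \<in> carrier M"
proof -
  obtain p where p: "p \<in> carrier (free_algebra (carrier L))" "r = uea_class L p" using assms carrier_uea by blast
  show ?thesis unfolding p(2) uea_action_class[OF p(1) assms(2)]
    by (rule lin_ext_closed[of _ "words (carrier L)"])
      (use p assms foldr_action_closed in \<open>auto simp: carrier_free_algebra in_lists_conv_set\<close>)
qed

end

section \<open>Extension of scalars\<close>

definition left_mult ::
    "'l::ab_group_add lie_alg \<Rightarrow> 'l free_poly \<Rightarrow> ('l uea \<times> 'e) multiset \<Rightarrow> ('l uea \<times> 'e) multiset" where
  "left_mult L p F = image_mset (\<lambda>(u, m). (uea_class L p \<otimes>\<^bsub>uea L\<^esub> u, m)) F"

lemma left_mult_simps [simp]:
  "left_mult L p {#} = {#}" "left_mult L p (F + G) = left_mult L p F + left_mult L p G"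
  "left_mult L p (add_mset z F) = add_mset (uea_class L p \<otimes>\<^bsub>uea L\<^esub> fst z, snd z) (left_mult L p F)"
  by (simp_all add: left_mult_def case_prod_unfold)

lemma left_mult_terms_eq: "left_mult_terms L p s = left_mult L p (terms s)"
  by (simp add: left_mult_terms_def left_mult_def)

text \<open>The formal sums of pairs and their chosen representatives are handled once and for all here;
  afterwards only the module structure of the extension, the map \<open>m \<mapsto> 1 \<otimes> m\<close> and additive maps out
  of the tensor product are used.\<close>

locale scalar_extension = L: lie_algebra L + M: lie_module P M
  for L P :: "'l::ab_group_add lie_alg" and M :: "('l, ('l uea, 'v) elt) lie_rep" +
  assumes P_sub: "carrier P \<subseteq> carrier L" and P_scale: "lscale P = lscale L" and P_bracket: "lbracket P = lbracket L"
begin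

abbreviation valid where
  "valid F \<equiv> set_mset F \<subseteq> carrier (uea L) \<times> carrier M"

abbreviation teq (infix \<open>\<approx>\<close> 50) where
  "F \<approx> G \<equiv> uea_tensor_eq L P M F G"

abbreviation cls where "cls \<equiv> tensor_class L P M"

abbreviation E where "E \<equiv> extend_scalars L P M"

abbreviation cl where "cl \<equiv> uea_class L"

abbreviation FL where "FL \<equiv> carrier (free_algebra (carrier L))"

definition embed :: "('l uea, 'v) elt \<Rightarrow> ('l uea, 'v) elt" where
  "embed m = cls {#(\<one>\<^bsub>uea L\<^esub>, m)#}"

lemma cl_closed: "p \<in> FL \<Longrightarrow> cl p \<in> carrier (uea L)"
  by (rule L.uea_class_simps(3))

lemma FP_sub: "carrier (free_algebra (carrier P)) \<subseteq> FL"
  using image_mono[OF lists_mono[OF P_sub], of Word] by (auto simp: carrier_free_algebra)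

text \<open>Needed for the map between the enveloping algebras to be independent of representatives: the
  larger ideal meets the smaller free algebra in an ideal containing the smaller relations.\<close>

lemma uea_ideal_mono: "uea_ideal P \<subseteq> uea_ideal L"
proof -
  let ?J = "uea_ideal L \<inter> carrier (free_algebra (carrier P))"
  have rel: "uea_relations P \<subseteq> uea_relations L"
    using P_sub unfolding uea_relations_def P_scale P_bracket by blast
  have "ideal ?J (free_algebra (carrier P))"
  proof (rule idealI[OF ring_free_algebra])
    show "subgroup ?J (add_monoid (free_algebra (carrier P)))"
    proof (rule M.FA.add.subgroupI)
      show "\<ominus>\<^bsub>free_algebra (carrier P)\<^esub> p \<in> ?J" if "p \<in> ?J" for p
      proof -
        have "\<ominus>\<^bsub>free_algebra (carrier L)\<^esub> p \<in> uea_ideal L" using that by simp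
        then show ?thesis using that FP_sub free_algebra_closed(6)[of p "carrier P"]
          by (auto simp: free_algebra_a_inv)
      qed
      show "?J \<noteq> {}" using L.UI.zero_closed free_algebra_closed(1)[of "carrier P"] by auto
      show "p \<oplus>\<^bsub>free_algebra (carrier P)\<^esub> q \<in> ?J" if "p \<in> ?J" "q \<in> ?J" for p q
        using that L.UI.a_closed[of p q] free_algebra_closed(4)[of p "carrier P" q] by simp
    qed auto
    show "x \<otimes>\<^bsub>free_algebra (carrier P)\<^esub> a \<in> ?J" if "a \<in> ?J" "x \<in> carrier (free_algebra (carrier P))" for a x
      using that FP_sub L.UI.I_l_closed[of a x] free_algebra_closed(5)[of x "carrier P" a] by auto
    show "a \<otimes>\<^bsub>free_algebra (carrier P)\<^esub> x \<in> ?J" if "a \<in> ?J" "x \<in> carrier (free_algebra (carrier P))" for a x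
      using that FP_sub L.UI.I_r_closed[of a x] free_algebra_closed(5)[of a "carrier P" x] by auto
  qed
  moreover have "uea_relations P \<subseteq> ?J"
    using rel L.FA.genideal_self[OF L.uea_relations_subset] M.uea_relations_subset
    unfolding uea_ideal_def by blast
  ultimately have "uea_ideal P \<subseteq> ?J" unfolding uea_ideal_def[of P] by (rule M.FA.genideal_minimal)
  then show ?thesis by blast
qed

lemma uea_incl_class:
  assumes "p \<in> carrier (free_algebra (carrier P))"
  shows "uea_incl L (uea_class P p) = cl p"
  unfolding uea_incl_def using M.uea_class_some[OF assms] assms FP_sub uea_ideal_mono
  by (subst L.uea_class_eq_iff) auto

lemma teq_refl: "valid F \<Longrightarrow> F \<approx> F"
  unfolding uea_tensor_eq_def by (rule tensor_refl)

lemma teq_sym: "F \<approx> G \<Longrightarrow> G \<approx> F"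
  unfolding uea_tensor_eq_def by (rule tensor_sym)

lemma teq_trans: "F \<approx> G \<Longrightarrow> G \<approx> H \<Longrightarrow> F \<approx> H"
  unfolding uea_tensor_eq_def by (rule tensor_trans)

lemma teq_cong: "F \<approx> F' \<Longrightarrow> G \<approx> G' \<Longrightarrow> F + G \<approx> F' + G'"
  unfolding uea_tensor_eq_def by (rule tensor_cong)

lemma teq_zero: "m \<in> carrier M \<Longrightarrow> {#(\<zero>\<^bsub>uea L\<^esub>, m)#} \<approx> {#}"
  unfolding uea_tensor_eq_def by (rule tensor_zero)

lemma teq_add_left: "u \<in> carrier (uea L) \<Longrightarrow> v \<in> carrier (uea L) \<Longrightarrow> m \<in> carrier M \<Longrightarrow>
    {#(u \<oplus>\<^bsub>uea L\<^esub> v, m)#} \<approx> {#(u, m), (v, m)#}"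
  unfolding uea_tensor_eq_def by (rule tensor_add_left)

lemma teq_add_right: "u \<in> carrier (uea L) \<Longrightarrow> m \<in> carrier M \<Longrightarrow> n \<in> carrier M \<Longrightarrow>
    {#(u, m \<oplus>\<^bsub>M\<^esub> n)#} \<approx> {#(u, m), (u, n)#}"
  unfolding uea_tensor_eq_def by (rule tensor_add_right)

lemma teq_balanced: "u \<in> carrier (uea L) \<Longrightarrow> r \<in> carrier (uea P) \<Longrightarrow> m \<in> carrier M \<Longrightarrow>
    {#(u \<otimes>\<^bsub>uea L\<^esub> uea_incl L r, m)#} \<approx> {#(u, uea_action M r m)#}"
  unfolding uea_tensor_eq_def by (rule tensor_balanced)

text \<open>The induction principle of the tensor congruence, with elements of the enveloping algebra of the
  subalgebra replaced by polynomials that represent them.\<close>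

lemma teq_induct [consumes 1, case_names refl sym trans cong zero add_left add_right balanced]:
  assumes "F \<approx> G"
    and "\<And>F. valid F \<Longrightarrow> R F F"
    and "\<And>F G. F \<approx> G \<Longrightarrow> R F G \<Longrightarrow> R G F"
    and "\<And>F G H. F \<approx> G \<Longrightarrow> R F G \<Longrightarrow> G \<approx> H \<Longrightarrow> R G H \<Longrightarrow> R F H"
    and "\<And>F F' G G'. F \<approx> F' \<Longrightarrow> R F F' \<Longrightarrow> G \<approx> G' \<Longrightarrow> R G G' \<Longrightarrow> R (F + G) (F' + G')"
    and "\<And>m. m \<in> carrier M \<Longrightarrow> R {#(\<zero>\<^bsub>uea L\<^esub>, m)#} {#}"
    and "\<And>u v m. u \<in> carrier (uea L) \<Longrightarrow> v \<in> carrier (uea L) \<Longrightarrow> m \<in> carrier M \<Longrightarrow>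
      R {#(u \<oplus>\<^bsub>uea L\<^esub> v, m)#} {#(u, m), (v, m)#}"
    and "\<And>u m n. u \<in> carrier (uea L) \<Longrightarrow> m \<in> carrier M \<Longrightarrow> n \<in> carrier M \<Longrightarrow>
      R {#(u, m \<oplus>\<^bsub>M\<^esub> n)#} {#(u, m), (u, n)#}"
    and "\<And>u p m. u \<in> carrier (uea L) \<Longrightarrow> p \<in> carrier (free_algebra (carrier P)) \<Longrightarrow> m \<in> carrier M \<Longrightarrow>
      R {#(u \<otimes>\<^bsub>uea L\<^esub> cl p, m)#} {#(u, uea_action M (uea_class P p) m)#}"
  shows "R F G"
  using assms(1) unfolding uea_tensor_eq_def
proof (induction rule: tensor_eq.induct)
  case (tensor_balanced u r m)
  then show ?case using assms(9)[of u _ m] uea_incl_class unfolding M.carrier_uea by auto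
qed (use assms(2-8) in \<open>simp_all add: uea_tensor_eq_def\<close>)

lemma teq_valid: "F \<approx> G \<Longrightarrow> valid F \<and> valid G"
proof (induction rule: teq_induct)
  case (balanced u p m)
  then show ?case using M.uea_action_closed M.uea_class_simps(3) L.uea_class_simps(3) FP_sub by auto
qed auto


lemma terms_cls:
  assumes "valid F"
  shows "F \<approx> terms (cls F)" "valid (terms (cls F))"
proof -
  have "F \<approx> (SOME G. F \<approx> G)" by (rule someI[of _ F]) (rule teq_refl[OF assms])
  then show "F \<approx> terms (cls F)" by (simp add: tensor_class_def)
  then show "valid (terms (cls F))" using teq_valid by blast
qed

lemma cls_eq_iff:
  assumes "valid F" "valid G"
  shows "cls F = cls G \<longleftrightarrow> F \<approx> G"
proof
  assume "cls F = cls G"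
  then show "F \<approx> G" using teq_trans[OF terms_cls(1)[OF assms(1)] teq_sym] terms_cls(1)[OF assms(2)] by simp
next
  assume "F \<approx> G"
  then have "(F \<approx> H) = (G \<approx> H)" for H using teq_trans teq_sym by metis
  then show "cls F = cls G" by (simp add: tensor_class_def)
qed

lemma left_mult_valid: "valid F \<Longrightarrow> p \<in> FL \<Longrightarrow> valid (left_mult L p F)"
  using L.uea_class_simps(3) by (auto simp: left_mult_def)

text \<open>Left multiplication is compatible with the congruence because the subalgebra acts on the right.\<close>

lemma left_mult_teq:
  assumes "F \<approx> G" "p \<in> FL"
  shows "left_mult L p F \<approx> left_mult L p G"
proof -
  have cp: "cl p \<in> carrier (uea L)" by (rule L.uea_class_simps(3)[OF assms(2,2)])
  show ?thesis using assms(1)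
  proof (induction rule: teq_induct)
    case (refl F)
    then show ?case by (rule teq_refl[OF left_mult_valid[OF _ assms(2)]])
  next
    case (cong F F' G G')
    then show ?case by (simp add: teq_cong)
  next
    case (sym F G)
    show ?case by (rule teq_sym[OF sym.IH])
  next
    case (trans F G H)
    show ?case by (rule teq_trans[OF trans.IH])
  next
    case (zero m)
    then show ?case using teq_zero[of m] cp by simp
  next
    case (add_left u v m)
    then show ?case using teq_add_left[of "cl p \<otimes>\<^bsub>uea L\<^esub> u" "cl p \<otimes>\<^bsub>uea L\<^esub> v" m] cp
      by (simp add: L.U.r_distr)
  next
    case (add_right u m n)
    then show ?case using teq_add_right[of "cl p \<otimes>\<^bsub>uea L\<^esub> u" m n] cp by simp
  next
    case (balanced u q m)
    have c: "cl q \<in> carrier (uea L)" "uea_class P q \<in> carrier (uea P)"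
      using L.uea_class_simps(3)[of q q] M.uea_class_simps(3)[of q q] subsetD[OF FP_sub, of q] balanced(2) by auto
    have "{#((cl p \<otimes>\<^bsub>uea L\<^esub> u) \<otimes>\<^bsub>uea L\<^esub> uea_incl L (uea_class P q), m)#}
        \<approx> {#(cl p \<otimes>\<^bsub>uea L\<^esub> u, uea_action M (uea_class P q) m)#}"
      by (rule teq_balanced) (use cp c balanced in auto)
    then show ?case using c cp balanced by (simp add: L.U.m_assoc uea_incl_class)
  qed
qed

lemma carrier_E: "carrier E = cls ` {F. valid F}"
  by (simp add: extend_scalars_def)

lemma E_cases: "s \<in> carrier E \<Longrightarrow> (\<And>F. s = cls F \<Longrightarrow> valid F \<Longrightarrow> thesis) \<Longrightarrow> thesis"
  unfolding carrier_E by blast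

text \<open>All operations of the extended module are computed on formal sums, whichever representatives were
  chosen.\<close>

lemma E_simps:
  assumes "valid F"
  shows "valid G \<Longrightarrow> cls F \<oplus>\<^bsub>E\<^esub> cls G = cls (F + G)"
    and "a \<odot>\<^bsub>E\<^esub> cls F = cls (left_mult L (scalar a) F)"
    and "x \<in> carrier L \<Longrightarrow> action E x (cls F) = cls (left_mult L (gen x) F)"
    and "\<zero>\<^bsub>E\<^esub> = cls {#}"
proof -
  show "cls F \<oplus>\<^bsub>E\<^esub> cls G = cls (F + G)" if "valid G"
  proof -
    have t: "terms (cls F) + terms (cls G) \<approx> F + G"
      by (rule teq_cong[OF teq_sym[OF terms_cls(1)[OF assms]] teq_sym[OF terms_cls(1)[OF that]]])
    have "cls (terms (cls F) + terms (cls G)) = cls (F + G)"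
      using teq_valid[OF t] t by (subst cls_eq_iff) blast+
    then show ?thesis by (simp add: extend_scalars_def)
  qed
  have lm: "cls (left_mult L p (terms (cls F))) = cls (left_mult L p F)" if "p \<in> FL" for p
    using left_mult_teq[OF teq_sym[OF terms_cls(1)[OF assms]] that] teq_valid by (metis cls_eq_iff)
  show "a \<odot>\<^bsub>E\<^esub> cls F = cls (left_mult L (scalar a) F)"
    using lm[OF free_algebra_closed(3)] by (simp add: extend_scalars_def left_mult_terms_eq)
  show "x \<in> carrier L \<Longrightarrow> action E x (cls F) = cls (left_mult L (gen x) F)"
    using lm[OF free_algebra_closed(8)] by (simp add: extend_scalars_def left_mult_terms_eq)
qed (simp add: extend_scalars_def)

lemma left_mult_add:
  assumes "p \<in> FL" "q \<in> FL"
  shows "valid F \<Longrightarrow> left_mult L (p + q) F \<approx> left_mult L p F + left_mult L q F"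
proof (induction F)
  case empty
  then show ?case using teq_refl[of "{#}"] by simp
next
  case (add z F)
  obtain u m where z: "z = (u, m)" by force
  have c: "u \<in> carrier (uea L)" "m \<in> carrier M" "valid F" "cl p \<in> carrier (uea L)" "cl q \<in> carrier (uea L)"
    using add.prems L.uea_class_simps(3) assms by (auto simp: z)
  have "{#(cl (p + q) \<otimes>\<^bsub>uea L\<^esub> u, m)#} \<approx> {#(cl p \<otimes>\<^bsub>uea L\<^esub> u, m), (cl q \<otimes>\<^bsub>uea L\<^esub> u, m)#}"
    using teq_add_left[of "cl p \<otimes>\<^bsub>uea L\<^esub> u" "cl q \<otimes>\<^bsub>uea L\<^esub> u" m] c
    by (simp add: L.U.l_distr L.uea_class_simps(1)[OF assms, symmetric])
  from teq_cong[OF this add.IH[OF c(3)]] show ?case by (simp add: z add.commute add_mset_commute)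
qed

lemma left_mult_mult:
  assumes "p \<in> FL" "q \<in> FL" "valid F"
  shows "left_mult L (p * q) F = left_mult L p (left_mult L q F)"
proof -
  have "cl (p * q) \<otimes>\<^bsub>uea L\<^esub> u = cl p \<otimes>\<^bsub>uea L\<^esub> (cl q \<otimes>\<^bsub>uea L\<^esub> u)" if "u \<in> carrier (uea L)" for u
    using that L.uea_class_simps[OF assms(1,2)] L.uea_class_simps(3)[OF assms(1,1)] L.uea_class_simps(3)[OF assms(2,2)]
    by (simp add: L.U.m_assoc flip: L.uea_class_simps(2)[OF assms(1,2)])
  then show ?thesis using assms(3)
    unfolding left_mult_def multiset.map_comp by (intro image_mset_cong) auto
qed

lemma left_mult_one: "valid F \<Longrightarrow> left_mult L 1 F = F"
  unfolding left_mult_def by (rule trans[OF image_mset_cong multiset.map_ident])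
    (auto simp: L.uea_class_one[symmetric])

lemma left_mult_zero: "valid F \<Longrightarrow> left_mult L 0 F \<approx> {#}"
proof (induction F)
  case empty
  then show ?case using teq_refl[of "{#}"] by simp
next
  case (add z F)
  obtain u m where z: "z = (u, m)" by force
  have "{#(cl 0 \<otimes>\<^bsub>uea L\<^esub> u, m)#} \<approx> {#}" using add.prems teq_zero[of m] by (simp add: z L.uea_class_zero[symmetric])
  from teq_cong[OF this add.IH] add.prems show ?case by (simp add: z)
qed

lemma left_mult_class: "cl p = cl q \<Longrightarrow> left_mult L p F = left_mult L q F"
  by (simp add: left_mult_def)

lemma scalar_simps:
  "scalar (a + b) = scalar a + scalar b" "scalar (a * b) = scalar a * scalar b" "scalar 1 = (1 :: 'a free_poly)"
  "scalar 0 = (0 :: 'a free_poly)" "scalar a * p = p * (scalar a :: 'a free_poly)"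
proof -
  show "scalar a * p = p * (scalar a :: 'a free_poly)"
    by (rule free_poly_induct[of p UNIV])
      (simp_all add: scalar_def distrib_left distrib_right mult_single mult.commute)
qed (simp_all add: scalar_def single_add mult_single)

lemma E_lie_module: "lie_module L E"
proof (rule lie_moduleI[OF L.lie_algebra_axioms])
  note c = free_algebra_closed L.carrier_add L.carrier_scale L.bracket_closed
  note v = left_mult_valid
  have cE: "valid F \<Longrightarrow> cls F \<in> carrier E" for F by (auto simp: carrier_E)
  show "\<zero>\<^bsub>E\<^esub> \<in> carrier E" using cE[of "{#}"] E_simps(4)[of "{#}"] by simp
  fix l m n assume "l \<in> carrier E" "m \<in> carrier E" "n \<in> carrier E"
  then obtain A F G where A: "valid A" "l = cls A" and F: "valid F" "m = cls F" and G: "valid G" "n = cls G"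
    by (metis E_cases)
  note AFG = A F G
  show "m \<oplus>\<^bsub>E\<^esub> n \<in> carrier E" using AFG by (simp add: E_simps cE)
  show "(l \<oplus>\<^bsub>E\<^esub> m) \<oplus>\<^bsub>E\<^esub> n = l \<oplus>\<^bsub>E\<^esub> (m \<oplus>\<^bsub>E\<^esub> n)" using AFG by (simp add: E_simps add.assoc)
  show "m \<oplus>\<^bsub>E\<^esub> n = n \<oplus>\<^bsub>E\<^esub> m" using AFG by (simp add: E_simps add.commute)
  show "\<zero>\<^bsub>E\<^esub> \<oplus>\<^bsub>E\<^esub> m = m" using AFG by (simp add: E_simps)
  show "a \<odot>\<^bsub>E\<^esub> m \<in> carrier E" for a using AFG by (simp add: E_simps cE v c)
  show "(a + b) \<odot>\<^bsub>E\<^esub> m = a \<odot>\<^bsub>E\<^esub> m \<oplus>\<^bsub>E\<^esub> b \<odot>\<^bsub>E\<^esub> m" for a b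
    using AFG by (simp add: E_simps v c scalar_simps(1) cls_eq_iff left_mult_add)
  show "a \<odot>\<^bsub>E\<^esub> (m \<oplus>\<^bsub>E\<^esub> n) = a \<odot>\<^bsub>E\<^esub> m \<oplus>\<^bsub>E\<^esub> a \<odot>\<^bsub>E\<^esub> n" for a
    using AFG by (simp add: E_simps v c)
  show "(a * b) \<odot>\<^bsub>E\<^esub> m = a \<odot>\<^bsub>E\<^esub> (b \<odot>\<^bsub>E\<^esub> m)" for a b
    using AFG by (simp add: E_simps v c scalar_simps(2) left_mult_mult)
  show "1 \<odot>\<^bsub>E\<^esub> m = m" using AFG by (simp add: E_simps scalar_simps(3) left_mult_one)
  show "0 \<odot>\<^bsub>E\<^esub> m = \<zero>\<^bsub>E\<^esub>"
    using AFG by (simp add: E_simps scalar_simps(4) cls_eq_iff left_mult_zero v c)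
  fix x y assume x: "x \<in> carrier L" and y: "y \<in> carrier L"
  show "action E x m \<in> carrier E" using AFG x by (simp add: E_simps cE v c)
  show "action E x (m \<oplus>\<^bsub>E\<^esub> n) = action E x m \<oplus>\<^bsub>E\<^esub> action E x n"
    using AFG x by (simp add: E_simps v c)
  show "action E x (a \<odot>\<^bsub>E\<^esub> m) = a \<odot>\<^bsub>E\<^esub> action E x m" for a
    using AFG x by (simp add: E_simps v c left_mult_mult[symmetric] scalar_simps(5)[of a "gen x"])
  show "action E (x + y) m = action E x m \<oplus>\<^bsub>E\<^esub> action E y m"
    using AFG x y left_mult_class[OF L.uea_class_gen(1)[OF x y], of F]
    by (simp add: E_simps v c cls_eq_iff left_mult_add)
  show "action E (lscale L a x) m = a \<odot>\<^bsub>E\<^esub> action E x m" for a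
    using AFG x left_mult_class[OF L.uea_class_gen(2)[OF x x, of a], of F]
    by (simp add: E_simps v c left_mult_mult[symmetric])
  show "action E (lbracket L x y) m \<oplus>\<^bsub>E\<^esub> action E y (action E x m) = action E x (action E y m)"
    using AFG x y left_mult_class[OF L.uea_class_gen(3)[OF x y], of F]
      left_mult_add[of "gen (lbracket L x y)" "gen y * gen x" F]
    by (simp add: E_simps v c left_mult_mult[symmetric] cls_eq_iff teq_sym)
qed

sublocale E: lie_module L E by (rule E_lie_module)

lemma embed_closed: "m \<in> carrier M \<Longrightarrow> embed m \<in> carrier E"
  by (auto simp: embed_def carrier_E)

lemma embed_add: "m \<in> carrier M \<Longrightarrow> n \<in> carrier M \<Longrightarrow> embed (m \<oplus>\<^bsub>M\<^esub> n) = embed m \<oplus>\<^bsub>E\<^esub> embed n"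
  using teq_add_right[of "\<one>\<^bsub>uea L\<^esub>" m n] by (simp add: embed_def E_simps cls_eq_iff add_mset_commute)

lemma cls_class:
  assumes "p \<in> FL" "m \<in> carrier M"
  shows "cls {#(cl p, m)#} = cls (left_mult L p {#(\<one>\<^bsub>uea L\<^esub>, m)#})"
  using assms L.uea_class_simps(3) by simp

lemma embed_uea_action:
  assumes "p \<in> carrier (free_algebra (carrier P))" "m \<in> carrier M"
  shows "embed (uea_action M (uea_class P p) m) = cls (left_mult L p {#(\<one>\<^bsub>uea L\<^esub>, m)#})"
proof -
  have c: "uea_class P p \<in> carrier (uea P)" "cl p \<in> carrier (uea L)"
    using assms(1) M.uea_class_simps(3) L.uea_class_simps(3) FP_sub by auto
  have "{#(\<one>\<^bsub>uea L\<^esub> \<otimes>\<^bsub>uea L\<^esub> cl p, m)#} \<approx> {#(\<one>\<^bsub>uea L\<^esub>, uea_action M (uea_class P p) m)#}"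
    using teq_balanced[of "\<one>\<^bsub>uea L\<^esub>" "uea_class P p" m] c assms uea_incl_class by simp
  then show ?thesis using c assms M.uea_action_closed
    by (subst cls_class[symmetric]) (use FP_sub in \<open>auto simp: embed_def cls_eq_iff teq_sym\<close>)
qed

lemma embed_smult:
  assumes "m \<in> carrier M"
  shows "embed (a \<odot>\<^bsub>M\<^esub> m) = a \<odot>\<^bsub>E\<^esub> embed m"
proof -
  have "uea_action M (uea_class P (scalar a)) m = a \<odot>\<^bsub>M\<^esub> m"
    using assms free_algebra_closed(3)[of a "carrier P"]
    by (simp add: M.uea_action_class) (simp add: scalar_def M.lin_ext_single zero_word_def)
  then show ?thesis using embed_uea_action[OF free_algebra_closed(3) assms, of a] assms
    by (simp add: embed_def E_simps)
qed

lemma embed_action: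
  assumes "y \<in> carrier P" "m \<in> carrier M"
  shows "embed (action M y m) = action E y (embed m)"
proof -
  have "uea_action M (uea_class P (gen y)) m = action M y m"
    using assms free_algebra_closed(8)[of y "carrier P"] M.action_closed
    by (simp add: M.uea_action_class) (simp add: gen_def M.lin_ext_single M.msimps)
  then show ?thesis using embed_uea_action[OF free_algebra_closed(8)[OF assms(1)] assms(2)] assms subsetD[OF P_sub assms(1)]
    by (simp add: embed_def E_simps)
qed

lemma cls_add: "valid F \<Longrightarrow> valid G \<Longrightarrow> cls (F + G) = cls F \<oplus>\<^bsub>E\<^esub> cls G"
  by (simp add: E_simps)

text \<open>Every \<open>u \<otimes> m\<close> with \<open>u\<close> a word is obtained from \<open>1 \<otimes> m\<close> by letting the letters act one after the
  other.\<close>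

lemma embed_generates:
  assumes W: "stable_subspace E (carrier L) W" and sub: "embed ` carrier M \<subseteq> W"
  shows "W = carrier E"
proof
  note d = stable_subspaceD[OF W]
  note c = free_algebra_closed
  show "W \<subseteq> carrier E" by (rule d)
  have word: "cls {#(cl (Poly_Mapping.single (Word xs) 1), m)#} \<in> W"
    if "xs \<in> lists (carrier L)" "m \<in> carrier M" for xs m
    using that(1)
  proof (induction xs)
    case Nil
    have "Poly_Mapping.single (Word []) 1 = (1 :: 'l free_poly)" by (simp add: zero_word_def[symmetric])
    then show ?case using sub that by (auto simp: embed_def L.uea_class_one[symmetric])
  next
    case (Cons x xs)
    have e: "Poly_Mapping.single (Word (x # xs)) (1::complex) = gen x * Poly_Mapping.single (Word xs) 1"
      by (simp add: gen_def mult_single)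
    have w: "Poly_Mapping.single (Word xs) 1 \<in> FL" "gen x \<in> FL" using Cons.hyps c(9)[of "Word xs" "carrier L" 1] c(8)[of x "carrier L"] by auto
    have "cls {#(cl (Poly_Mapping.single (Word (x # xs)) 1), m)#}
        = action E x (cls {#(cl (Poly_Mapping.single (Word xs) 1), m)#})"
      using Cons w that by (simp add: E_simps L.uea_class_simps e)
    then show ?case using d(6)[OF _ Cons.IH] Cons by auto
  qed
  have poly: "cls {#(cl p, m)#} \<in> W" if "p \<in> FL" "m \<in> carrier M" for p m
  proof -
    have "Poly_Mapping.keys p \<subseteq> words (carrier L)" using that by (simp add: carrier_free_algebra)
    then show ?thesis
    proof (induction rule: free_poly_induct)
      case zero
      have "cls {#(cl 0, m)#} = cls {#}"
        using teq_zero[OF that(2)] that L.uea_class_simps(3)[OF c(1) c(1)] by (simp add: L.uea_class_zero cls_eq_iff)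
      then show ?case using d(3) E_simps(4)[of "{#}"] by simp
    next
      case (single_add p w a)
      obtain xs where xs: "w = Word xs" "xs \<in> lists (carrier L)" using single_add by auto
      have w: "Poly_Mapping.single w 1 \<in> FL" "Poly_Mapping.single w a \<in> FL" "p \<in> FL"
        using single_add c(9) by (auto simp: carrier_free_algebra)
      have e: "Poly_Mapping.single w a = scalar a * Poly_Mapping.single w 1"
        by (simp add: scalar_def mult_single)
      have "cls {#(cl (Poly_Mapping.single w a), m)#} = a \<odot>\<^bsub>E\<^esub> cls {#(cl (Poly_Mapping.single w 1), m)#}"
        using w that c(3)[of a "carrier L"] by (simp add: E_simps L.uea_class_simps e)
      then have 1: "cls {#(cl (Poly_Mapping.single w a), m)#} \<in> W"
        using d(5) word[OF xs(2) that(2)] xs by simp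
      have "cls {#(cl (Poly_Mapping.single w a + p), m)#} = cls {#(cl (Poly_Mapping.single w a), m), (cl p, m)#}"
        using teq_add_left[of "cl (Poly_Mapping.single w a)" "cl p" m] w that
        by (simp add: c(4) L.uea_class_simps(1) cl_closed cls_eq_iff add_mset_commute)
      also have "\<dots> = cls {#(cl (Poly_Mapping.single w a), m)#} \<oplus>\<^bsub>E\<^esub> cls {#(cl p, m)#}"
        using cls_add[of "{#(cl (Poly_Mapping.single w a), m)#}" "{#(cl p, m)#}"] w that
        by (simp add: cl_closed add_mset_commute)
      finally show ?case using d(4)[OF 1 single_add.IH] by simp
    qed
  qed
  have "valid F \<Longrightarrow> cls F \<in> W" for F
  proof (induction F)
    case empty
    then show ?case using d(3) E_simps(4)[of "{#}"] by simp
  next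
    case (add z F)
    obtain u m where z: "z = (u, m)" by force
    have 1: "valid {#z#}" "valid F" using add.prems by auto
    obtain p where p: "p \<in> FL" "u = cl p" using add.prems unfolding z L.carrier_uea by auto
    have "cls (add_mset z F) = cls {#z#} \<oplus>\<^bsub>E\<^esub> cls F" using cls_add[OF 1] by simp
    then show ?case using d(4)[OF poly[OF p(1), of m] add.IH[OF 1(2)]] 1 p z by auto
  qed
  then show "carrier E \<subseteq> W" unfolding carrier_E by blast
qed

end

text \<open>The homomorphism is applied to the second entries of formal sums. Surjectivity is preserved
  because formal sums can be lifted term by term.\<close>

lemma extend_scalars_hom:
  assumes "scalar_extension L P M" "scalar_extension L P M'" and \<psi>: "lie_hom P M M' \<psi>"
    and surj: "carrier M' = \<psi> ` carrier M"
  shows "\<exists>\<chi>. lie_hom L (extend_scalars L P M) (extend_scalars L P M') \<chi> \<and>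
    carrier (extend_scalars L P M') = \<chi> ` carrier (extend_scalars L P M)"
proof -
  interpret A: scalar_extension L P M by fact
  interpret B: scalar_extension L P M' by fact
  note h = lie_homD[OF \<psi>]
  let ?f = "image_mset (\<lambda>(u, m). (u, \<psi> m))"
  have valid: "A.valid F \<Longrightarrow> B.valid (?f F)" for F using h(1) by auto
  have act: "\<psi> (uea_action M (uea_class P p) m) = uea_action M' (uea_class P p) (\<psi> m)"
    if "p \<in> carrier (free_algebra (carrier P))" "m \<in> carrier M" for p m
  proof -
    have w: "\<psi> (word_action M w m) = word_action M' w (\<psi> m) \<and> word_action M w m \<in> carrier M"
      if w: "w \<in> words (carrier P)" for w
    proof -
      obtain xs where "w = Word xs" "xs \<in> lists (carrier P)" using w by blast
      moreover from this(2) have "\<psi> (foldr (action M) xs m) = foldr (action M') xs (\<psi> m)"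
        by (induction xs) (use h(4) A.M.foldr_action_closed \<open>m \<in> carrier M\<close> in auto)
      ultimately show ?thesis using A.M.foldr_action_closed \<open>m \<in> carrier M\<close> by simp
    qed
    have k: "Poly_Mapping.keys p \<subseteq> words (carrier P)" using that by (simp add: carrier_free_algebra)
    have "\<psi> (lin_ext M (\<lambda>w. word_action M w m) p) = lin_ext M' (\<lambda>w. \<psi> (word_action M w m)) p"
      by (rule lin_ext_hom[OF A.M.lie_module_axioms B.M.lie_module_axioms k])
        (simp_all add: w h Pi_iff del: word_action.simps)
    also have "\<dots> = lin_ext M' (\<lambda>w. word_action M' w (\<psi> m)) p"
    proof (rule B.M.lin_ext_cong[OF k])
      fix v assume "v \<in> words (carrier P)"
      from w[OF this] h(1) show "word_action M' v (\<psi> m) \<in> carrier M'" by metis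
    qed (simp add: w)
    finally show ?thesis using that h(1) by (simp add: A.M.uea_action_class B.M.uea_action_class)
  qed
  have teq: "uea_tensor_eq L P M F G \<Longrightarrow> uea_tensor_eq L P M' (?f F) (?f G)" for F G
  proof (induction rule: A.teq_induct)
    case (refl F)
    then show ?case by (rule B.teq_refl[OF valid])
  next
    case (cong F F' G G')
    then show ?case by (simp add: B.teq_cong)
  next
    case (sym F G)
    show ?case by (rule B.teq_sym[OF sym.IH])
  next
    case (trans F G H)
    show ?case by (rule B.teq_trans[OF trans.IH])
  next
    case (zero m)
    then show ?case using B.teq_zero[OF h(1)] by simp
  next
    case (add_left u v m)
    then show ?case using B.teq_add_left[OF _ _ h(1), of u v m] by simp
  next
    case (add_right u m n)
    then show ?case using B.teq_add_right[OF _ h(1) h(1), of u m n] by (simp add: h(2))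
  next
    case (balanced u p m)
    then show ?case using B.teq_balanced[OF _ _ h(1), of u "uea_class P p" m] A.M.uea_class_simps(3)[of p p]
      by (simp add: act B.uea_incl_class)
  qed
  define \<chi> where "\<chi> s = B.cls (?f (terms s))" for s :: "('a uea, 'b) elt"
  have \<chi>: "\<chi> (A.cls F) = B.cls (?f F)" if "A.valid F" for F
    using teq[OF A.teq_sym[OF A.terms_cls(1)[OF that]]] B.cls_eq_iff[OF valid valid] A.terms_cls(2) that
    unfolding \<chi>_def by blast
  have lm: "?f (left_mult L p F) = left_mult L p (?f F)" for p F
    by (simp add: left_mult_def multiset.map_comp comp_def case_prod_unfold)
  show ?thesis
  proof (intro exI conjI)
    note v = A.left_mult_valid free_algebra_closed
    show "lie_hom L A.E B.E \<chi>" unfolding lie_hom_def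
    proof (intro conjI allI ballI)
      show "\<chi> ` carrier A.E \<subseteq> carrier B.E" using valid by (auto simp: A.carrier_E B.carrier_E \<chi>)
    next
      fix m n assume "m \<in> carrier A.E" "n \<in> carrier A.E"
      then obtain F G where "m = A.cls F" "A.valid F" "n = A.cls G" "A.valid G" by (metis A.E_cases)
      then show "\<chi> (m \<oplus>\<^bsub>A.E\<^esub> n) = \<chi> m \<oplus>\<^bsub>B.E\<^esub> \<chi> n"
        using valid by (simp add: A.E_simps B.E_simps \<chi>)
    next
      fix a m assume "m \<in> carrier A.E"
      then obtain F where "m = A.cls F" "A.valid F" by (metis A.E_cases)
      then show "\<chi> (a \<odot>\<^bsub>A.E\<^esub> m) = a \<odot>\<^bsub>B.E\<^esub> \<chi> m"
        using valid by (simp add: A.E_simps B.E_simps \<chi> v lm)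
    next
      fix x m assume "x \<in> carrier L" "m \<in> carrier A.E"
      then obtain F where "m = A.cls F" "A.valid F" by (metis A.E_cases)
      then show "\<chi> (action A.E x m) = action B.E x (\<chi> m)"
        using valid \<open>x \<in> carrier L\<close> by (simp add: A.E_simps B.E_simps \<chi> v lm)
    qed
    have lift: "B.valid G \<Longrightarrow> \<exists>F. A.valid F \<and> G = ?f F" for G
    proof (induction G)
      case empty
      then show ?case by (intro exI[of _ "{#}"]) simp
    next
      case (add z G)
      then obtain F where F: "A.valid F" "G = ?f F" by auto
      obtain u m where z: "z = (u, \<psi> m)" "u \<in> carrier (uea L)" "m \<in> carrier M"
        using add.prems unfolding surj by auto
      then show ?case using F by (intro exI[of _ "add_mset (u, m) F"]) simp
    qed
    show "carrier B.E = \<chi> ` carrier A.E"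
    proof
      show "\<chi> ` carrier A.E \<subseteq> carrier B.E" using valid by (auto simp: A.carrier_E B.carrier_E \<chi>)
      show "carrier B.E \<subseteq> \<chi> ` carrier A.E"
      proof
        fix s assume "s \<in> carrier B.E"
        then obtain G where G: "s = B.cls G" "B.valid G" by (metis B.E_cases)
        then obtain F where F: "A.valid F" "G = ?f F" using lift by blast
        then have "s = \<chi> (A.cls F)" using G \<chi> by simp
        then show "s \<in> \<chi> ` carrier A.E" using F(1) unfolding A.carrier_E by blast
      qed
    qed
  qed
qed

section \<open>Derivations of functions of words\<close>

text \<open>Membership of a word in the set of words over the algebra is kept folded, so that the simplifier
  can match it against the hypotheses of the following lemmas.\<close>

declare in_listsD [rule del] in_listsI [rule del]

text \<open>The sum of the values of \<open>h\<close> at the words in which one letter \<open>x\<close> is replaced by \<open>[x, n]\<close>: the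
  right adjoint action of \<open>n\<close> on words, transported to functions of words.\<close>

primrec deriv_words ::
    "'l lie_alg \<Rightarrow> ('k, 'e) lie_rep \<Rightarrow> 'l \<Rightarrow> ('l list \<Rightarrow> 'e) \<Rightarrow> 'l list \<Rightarrow> 'e" where
  "deriv_words L M n h [] = \<zero>\<^bsub>M\<^esub>"
| "deriv_words L M n h (x # xs) =
    h (lbracket L x n # xs) \<oplus>\<^bsub>M\<^esub> deriv_words L M n (\<lambda>ys. h (x # ys)) xs"

definition multilinear ::
    "'l::ab_group_add lie_alg \<Rightarrow> ('k, 'e) lie_rep \<Rightarrow> nat \<Rightarrow> ('l list \<Rightarrow> 'e) \<Rightarrow> bool" where
  "multilinear L M k h \<longleftrightarrow>
    (\<forall>xs\<in>lists (carrier L). length xs = k \<longrightarrow> h xs \<in> carrier M) \<and>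
    (\<forall>u\<in>lists (carrier L). \<forall>v\<in>lists (carrier L). \<forall>x\<in>carrier L. \<forall>y\<in>carrier L. \<forall>a.
      Suc (length u + length v) = k \<longrightarrow>
      h (u @ (lscale L a x + y) # v) = a \<odot>\<^bsub>M\<^esub> h (u @ x # v) \<oplus>\<^bsub>M\<^esub> h (u @ y # v))"

lemma multilinearI:
  assumes "\<And>xs. xs \<in> lists (carrier L) \<Longrightarrow> length xs = k \<Longrightarrow> h xs \<in> carrier M"
    and "\<And>u v x y a. u \<in> lists (carrier L) \<Longrightarrow> v \<in> lists (carrier L) \<Longrightarrow> x \<in> carrier L \<Longrightarrow> y \<in> carrier L \<Longrightarrow>
      Suc (length u + length v) = k \<Longrightarrow>
      h (u @ (lscale L a x + y) # v) = a \<odot>\<^bsub>M\<^esub> h (u @ x # v) \<oplus>\<^bsub>M\<^esub> h (u @ y # v)"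
  shows "multilinear L M k h"
  unfolding multilinear_def using assms by simp

lemma multilinearD:
  assumes "multilinear L M k h"
  shows "xs \<in> lists (carrier L) \<Longrightarrow> length xs = k \<Longrightarrow> h xs \<in> carrier M"
    and "u \<in> lists (carrier L) \<Longrightarrow> v \<in> lists (carrier L) \<Longrightarrow> x \<in> carrier L \<Longrightarrow> y \<in> carrier L \<Longrightarrow>
      Suc (length u + length v) = k \<Longrightarrow>
      h (u @ (lscale L a x + y) # v) = a \<odot>\<^bsub>M\<^esub> h (u @ x # v) \<oplus>\<^bsub>M\<^esub> h (u @ y # v)"
  using assms unfolding multilinear_def by simp_all

text \<open>The letters come from \<open>L\<close>, whereas the values lie in a module over the subalgebra \<open>P\<close> to which
  the lemmas will be applied; only sums and multiples of values are formed.\<close>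

locale word_functions = L: lie_algebra L + M: lie_module P M
  for L P :: "'l::ab_group_add lie_alg" and M :: "('l, 'e) lie_rep"
begin

abbreviation (input) Ls where "Ls \<equiv> lists (carrier L)"
abbreviation (input) C where "C \<equiv> carrier L"
abbreviation der where "der \<equiv> deriv_words L M"
abbreviation ml where "ml \<equiv> multilinear L M"

lemma comb_closed: "x \<in> C \<Longrightarrow> y \<in> C \<Longrightarrow> lscale L a x + y \<in> C"
  by (simp add: L.carrier_add L.carrier_scale)

lemma ml_Cons: "ml (Suc k) h \<Longrightarrow> x \<in> C \<Longrightarrow> ml k (\<lambda>ys. h (x # ys))"
  by (rule multilinearI) (use multilinearD(1)[of L M "Suc k" h] multilinearD(2)[of L M "Suc k" h "x # u" for u] in auto)

lemma der_closed:
  "xs \<in> Ls \<Longrightarrow> n \<in> C \<Longrightarrow> (\<And>ys. ys \<in> Ls \<Longrightarrow> length ys = length xs \<Longrightarrow> h ys \<in> carrier M) \<Longrightarrow> der n h xs \<in> carrier M"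
proof (induction xs arbitrary: h)
  case (Cons x xs)
  have "der n (\<lambda>ys. h (x # ys)) xs \<in> carrier M" using Cons by (intro Cons.IH) auto
  moreover have "h (lbracket L x n # xs) \<in> carrier M" using Cons by (auto simp: L.bracket_closed)
  ultimately show ?case by simp
qed simp

lemma der_closed_ml: "ml k h \<Longrightarrow> n \<in> C \<Longrightarrow> xs \<in> Ls \<Longrightarrow> length xs = k \<Longrightarrow> der n h xs \<in> carrier M"
  by (rule der_closed) (simp_all add: multilinearD(1))

lemma der_cong:
  "xs \<in> Ls \<Longrightarrow> n \<in> C \<Longrightarrow> (\<And>ys. ys \<in> Ls \<Longrightarrow> length ys = length xs \<Longrightarrow> h ys = h' ys) \<Longrightarrow> der n h xs = der n h' xs"
proof (induction xs arbitrary: h h')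
  case (Cons x xs)
  have "der n (\<lambda>ys. h (x # ys)) xs = der n (\<lambda>ys. h' (x # ys)) xs" using Cons by (intro Cons.IH) auto
  moreover have "h (lbracket L x n # xs) = h' (lbracket L x n # xs)" using Cons by (auto simp: L.bracket_closed)
  ultimately show ?case by simp
qed simp

lemma der_linear:
  "xs \<in> Ls \<Longrightarrow> n \<in> C \<Longrightarrow> (\<And>ys. ys \<in> Ls \<Longrightarrow> length ys = length xs \<Longrightarrow> h ys \<in> carrier M) \<Longrightarrow>
    (\<And>ys. ys \<in> Ls \<Longrightarrow> length ys = length xs \<Longrightarrow> h' ys \<in> carrier M) \<Longrightarrow>
    der n (\<lambda>ys. a \<odot>\<^bsub>M\<^esub> h ys \<oplus>\<^bsub>M\<^esub> h' ys) xs = a \<odot>\<^bsub>M\<^esub> der n h xs \<oplus>\<^bsub>M\<^esub> der n h' xs"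
proof (induction xs arbitrary: h h')
  case Nil
  then show ?case by (simp add: M.msimps)
next
  case (Cons x xs)
  have IH: "der n (\<lambda>ys. a \<odot>\<^bsub>M\<^esub> h (x # ys) \<oplus>\<^bsub>M\<^esub> h' (x # ys)) xs
      = a \<odot>\<^bsub>M\<^esub> der n (\<lambda>ys. h (x # ys)) xs \<oplus>\<^bsub>M\<^esub> der n (\<lambda>ys. h' (x # ys)) xs"
    using Cons by (intro Cons.IH) auto
  have c: "der n (\<lambda>ys. h (x # ys)) xs \<in> carrier M" "der n (\<lambda>ys. h' (x # ys)) xs \<in> carrier M"
    "h (lbracket L x n # xs) \<in> carrier M" "h' (lbracket L x n # xs) \<in> carrier M"
    using Cons by (auto intro!: der_closed simp: L.bracket_closed)
  show ?case using c by (simp add: IH M.msimps M.M.a_ac)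
qed

lemma der_add:
  assumes "xs \<in> Ls" "n \<in> C" "\<And>ys. ys \<in> Ls \<Longrightarrow> length ys = length xs \<Longrightarrow> h ys \<in> carrier M"
    "\<And>ys. ys \<in> Ls \<Longrightarrow> length ys = length xs \<Longrightarrow> h' ys \<in> carrier M"
  shows "der n (\<lambda>ys. h ys \<oplus>\<^bsub>M\<^esub> h' ys) xs = der n h xs \<oplus>\<^bsub>M\<^esub> der n h' xs"
proof -
  have "der n (\<lambda>ys. h ys \<oplus>\<^bsub>M\<^esub> h' ys) xs = der n (\<lambda>ys. 1 \<odot>\<^bsub>M\<^esub> h ys \<oplus>\<^bsub>M\<^esub> h' ys) xs"
    by (rule der_cong) (use assms in \<open>auto simp: M.msimps\<close>)
  then show ?thesis using der_linear[OF assms, where a = 1] der_closed[OF assms(1-3)] by (simp add: M.msimps)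
qed

lemma der_append:
  "u \<in> Ls \<Longrightarrow> v \<in> Ls \<Longrightarrow> n \<in> C \<Longrightarrow> (\<And>ys. ys \<in> Ls \<Longrightarrow> length ys = length u + length v \<Longrightarrow> h ys \<in> carrier M) \<Longrightarrow>
    der n h (u @ v) = der n (\<lambda>ys. h (ys @ v)) u \<oplus>\<^bsub>M\<^esub> der n (\<lambda>ys. h (u @ ys)) v"
proof (induction u arbitrary: h)
  case Nil
  then have "der n h v \<in> carrier M" by (intro der_closed) auto
  then show ?case by simp
next
  case (Cons x u)
  have IH: "der n (\<lambda>ys. h (x # ys)) (u @ v)
      = der n (\<lambda>ys. h (x # ys @ v)) u \<oplus>\<^bsub>M\<^esub> der n (\<lambda>ys. h (x # u @ ys)) v"
    using Cons by (intro Cons.IH) auto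
  have c: "der n (\<lambda>ys. h (x # ys @ v)) u \<in> carrier M" "der n (\<lambda>ys. h (x # u @ ys)) v \<in> carrier M"
    "h (lbracket L x n # u @ v) \<in> carrier M"
    using Cons by (auto intro!: der_closed simp: L.bracket_closed)
  show ?case using c by (simp add: IH M.M.a_ac)
qed

lemma der_direction_linear:
  "xs \<in> Ls \<Longrightarrow> n \<in> C \<Longrightarrow> n' \<in> C \<Longrightarrow> ml (length xs) h \<Longrightarrow>
    der (lscale L a n + n') h xs = a \<odot>\<^bsub>M\<^esub> der n h xs \<oplus>\<^bsub>M\<^esub> der n' h xs"
proof (induction xs arbitrary: h)
  case Nil
  then show ?case by (simp add: M.msimps)
next
  case (Cons x xs)
  note D = multilinearD[OF Cons.prems(4)]
  have x: "x \<in> C" "xs \<in> Ls" using Cons.prems by auto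
  have IH: "der (lscale L a n + n') (\<lambda>ys. h (x # ys)) xs
      = a \<odot>\<^bsub>M\<^esub> der n (\<lambda>ys. h (x # ys)) xs \<oplus>\<^bsub>M\<^esub> der n' (\<lambda>ys. h (x # ys)) xs"
    by (rule Cons.IH) (use Cons.prems ml_Cons in auto)
  have b: "lbracket L x (lscale L a n + n') = lscale L a (lbracket L x n) + lbracket L x n'"
    using Cons.prems x by (simp add: L.bracket_add_right L.bracket_scale_right L.carrier_scale)
  have h: "h (lbracket L x (lscale L a n + n') # xs) = a \<odot>\<^bsub>M\<^esub> h (lbracket L x n # xs) \<oplus>\<^bsub>M\<^esub> h (lbracket L x n' # xs)"
    unfolding b using D(2)[of "[]" xs "lbracket L x n" "lbracket L x n'" a] Cons.prems x
    by (simp add: L.bracket_closed)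
  have c: "der n (\<lambda>ys. h (x # ys)) xs \<in> carrier M" "der n' (\<lambda>ys. h (x # ys)) xs \<in> carrier M"
    "h (lbracket L x n # xs) \<in> carrier M" "h (lbracket L x n' # xs) \<in> carrier M"
    using Cons.prems(2,3) x D(1) der_closed_ml[OF ml_Cons[OF _ x(1)]] Cons.prems(4)
    by (simp_all add: L.bracket_closed)
  show ?case using c by (simp add: IH h M.msimps M.M.a_ac)
qed

lemma ml_add: "ml k h \<Longrightarrow> u \<in> Ls \<Longrightarrow> v \<in> Ls \<Longrightarrow> x \<in> C \<Longrightarrow> y \<in> C \<Longrightarrow> Suc (length u + length v) = k \<Longrightarrow>
    h (u @ (x + y) # v) = h (u @ x # v) \<oplus>\<^bsub>M\<^esub> h (u @ y # v)"
  using multilinearD(2)[of L M k h u v x y 1] multilinearD(1)[of L M k h "u @ x # v"] by (simp add: M.msimps)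

lemma ml_zero:
  assumes "ml k h" "u \<in> Ls" "v \<in> Ls" "Suc (length u + length v) = k"
  shows "h (u @ 0 # v) = \<zero>\<^bsub>M\<^esub>"
proof -
  have "h (u @ 0 # v) \<in> carrier M" using multilinearD(1)[OF assms(1), of "u @ 0 # v"] assms L.carrier_zero by auto
  moreover have "h (u @ 0 # v) = h (u @ 0 # v) \<oplus>\<^bsub>M\<^esub> h (u @ 0 # v)"
    using ml_add[OF assms(1-3) L.carrier_zero L.carrier_zero assms(4)] by simp
  ultimately show ?thesis by (metis M.M.add.l_cancel_one)
qed

lemma ml_scale: "ml k h \<Longrightarrow> u \<in> Ls \<Longrightarrow> v \<in> Ls \<Longrightarrow> x \<in> C \<Longrightarrow> Suc (length u + length v) = k \<Longrightarrow>
    h (u @ lscale L a x # v) = a \<odot>\<^bsub>M\<^esub> h (u @ x # v)"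
  using multilinearD(2)[of L M k h u v x 0 a] multilinearD(1)[of L M k h "u @ x # v"] L.carrier_zero
  by (simp add: ml_zero)

lemma der_zero: "xs \<in> Ls \<Longrightarrow> ml (length xs) h \<Longrightarrow> der 0 h xs = \<zero>\<^bsub>M\<^esub>"
proof (induction xs arbitrary: h)
  case (Cons x xs)
  then have x: "x \<in> C" "xs \<in> Ls" by auto
  have "lbracket L x 0 = 0" using L.bracket_scale_right[OF x(1) L.carrier_zero, of 0] by simp
  moreover have "h (0 # xs) = \<zero>\<^bsub>M\<^esub>" using ml_zero[OF Cons.prems(2), of "[]" xs] x by simp
  moreover have "der 0 (\<lambda>ys. h (x # ys)) xs = \<zero>\<^bsub>M\<^esub>" using Cons.prems x by (intro Cons.IH ml_Cons) auto
  ultimately show ?case by simp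
qed simp

lemma ml_der:
  assumes h: "ml k h" and n: "n \<in> C"
  shows "ml k (der n h)"
proof (rule multilinearI)
  note D = multilinearD[OF h]
  show "der n h xs \<in> carrier M" if "xs \<in> Ls" "length xs = k" for xs
    using that n D(1) by (intro der_closed) auto
  fix u v x y a assume a: "u \<in> Ls" "v \<in> Ls" "x \<in> C" "y \<in> C" "Suc (length u + length v) = k"
  let ?z = "lscale L a x + y"
  have z: "?z \<in> C" using a by (simp add: comb_closed)
  have exp: "der n h (u @ w # v)
      = der n (\<lambda>ys. h (ys @ w # v)) u \<oplus>\<^bsub>M\<^esub> (h (u @ lbracket L w n # v) \<oplus>\<^bsub>M\<^esub> der n (\<lambda>ys. h (u @ w # ys)) v)"
    if "w \<in> C" for w
    using der_append[of u "w # v" n h] that a n D(1) by simp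
  have 1: "der n (\<lambda>ys. h (ys @ ?z # v)) u = a \<odot>\<^bsub>M\<^esub> der n (\<lambda>ys. h (ys @ x # v)) u \<oplus>\<^bsub>M\<^esub> der n (\<lambda>ys. h (ys @ y # v)) u"
  proof -
    have "der n (\<lambda>ys. h (ys @ ?z # v)) u
      = der n (\<lambda>ys. a \<odot>\<^bsub>M\<^esub> h (ys @ x # v) \<oplus>\<^bsub>M\<^esub> h (ys @ y # v)) u"
      by (rule der_cong) (use a n D(2) in simp_all)
    also have "\<dots> = a \<odot>\<^bsub>M\<^esub> der n (\<lambda>ys. h (ys @ x # v)) u \<oplus>\<^bsub>M\<^esub> der n (\<lambda>ys. h (ys @ y # v)) u"
      by (rule der_linear) (use a n D(1) in simp_all)
    finally show ?thesis .
  qed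
  have 2: "der n (\<lambda>ys. h (u @ ?z # ys)) v
    = a \<odot>\<^bsub>M\<^esub> der n (\<lambda>ys. h (u @ x # ys)) v \<oplus>\<^bsub>M\<^esub> der n (\<lambda>ys. h (u @ y # ys)) v"
  proof -
    have "der n (\<lambda>ys. h (u @ ?z # ys)) v
      = der n (\<lambda>ys. a \<odot>\<^bsub>M\<^esub> h (u @ x # ys) \<oplus>\<^bsub>M\<^esub> h (u @ y # ys)) v"
      by (rule der_cong) (use a n D(2) in simp_all)
    also have "\<dots> = a \<odot>\<^bsub>M\<^esub> der n (\<lambda>ys. h (u @ x # ys)) v \<oplus>\<^bsub>M\<^esub> der n (\<lambda>ys. h (u @ y # ys)) v"
      by (rule der_linear) (use a n D(1) in simp_all)
    finally show ?thesis .
  qed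
  have b: "lbracket L ?z n = lscale L a (lbracket L x n) + lbracket L y n"
    using a n by (simp add: L.bracket_add_left L.bracket_scale_left L.carrier_scale)
  have 3: "h (u @ lbracket L ?z n # v) = a \<odot>\<^bsub>M\<^esub> h (u @ lbracket L x n # v) \<oplus>\<^bsub>M\<^esub> h (u @ lbracket L y n # v)"
    unfolding b using a n by (intro D(2)) (auto simp: L.bracket_closed)
  have c: "der n (\<lambda>ys. h (ys @ w # v)) u \<in> carrier M" "h (u @ lbracket L w n # v) \<in> carrier M"
    "der n (\<lambda>ys. h (u @ w # ys)) v \<in> carrier M" if "w \<in> C" for w
  proof -
    show "der n (\<lambda>ys. h (ys @ w # v)) u \<in> carrier M" by (rule der_closed) (use that a n D(1) in simp_all)
    show "h (u @ lbracket L w n # v) \<in> carrier M" using that a n D(1) by (simp add: L.bracket_closed)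
    show "der n (\<lambda>ys. h (u @ w # ys)) v \<in> carrier M" by (rule der_closed) (use that a n D(1) in simp_all)
  qed
  show "der n h (u @ ?z # v) = a \<odot>\<^bsub>M\<^esub> der n h (u @ x # v) \<oplus>\<^bsub>M\<^esub> der n h (u @ y # v)"
    unfolding exp[OF z] exp[OF a(3)] exp[OF a(4)] 1 2 3
    using c[OF a(3)] c[OF a(4)] by (simp add: M.msimps M.M.a_ac)
qed

lemma bracket_neg_right: "x \<in> C \<Longrightarrow> y \<in> C \<Longrightarrow> lbracket L x (- y) = - lbracket L x y"
  using L.bracket_scale_right[of x y "-1"] by simp

text \<open>The Jacobi identity for the right adjoint action.\<close>

lemma jacobi_right:
  assumes "z \<in> C" "y \<in> C" "x \<in> C"
  shows "lbracket L (lbracket L z y) x = lbracket L (lbracket L z x) y + lbracket L z (lbracket L y x)"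
proof -
  define a where "a = lbracket L x (lbracket L z y)"
  define b where "b = lbracket L y (lbracket L z x)"
  define c where "c = lbracket L z (lbracket L y x)"
  have A: "lbracket L (lbracket L z y) x = - a"
    unfolding a_def by (rule L.bracket_swap) (use assms L.bracket_closed in auto)
  have B: "lbracket L (lbracket L z x) y = - b"
    unfolding b_def by (rule L.bracket_swap) (use assms L.bracket_closed in auto)
  have "lbracket L y (lbracket L x z) = - b"
    unfolding b_def using L.bracket_swap[of x z] bracket_neg_right assms L.bracket_closed by simp
  then have j: "a + c + - b = 0" using L.jacobi[OF assms(3,1,2)] by (simp add: a_def c_def add.assoc)
  have "c = (a + c + - b) + (b - a)" by simp
  then have "c = b - a" unfolding j by simp
  then show ?thesis unfolding A B c_def[symmetric] by simp
qed

text \<open>The right adjoint action on words is a Lie algebra action: applying \<open>y\<close> and then \<open>x\<close> differs from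
  the opposite order by the action of \<open>[y, x]\<close>. In terms of functions the order of composition is
  reversed.\<close>

lemma der_commute:
  "xs \<in> Ls \<Longrightarrow> x \<in> C \<Longrightarrow> y \<in> C \<Longrightarrow> ml (length xs) h \<Longrightarrow>
    der y (der x h) xs = der x (der y h) xs \<oplus>\<^bsub>M\<^esub> der (lbracket L y x) h xs"
proof (induction xs arbitrary: h)
  case (Cons z xs)
  have z: "z \<in> C" "xs \<in> Ls" using Cons.prems by auto
  note h = Cons.prems(4)
  note D = multilinearD[OF h]
  have hz: "ml (length xs) (\<lambda>ys. h (w # ys))" if "w \<in> C" for w using h that by (intro ml_Cons) auto
  have cc: "h (w # ys) \<in> carrier M" if "w \<in> C" "ys \<in> Ls" "length ys = length xs" for w ys
    using that D(1)[of "w # ys"] by simp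
  have dc: "der n (\<lambda>ys. h (w # ys)) ys \<in> carrier M" if "n \<in> C" "w \<in> C" "ys \<in> Ls" "length ys = length xs" for n w ys
    using multilinearD(1)[OF ml_der[OF hz[OF that(2)] that(1)] that(3,4)] .
  have ddc: "der n (der n' (\<lambda>ys. h (z # ys))) xs \<in> carrier M" if "n \<in> C" "n' \<in> C" for n n'
    using multilinearD(1)[OF ml_der[OF ml_der[OF hz[OF z(1)] that(2)] that(1)] z(2)] by simp
  have exp: "der b (der a h) (z # xs) = h (lbracket L (lbracket L z b) a # xs)
     \<oplus>\<^bsub>M\<^esub> der a (\<lambda>ys. h (lbracket L z b # ys)) xs \<oplus>\<^bsub>M\<^esub> (der b (\<lambda>ys. h (lbracket L z a # ys)) xs
     \<oplus>\<^bsub>M\<^esub> der b (der a (\<lambda>ys. h (z # ys))) xs)" if "a \<in> C" "b \<in> C" for a b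
  proof -
    have "der b (\<lambda>ys. der a h (z # ys)) xs
      = der b (\<lambda>ys. h (lbracket L z a # ys)) xs \<oplus>\<^bsub>M\<^esub> der b (der a (\<lambda>ys. h (z # ys))) xs"
      unfolding deriv_words.simps
      by (rule der_add) (use that z cc dc L.bracket_closed in auto)
    then show ?thesis by simp
  qed
  have IH: "der y (der x (\<lambda>ys. h (z # ys))) xs
    = der x (der y (\<lambda>ys. h (z # ys))) xs \<oplus>\<^bsub>M\<^esub> der (lbracket L y x) (\<lambda>ys. h (z # ys)) xs"
    by (rule Cons.IH[OF z(2) Cons.prems(2,3) hz[OF z(1)]])
  have j: "h (lbracket L (lbracket L z y) x # xs)
    = h (lbracket L (lbracket L z x) y # xs) \<oplus>\<^bsub>M\<^esub> h (lbracket L z (lbracket L y x) # xs)"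
    unfolding jacobi_right[OF z(1) Cons.prems(3,2)]
    using ml_add[OF h, of "[]" xs "lbracket L (lbracket L z x) y" "lbracket L z (lbracket L y x)"]
      z Cons.prems(2,3) by (simp add: L.bracket_closed)
  have b: "lbracket L z x \<in> C" "lbracket L z y \<in> C" "lbracket L y x \<in> C"
    "lbracket L (lbracket L z x) y \<in> C" "lbracket L z (lbracket L y x) \<in> C"
    using z Cons.prems by (simp_all add: L.bracket_closed)
  have "der x (\<lambda>ys. h (lbracket L z y # ys)) xs \<in> carrier M" "der y (\<lambda>ys. h (lbracket L z x # ys)) xs \<in> carrier M"
    "der x (der y (\<lambda>ys. h (z # ys))) xs \<in> carrier M" "der (lbracket L y x) (\<lambda>ys. h (z # ys)) xs \<in> carrier M"
    "h (lbracket L (lbracket L z x) y # xs) \<in> carrier M" "h (lbracket L z (lbracket L y x) # xs) \<in> carrier M"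
    using Cons.prems(2,3) z b by (simp_all add: dc ddc cc)
  then show ?case
    unfolding exp[OF Cons.prems(2,3)] exp[OF Cons.prems(3,2)] IH j by (simp add: M.M.a_ac)
qed simp

end

section \<open>The value of a word modulo a complementary subalgebra\<close>

text \<open>The algebra is the direct sum of the subalgebra \<open>P\<close> and a complement \<open>N\<close> that is also a subalgebra,
  with \<open>pN\<close> the projection onto \<open>N\<close>.\<close>

locale split_extension = scalar_extension L P M
  for L P :: "'l::ab_group_add lie_alg" and M :: "('l, ('l uea, 'v) elt) lie_rep" +
  fixes N :: "'l set" and pN :: "'l \<Rightarrow> 'l"
  assumes N_sub: "N \<subseteq> carrier L"
    and N_bracket: "x \<in> N \<Longrightarrow> y \<in> N \<Longrightarrow> lbracket L x y \<in> N"
    and pN_N: "x \<in> carrier L \<Longrightarrow> pN x \<in> N"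
    and pN_P: "x \<in> carrier L \<Longrightarrow> x - pN x \<in> carrier P"
    and pN_on_N: "x \<in> N \<Longrightarrow> pN x = x"
    and pN_on_P: "x \<in> carrier P \<Longrightarrow> pN x = 0"
    and pN_linear: "x \<in> carrier L \<Longrightarrow> y \<in> carrier L \<Longrightarrow> pN (lscale L a x + y) = lscale L a (pN x) + pN y"
begin

sublocale W: word_functions L P M ..

abbreviation (input) C where "C \<equiv> carrier L"
abbreviation (input) Ls where "Ls \<equiv> lists (carrier L)"

definition pP :: "'l \<Rightarrow> 'l" where
  "pP x = x - pN x"

lemma pN_C: "x \<in> C \<Longrightarrow> pN x \<in> C" using pN_N N_sub by blast
lemma pP_P: "x \<in> C \<Longrightarrow> pP x \<in> carrier P" unfolding pP_def by (rule pN_P)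
lemma pP_C: "x \<in> C \<Longrightarrow> pP x \<in> C" using pP_P P_sub by blast
lemma pN_pP: "x = pP x + pN x" by (simp add: pP_def)

lemma pP_linear: "x \<in> C \<Longrightarrow> y \<in> C \<Longrightarrow> pP (lscale L a x + y) = lscale P a (pP x) + pP y"
  unfolding pP_def pN_linear P_scale by (simp add: L.scale_right_diff_distrib)

lemma pP_action: "x \<in> C \<Longrightarrow> y \<in> C \<Longrightarrow> m \<in> carrier M \<Longrightarrow>
    action M (pP (lscale L a x + y)) m = a \<odot>\<^bsub>M\<^esub> action M (pP x) m \<oplus>\<^bsub>M\<^esub> action M (pP y) m"
  by (simp add: pP_linear M.add_action M.scale_action M.carrier_scale pP_P)

text \<open>The component in \<open>M\<close> of \<open>x\<^sub>1 \<cdots> x\<^sub>n \<otimes> m\<close> when everything in \<open>N U(L) \<otimes> M\<close> is discarded. The list holds the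
  letters in reverse, so that its head is the letter next to \<open>m\<close>. Write this letter as a sum of a
  part in \<open>P\<close> and a part in \<open>N\<close>. The first acts on \<open>m\<close>. The second is moved to the left end of the
  word, where it is discarded; on its way it is bracketed with each of the other letters in turn,
  which is the derivation in the second summand.\<close>

primrec hc_aux :: "nat \<Rightarrow> 'l list \<Rightarrow> ('l uea, 'v) elt \<Rightarrow> ('l uea, 'v) elt" where
  "hc_aux 0 xs m = m"
| "hc_aux (Suc k) xs m = hc_aux k (tl xs) (action M (pP (hd xs)) m)
    \<oplus>\<^bsub>M\<^esub> W.der (pN (hd xs)) (\<lambda>ys. hc_aux k ys m) (tl xs)"

definition hc :: "'l list \<Rightarrow> ('l uea, 'v) elt \<Rightarrow> ('l uea, 'v) elt" where
  "hc xs m = hc_aux (length xs) xs m"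

lemma hc_Nil [simp]: "hc [] m = m"
  by (simp add: hc_def)

lemma hc_Cons:
  assumes "x \<in> C" "xs \<in> Ls"
  shows "hc (x # xs) m = hc xs (action M (pP x) m) \<oplus>\<^bsub>M\<^esub> W.der (pN x) (\<lambda>ys. hc ys m) xs"
proof -
  have "W.der (pN x) (\<lambda>ys. hc_aux (length xs) ys m) xs = W.der (pN x) (\<lambda>ys. hc ys m) xs"
    by (rule W.der_cong) (use assms pN_C in \<open>simp_all add: hc_def\<close>)
  then show ?thesis by (simp add: hc_def)
qed

text \<open>Linearity in the letters and linearity in \<open>m\<close> have to be proved together: when a letter acts on
  \<open>m\<close>, the one is reduced to the other.\<close>

lemma hc_linear_aux:
  "(\<forall>m\<in>carrier M. W.ml k (\<lambda>xs. hc xs m)) \<and>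
   (\<forall>xs\<in>Ls. length xs = k \<longrightarrow> (\<forall>m\<in>carrier M. \<forall>n\<in>carrier M. \<forall>a.
      hc xs (a \<odot>\<^bsub>M\<^esub> m \<oplus>\<^bsub>M\<^esub> n) = a \<odot>\<^bsub>M\<^esub> hc xs m \<oplus>\<^bsub>M\<^esub> hc xs n))"
proof (induction k)
  case 0
  show ?case by (auto intro!: multilinearI)
next
  case (Suc k)
  have ml: "W.ml k (\<lambda>xs. hc xs m)" if "m \<in> carrier M" for m using Suc that by blast
  have lin: "hc xs (a \<odot>\<^bsub>M\<^esub> m \<oplus>\<^bsub>M\<^esub> n) = a \<odot>\<^bsub>M\<^esub> hc xs m \<oplus>\<^bsub>M\<^esub> hc xs n"
    if "xs \<in> Ls" "length xs = k" "m \<in> carrier M" "n \<in> carrier M" for xs a m n using Suc that by blast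
  note D = multilinearD[OF ml]
  have act: "action M (pP x) m \<in> carrier M" if "x \<in> C" "m \<in> carrier M" for x m
    using that pP_P M.action_closed by blast
  have c: "hc xs (action M (pP x) m) \<in> carrier M" "W.der (pN x) (\<lambda>ys. hc ys m) xs \<in> carrier M"
    if "x \<in> C" "xs \<in> Ls" "length xs = k" "m \<in> carrier M" for x xs m
    using D(1)[OF act[OF that(1,4)] that(2,3)] W.der_closed_ml[OF ml[OF that(4)] pN_C[OF that(1)] that(2,3)] .
  have "W.ml (Suc k) (\<lambda>xs. hc xs m)" if m: "m \<in> carrier M" for m
  proof (rule multilinearI)
    fix xs assume xs: "xs \<in> Ls" "length xs = Suc k"
    then obtain x ys where "xs = x # ys" "x \<in> C" "ys \<in> Ls" "length ys = k" by (cases xs) auto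
    then show "hc xs m \<in> carrier M" using c[of x ys m] m by (simp add: hc_Cons)
  next
    fix u v x y a assume a: "u \<in> Ls" "v \<in> Ls" "x \<in> C" "y \<in> C" "Suc (length u + length v) = Suc k"
    let ?z = "lscale L a x + y"
    have z: "?z \<in> C" using a W.comb_closed by simp
    show "hc (u @ ?z # v) m = a \<odot>\<^bsub>M\<^esub> hc (u @ x # v) m \<oplus>\<^bsub>M\<^esub> hc (u @ y # v) m"
    proof (cases u)
      case Nil
      have k: "length v = k" using a Nil by simp
      have "hc v (action M (pP ?z) m) = a \<odot>\<^bsub>M\<^esub> hc v (action M (pP x) m) \<oplus>\<^bsub>M\<^esub> hc v (action M (pP y) m)"
        unfolding pP_action[OF a(3,4) m] by (rule lin[OF a(2) k act[OF a(3) m] act[OF a(4) m]])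
      moreover have "W.der (pN ?z) (\<lambda>ys. hc ys m) v
        = a \<odot>\<^bsub>M\<^esub> W.der (pN x) (\<lambda>ys. hc ys m) v \<oplus>\<^bsub>M\<^esub> W.der (pN y) (\<lambda>ys. hc ys m) v"
        unfolding pN_linear[OF a(3,4)]
        by (rule W.der_direction_linear[OF a(2) pN_C[OF a(3)] pN_C[OF a(4)]]) (use ml[OF m] k in simp)
      ultimately show ?thesis
        using c[OF a(3) a(2) k m] c[OF a(4) a(2) k m] z a
        by (simp add: Nil hc_Cons M.msimps M.M.a_ac)
    next
      case (Cons w u')
      have w: "w \<in> C" "u' \<in> Ls" "Suc (length u' + length v) = k" using a Cons by auto
      have 1: "hc (u' @ ?z # v) (action M (pP w) m)
        = a \<odot>\<^bsub>M\<^esub> hc (u' @ x # v) (action M (pP w) m) \<oplus>\<^bsub>M\<^esub> hc (u' @ y # v) (action M (pP w) m)"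
        by (rule D(2)[OF act[OF w(1) m] w(2) a(2-4) w(3)])
      have 2: "W.der (pN w) (\<lambda>ys. hc ys m) (u' @ ?z # v) = a \<odot>\<^bsub>M\<^esub> W.der (pN w) (\<lambda>ys. hc ys m) (u' @ x # v)
          \<oplus>\<^bsub>M\<^esub> W.der (pN w) (\<lambda>ys. hc ys m) (u' @ y # v)"
        by (rule multilinearD(2)[OF W.ml_der[OF ml[OF m] pN_C[OF w(1)]] w(2) a(2-4) w(3)])
      have l: "u' @ q # v \<in> Ls" "length (u' @ q # v) = k" if "q \<in> C" for q using that w a by auto
      show ?thesis
        using c[OF w(1) l[OF a(3)] m] c[OF w(1) l[OF a(4)] m] z a w
        by (simp add: Cons hc_Cons 1 2 M.msimps M.M.a_ac)
    qed
  qed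
  moreover have "hc xs (a \<odot>\<^bsub>M\<^esub> m \<oplus>\<^bsub>M\<^esub> n) = a \<odot>\<^bsub>M\<^esub> hc xs m \<oplus>\<^bsub>M\<^esub> hc xs n"
    if xs: "xs \<in> Ls" "length xs = Suc k" and m: "m \<in> carrier M" "n \<in> carrier M" for xs m n a
  proof -
    obtain x ys where e: "xs = x # ys" "x \<in> C" "ys \<in> Ls" "length ys = k" using xs by (cases xs) auto
    have "action M (pP x) (a \<odot>\<^bsub>M\<^esub> m \<oplus>\<^bsub>M\<^esub> n) = a \<odot>\<^bsub>M\<^esub> action M (pP x) m \<oplus>\<^bsub>M\<^esub> action M (pP x) n"
      using m pP_P[OF e(2)] by (simp add: M.action_add M.action_smult)
    then have 1: "hc ys (action M (pP x) (a \<odot>\<^bsub>M\<^esub> m \<oplus>\<^bsub>M\<^esub> n))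
      = a \<odot>\<^bsub>M\<^esub> hc ys (action M (pP x) m) \<oplus>\<^bsub>M\<^esub> hc ys (action M (pP x) n)"
      using lin[OF e(3,4) act[OF e(2) m(1)] act[OF e(2) m(2)]] by simp
    have "W.der (pN x) (\<lambda>ys. hc ys (a \<odot>\<^bsub>M\<^esub> m \<oplus>\<^bsub>M\<^esub> n)) ys
      = W.der (pN x) (\<lambda>ys. a \<odot>\<^bsub>M\<^esub> hc ys m \<oplus>\<^bsub>M\<^esub> hc ys n) ys"
      by (rule W.der_cong[OF e(3) pN_C[OF e(2)]]) (use lin m e in simp)
    also have "\<dots> = a \<odot>\<^bsub>M\<^esub> W.der (pN x) (\<lambda>ys. hc ys m) ys \<oplus>\<^bsub>M\<^esub> W.der (pN x) (\<lambda>ys. hc ys n) ys"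
      by (rule W.der_linear[OF e(3) pN_C[OF e(2)]]) (use D(1) m e in simp_all)
    finally have 2: "W.der (pN x) (\<lambda>ys. hc ys (a \<odot>\<^bsub>M\<^esub> m \<oplus>\<^bsub>M\<^esub> n)) ys
      = a \<odot>\<^bsub>M\<^esub> W.der (pN x) (\<lambda>ys. hc ys m) ys \<oplus>\<^bsub>M\<^esub> W.der (pN x) (\<lambda>ys. hc ys n) ys" .
    show ?thesis
      unfolding e(1) hc_Cons[OF e(2,3)] 1 2
      using c[OF e(2-4) m(1)] c[OF e(2-4) m(2)] by (simp add: M.msimps M.M.a_ac)
  qed
  ultimately show ?case by blast
qed

lemma hc_ml: "m \<in> carrier M \<Longrightarrow> W.ml k (\<lambda>xs. hc xs m)"
  using hc_linear_aux by blast

lemma hc_closed: "xs \<in> Ls \<Longrightarrow> m \<in> carrier M \<Longrightarrow> hc xs m \<in> carrier M"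
  using multilinearD(1)[OF hc_ml] by blast

lemma hc_linear: "xs \<in> Ls \<Longrightarrow> m \<in> carrier M \<Longrightarrow> n \<in> carrier M \<Longrightarrow>
    hc xs (a \<odot>\<^bsub>M\<^esub> m \<oplus>\<^bsub>M\<^esub> n) = a \<odot>\<^bsub>M\<^esub> hc xs m \<oplus>\<^bsub>M\<^esub> hc xs n"
  using hc_linear_aux[of "length xs"] by blast

lemma hc_add: "xs \<in> Ls \<Longrightarrow> m \<in> carrier M \<Longrightarrow> n \<in> carrier M \<Longrightarrow>
    hc xs (m \<oplus>\<^bsub>M\<^esub> n) = hc xs m \<oplus>\<^bsub>M\<^esub> hc xs n"
  using hc_linear[of xs m n 1] hc_closed by (simp add: M.msimps)

lemma hc_zero: assumes "xs \<in> Ls" shows "hc xs \<zero>\<^bsub>M\<^esub> = \<zero>\<^bsub>M\<^esub>"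
proof -
  have "hc xs \<zero>\<^bsub>M\<^esub> = hc xs \<zero>\<^bsub>M\<^esub> \<oplus>\<^bsub>M\<^esub> hc xs \<zero>\<^bsub>M\<^esub>" using hc_add[OF assms, of "\<zero>\<^bsub>M\<^esub>" "\<zero>\<^bsub>M\<^esub>"] by simp
  then show ?thesis using hc_closed[OF assms, of "\<zero>\<^bsub>M\<^esub>"] by (metis M.M.add.l_cancel_one M.M.zero_closed)
qed

lemma hc_smult: "xs \<in> Ls \<Longrightarrow> m \<in> carrier M \<Longrightarrow> hc xs (a \<odot>\<^bsub>M\<^esub> m) = a \<odot>\<^bsub>M\<^esub> hc xs m"
  using hc_linear[of xs m "\<zero>\<^bsub>M\<^esub>" a] hc_closed by (simp add: hc_zero)

lemma hc_slot_add: "m \<in> carrier M \<Longrightarrow> u \<in> Ls \<Longrightarrow> v \<in> Ls \<Longrightarrow> x \<in> C \<Longrightarrow> y \<in> C \<Longrightarrow>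
    hc (u @ (x + y) # v) m = hc (u @ x # v) m \<oplus>\<^bsub>M\<^esub> hc (u @ y # v) m"
  by (rule W.ml_add[OF hc_ml]) auto

lemma hc_slot_scale: "m \<in> carrier M \<Longrightarrow> u \<in> Ls \<Longrightarrow> v \<in> Ls \<Longrightarrow> x \<in> C \<Longrightarrow>
    hc (u @ lscale L a x # v) m = a \<odot>\<^bsub>M\<^esub> hc (u @ x # v) m"
  by (rule W.ml_scale[OF hc_ml]) auto


text \<open>The relation for the two letters next to \<open>m\<close>. Both sides are expanded by moving both letters; the
  terms in which only one of them is moved cancel in pairs. What remains are three brackets: that of
  the parts in \<open>P\<close>, accounted for by the action on \<open>M\<close>; that of the parts in \<open>N\<close>, accounted for by the
  commutator of two derivations; and the mixed ones. Here it matters that \<open>P\<close> and \<open>N\<close> are both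
  subalgebras: the first bracket has no part in \<open>N\<close> and the second none in \<open>P\<close>.\<close>

lemma hc_relation_base:
  assumes v: "v \<in> Ls" and x: "x \<in> C" and y: "y \<in> C" and m: "m \<in> carrier M"
  shows "hc (y # x # v) m = hc (lbracket L x y # v) m \<oplus>\<^bsub>M\<^esub> hc (x # y # v) m"
proof -
  let ?d = "\<lambda>n. W.der n (\<lambda>ys. hc ys m) v"
  have act: "action M (pP x) m \<in> carrier M" if "x \<in> C" "m \<in> carrier M" for x m
    using that pP_P M.action_closed by blast
  have dcl: "W.der n (\<lambda>ys. hc ys m') v \<in> carrier M" if "n \<in> C" "m' \<in> carrier M" for n m'
    by (rule W.der_closed_ml[OF hc_ml[OF that(2)] that(1) v refl])
  have ddcl: "W.der n (W.der n' (\<lambda>ys. hc ys m)) v \<in> carrier M" if "n \<in> C" "n' \<in> C" for n n'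
    by (rule W.der_closed_ml[OF W.ml_der[OF hc_ml[OF m] that(2)] that(1) v refl])
  have exp: "hc (b # a # v) m = hc v (action M (pP a) (action M (pP b) m))
      \<oplus>\<^bsub>M\<^esub> W.der (pN a) (\<lambda>ys. hc ys (action M (pP b) m)) v
      \<oplus>\<^bsub>M\<^esub> (hc (lbracket L a (pN b) # v) m \<oplus>\<^bsub>M\<^esub> (W.der (pN b) (\<lambda>ys. hc ys (action M (pP a) m)) v
      \<oplus>\<^bsub>M\<^esub> W.der (pN b) (W.der (pN a) (\<lambda>ys. hc ys m)) v))"
    if a: "a \<in> C" and b: "b \<in> C" for a b
  proof -
    have "W.der (pN b) (\<lambda>ys. hc (a # ys) m) v
      = W.der (pN b) (\<lambda>ys. hc ys (action M (pP a) m) \<oplus>\<^bsub>M\<^esub> W.der (pN a) (\<lambda>ys. hc ys m) ys) v"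
      by (rule W.der_cong[OF v pN_C[OF b]]) (simp add: hc_Cons a)
    also have "\<dots> = W.der (pN b) (\<lambda>ys. hc ys (action M (pP a) m)) v
      \<oplus>\<^bsub>M\<^esub> W.der (pN b) (W.der (pN a) (\<lambda>ys. hc ys m)) v"
      by (rule W.der_add[OF v pN_C[OF b]])
        (use act[OF a m] hc_closed W.der_closed_ml[OF hc_ml[OF m] pN_C[OF a]] in simp_all)
    finally have 1: "W.der (pN b) (\<lambda>ys. hc (a # ys) m) v = W.der (pN b) (\<lambda>ys. hc ys (action M (pP a) m)) v
      \<oplus>\<^bsub>M\<^esub> W.der (pN b) (W.der (pN a) (\<lambda>ys. hc ys m)) v" .
    show ?thesis using a b v by (simp add: hc_Cons[of b "a # v"] hc_Cons[of a v "action M (pP b) m"] 1)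
  qed
  define z where "z = lbracket L x (pN y) - lbracket L y (pN x) - lbracket L x y"
  have br: "lbracket L (pP x) (pP y) \<in> carrier P" "lbracket L (pN x) (pN y) \<in> N"
    using M.bracket_closed[OF pP_P[OF x] pP_P[OF y]] N_bracket[OF pN_N[OF x] pN_N[OF y]]
    by (simp_all add: P_bracket)
  have brC: "lbracket L (pP x) (pP y) \<in> C" "lbracket L (pN x) (pN y) \<in> C" using br P_sub N_sub by auto
  have e1: "lbracket L x y = lbracket L (pP x) (pP y) + lbracket L (pP x) (pN y)
     + lbracket L (pN x) (pP y) + lbracket L (pN x) (pN y)"
    using x y pN_pP[of x] pN_pP[of y] pP_C pN_C
      L.bracket_add_left[of "pP x" "pN x" y] L.bracket_add_right[of "pP x" "pP y" "pN y"]
      L.bracket_add_right[of "pN x" "pP y" "pN y"] by simp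
  have e2: "lbracket L x (pN y) = lbracket L (pP x) (pN y) + lbracket L (pN x) (pN y)"
    using x y pN_pP[of x] pP_C pN_C L.bracket_add_left[of "pP x" "pN x" "pN y"] by simp
  have e3: "lbracket L y (pN x) = - (lbracket L (pN x) (pP y) + lbracket L (pN x) (pN y))"
    using x y pN_pP[of y] pP_C pN_C L.bracket_add_right[of "pN x" "pP y" "pN y"] L.bracket_swap[of y "pN x"]
    by simp
  \<comment> \<open>the identity between letters by which the mixed brackets cancel\<close>
  have key: "lbracket L x (pN y) + lbracket L (pP x) (pP y)
    = lbracket L x y + lbracket L y (pN x) + lbracket L (pN x) (pN y)"
    unfolding e1 e2 e3 by simp
  have cl: "lbracket L x (pN y) \<in> C" "lbracket L y (pN x) \<in> C" "lbracket L x y \<in> C"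
    using x y pN_C L.bracket_closed by auto
  have cadd: "hc ((p + q) # v) m = hc (p # v) m \<oplus>\<^bsub>M\<^esub> hc (q # v) m" if "p \<in> C" "q \<in> C" for p q
    using hc_slot_add[OF m _ v that, of "[]"] by simp
  have K: "hc (lbracket L x (pN y) # v) m \<oplus>\<^bsub>M\<^esub> hc (lbracket L (pP x) (pP y) # v) m
    = hc (lbracket L x y # v) m \<oplus>\<^bsub>M\<^esub> hc (lbracket L y (pN x) # v) m \<oplus>\<^bsub>M\<^esub> hc (lbracket L (pN x) (pN y) # v) m"
    using arg_cong[OF key, of "\<lambda>z. hc (z # v) m"] cl brC by (simp add: cadd L.carrier_add)
  have KP: "hc (lbracket L (pP x) (pP y) # v) m = hc v (action M (lbracket L (pP x) (pP y)) m)"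
    using br brC v m by (simp add: hc_Cons pN_on_P pP_def W.der_zero[OF v hc_ml[OF m]] hc_closed M.action_closed)
  have KN: "hc (lbracket L (pN x) (pN y) # v) m = ?d (lbracket L (pN x) (pN y))"
    using br brC v m dcl[OF brC(2) m] by (simp add: hc_Cons pN_on_N pP_def hc_zero)
  have P: "hc v (action M (lbracket L (pP x) (pP y)) m) \<oplus>\<^bsub>M\<^esub> hc v (action M (pP y) (action M (pP x) m))
    = hc v (action M (pP x) (action M (pP y) m))"
    using M.bracket_action'[OF pP_P[OF x] pP_P[OF y] m] br m act x y
    by (simp add: hc_add[OF v, symmetric] M.action_closed P_bracket)
  have Dc: "W.der (pN x) (W.der (pN y) (\<lambda>ys. hc ys m)) v
    = W.der (pN y) (W.der (pN x) (\<lambda>ys. hc ys m)) v \<oplus>\<^bsub>M\<^esub> ?d (lbracket L (pN x) (pN y))"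
    by (rule W.der_commute[OF v pN_C[OF y] pN_C[OF x] hc_ml[OF m]])
  \<comment> \<open>From here on only the additive group is used; the terms are named to keep the sums readable.\<close>
  define A where "A = hc v (action M (pP x) (action M (pP y) m))"
  define A' where "A' = hc v (action M (pP y) (action M (pP x) m))"
  define Br where "Br = hc v (action M (lbracket L (pP x) (pP y)) m)"
  define Bx where "Bx = W.der (pN x) (\<lambda>ys. hc ys (action M (pP y) m)) v"
  define By where "By = W.der (pN y) (\<lambda>ys. hc ys (action M (pP x) m)) v"
  define Z where "Z = hc (lbracket L x (pN y) # v) m"
  define Z' where "Z' = hc (lbracket L y (pN x) # v) m"
  define Z0 where "Z0 = hc (lbracket L x y # v) m"
  define Dn where "Dn = ?d (lbracket L (pN x) (pN y))"
  define DD where "DD = W.der (pN y) (W.der (pN x) (\<lambda>ys. hc ys m)) v"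
  have cs: "A \<in> carrier M" "A' \<in> carrier M" "Br \<in> carrier M" "Bx \<in> carrier M" "By \<in> carrier M"
    "Z \<in> carrier M" "Z' \<in> carrier M" "Z0 \<in> carrier M" "Dn \<in> carrier M" "DD \<in> carrier M"
    unfolding A_def A'_def Br_def Bx_def By_def Z_def Z'_def Z0_def Dn_def DD_def
    using v m x y act pN_C cl brC br by (simp_all add: hc_closed dcl ddcl M.action_closed)
  have L1: "hc (y # x # v) m = A \<oplus>\<^bsub>M\<^esub> Bx \<oplus>\<^bsub>M\<^esub> (Z \<oplus>\<^bsub>M\<^esub> (By \<oplus>\<^bsub>M\<^esub> DD))"
    unfolding exp[OF x y] A_def Bx_def Z_def By_def DD_def by simp
  have R1: "hc (x # y # v) m = A' \<oplus>\<^bsub>M\<^esub> By \<oplus>\<^bsub>M\<^esub> (Z' \<oplus>\<^bsub>M\<^esub> (Bx \<oplus>\<^bsub>M\<^esub> (DD \<oplus>\<^bsub>M\<^esub> Dn)))"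
    unfolding exp[OF y x] A'_def By_def Z'_def Bx_def DD_def Dn_def Dc by simp
  have k1: "Z \<oplus>\<^bsub>M\<^esub> Br = Z0 \<oplus>\<^bsub>M\<^esub> Z' \<oplus>\<^bsub>M\<^esub> Dn" using K unfolding KP KN Z_def Br_def Z0_def Z'_def Dn_def .
  have k2: "A = Br \<oplus>\<^bsub>M\<^esub> A'" using P unfolding A_def Br_def A'_def by simp
  have "hc (y # x # v) m = (Z \<oplus>\<^bsub>M\<^esub> Br) \<oplus>\<^bsub>M\<^esub> (A' \<oplus>\<^bsub>M\<^esub> Bx \<oplus>\<^bsub>M\<^esub> By \<oplus>\<^bsub>M\<^esub> DD)"
    unfolding L1 k2 using cs by (simp add: M.M.a_ac)
  also have "\<dots> = Z0 \<oplus>\<^bsub>M\<^esub> (A' \<oplus>\<^bsub>M\<^esub> By \<oplus>\<^bsub>M\<^esub> (Z' \<oplus>\<^bsub>M\<^esub> (Bx \<oplus>\<^bsub>M\<^esub> (DD \<oplus>\<^bsub>M\<^esub> Dn))))"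
    unfolding k1 using cs by (simp add: M.M.a_ac)
  finally show ?thesis unfolding R1 Z0_def .
qed

text \<open>For letters further to the left the relation follows by induction on the length: removing the
  letter next to \<open>m\<close> replaces the word by shorter ones, and a derivation maps the relation for \<open>x\<close>
  and \<open>y\<close> to those for \<open>[x, n]\<close> and \<open>y\<close> and for \<open>x\<close> and \<open>[y, n]\<close>, by the Jacobi identity.\<close>

lemma hc_relation:
  "u \<in> Ls \<Longrightarrow> v \<in> Ls \<Longrightarrow> x \<in> C \<Longrightarrow> y \<in> C \<Longrightarrow> m \<in> carrier M \<Longrightarrow>
    hc (u @ y # x # v) m = hc (u @ lbracket L x y # v) m \<oplus>\<^bsub>M\<^esub> hc (u @ x # y # v) m"
proof (induction "length u + length v" arbitrary: u v x y m)
  case 0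
  then show ?case using hc_relation_base[of "[]" x y m] by simp
next
  case (Suc k)
  show ?case
  proof (cases u)
    case Nil
    then show ?thesis using hc_relation_base[OF Suc.prems(2-5)] by simp
  next
    case (Cons w u')
    have w: "w \<in> C" "u' \<in> Ls" and k: "k = length u' + length v" using Suc Cons by auto
    note v = Suc.prems(2) and x = Suc.prems(3) and y = Suc.prems(4) and m = Suc.prems(5)
    let ?n = "pN w"
    have n: "?n \<in> C" using w pN_C by simp
    note cl = hc_closed[OF _ m]
    have IH: "hc (u'' @ y # x # v'') m' = hc (u'' @ lbracket L x y # v'') m' \<oplus>\<^bsub>M\<^esub> hc (u'' @ x # y # v'') m'"
      if "u'' \<in> Ls" "v'' \<in> Ls" "x \<in> C" "y \<in> C" "m' \<in> carrier M" "length u'' = length u'" "length v'' = length v"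
      for u'' v'' x y m'
      by (rule Suc.hyps(1)) (use that k in auto)
    have am: "action M (pP w) m \<in> carrier M" using pP_P[OF w(1)] m M.action_closed by blast
    have d2: "W.der ?n (\<lambda>ys. hc ys m) (u' @ a # b # v)
      = W.der ?n (\<lambda>ys. hc (ys @ a # b # v) m) u' \<oplus>\<^bsub>M\<^esub> (hc (u' @ lbracket L a ?n # b # v) m
        \<oplus>\<^bsub>M\<^esub> (hc (u' @ a # lbracket L b ?n # v) m \<oplus>\<^bsub>M\<^esub> W.der ?n (\<lambda>ys. hc (u' @ a # b # ys) m) v))"
      if "a \<in> C" "b \<in> C" for a b
      using W.der_append[OF w(2) _ n, of "a # b # v" "\<lambda>ys. hc ys m"] that v cl by simp
    have d1: "W.der ?n (\<lambda>ys. hc ys m) (u' @ a # v)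
      = W.der ?n (\<lambda>ys. hc (ys @ a # v) m) u' \<oplus>\<^bsub>M\<^esub> (hc (u' @ lbracket L a ?n # v) m
        \<oplus>\<^bsub>M\<^esub> W.der ?n (\<lambda>ys. hc (u' @ a # ys) m) v)"
      if "a \<in> C" for a
      using W.der_append[OF w(2) _ n, of "a # v" "\<lambda>ys. hc ys m"] that v cl by simp
    have dcl: "W.der ?n (\<lambda>ys. hc (ys @ zs) m) u' \<in> carrier M" if "zs \<in> Ls" for zs
      by (rule W.der_closed[OF w(2) n]) (use that cl in simp)
    have dcl': "W.der ?n (\<lambda>ys. hc (u' @ zs @ ys) m) v \<in> carrier M" if "zs \<in> Ls" for zs
      by (rule W.der_closed[OF v n]) (use that cl w in simp)
    have bxy: "lbracket L x y \<in> C" "lbracket L x ?n \<in> C" "lbracket L y ?n \<in> C"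
      "lbracket L x (lbracket L y ?n) \<in> C" "lbracket L (lbracket L x ?n) y \<in> C"
      "lbracket L (lbracket L x y) ?n \<in> C"
      using x y n L.bracket_closed by auto
    have "W.der ?n (\<lambda>ys. hc (ys @ y # x # v) m) u'
      = W.der ?n (\<lambda>ys. hc (ys @ lbracket L x y # v) m \<oplus>\<^bsub>M\<^esub> hc (ys @ x # y # v) m) u'"
      by (rule W.der_cong[OF w(2) n]) (simp add: IH[OF _ v x y m _ refl])
    also have "\<dots> = W.der ?n (\<lambda>ys. hc (ys @ lbracket L x y # v) m) u' \<oplus>\<^bsub>M\<^esub> W.der ?n (\<lambda>ys. hc (ys @ x # y # v) m) u'"
      by (rule W.der_add[OF w(2) n]) (use cl v x y bxy in simp_all)
    finally have t1: "W.der ?n (\<lambda>ys. hc (ys @ y # x # v) m) u'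
      = W.der ?n (\<lambda>ys. hc (ys @ lbracket L x y # v) m) u' \<oplus>\<^bsub>M\<^esub> W.der ?n (\<lambda>ys. hc (ys @ x # y # v) m) u'" .
    have "W.der ?n (\<lambda>ys. hc (u' @ y # x # ys) m) v
      = W.der ?n (\<lambda>ys. hc (u' @ lbracket L x y # ys) m \<oplus>\<^bsub>M\<^esub> hc (u' @ x # y # ys) m) v"
      by (rule W.der_cong[OF v n]) (simp add: IH[OF w(2) _ x y m refl])
    also have "\<dots> = W.der ?n (\<lambda>ys. hc (u' @ lbracket L x y # ys) m) v \<oplus>\<^bsub>M\<^esub> W.der ?n (\<lambda>ys. hc (u' @ x # y # ys) m) v"
      by (rule W.der_add[OF v n]) (use cl w x y bxy in simp_all)
    finally have t2: "W.der ?n (\<lambda>ys. hc (u' @ y # x # ys) m) v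
      = W.der ?n (\<lambda>ys. hc (u' @ lbracket L x y # ys) m) v \<oplus>\<^bsub>M\<^esub> W.der ?n (\<lambda>ys. hc (u' @ x # y # ys) m) v" .
    have t3: "hc (u' @ lbracket L y ?n # x # v) m
      = hc (u' @ lbracket L x (lbracket L y ?n) # v) m \<oplus>\<^bsub>M\<^esub> hc (u' @ x # lbracket L y ?n # v) m"
      by (rule IH[OF w(2) v x bxy(3) m refl refl])
    have t4: "hc (u' @ y # lbracket L x ?n # v) m
      = hc (u' @ lbracket L (lbracket L x ?n) y # v) m \<oplus>\<^bsub>M\<^esub> hc (u' @ lbracket L x ?n # y # v) m"
      by (rule IH[OF w(2) v bxy(2) y m refl refl])
    have t5: "hc (u' @ lbracket L (lbracket L x y) ?n # v) m
      = hc (u' @ lbracket L (lbracket L x ?n) y # v) m \<oplus>\<^bsub>M\<^esub> hc (u' @ lbracket L x (lbracket L y ?n) # v) m"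
      unfolding W.jacobi_right[OF x y n] by (rule hc_slot_add[OF m w(2) v bxy(5,4)])
    have t6: "hc (u' @ y # x # v) (action M (pP w) m)
      = hc (u' @ lbracket L x y # v) (action M (pP w) m) \<oplus>\<^bsub>M\<^esub> hc (u' @ x # y # v) (action M (pP w) m)"
      by (rule IH[OF w(2) v x y am refl refl])
    have fin: "W.der ?n (\<lambda>ys. hc ys m) (u' @ y # x # v)
      = W.der ?n (\<lambda>ys. hc ys m) (u' @ lbracket L x y # v) \<oplus>\<^bsub>M\<^esub> W.der ?n (\<lambda>ys. hc ys m) (u' @ x # y # v)"
      unfolding d2[OF y x] d2[OF x y] d1[OF bxy(1)] t1 t2 t3 t4 t5
      using w v x y bxy dcl dcl'[of "[lbracket L x y]"] dcl'[of "[x, y]"] cl by (simp add: M.M.a_ac)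
    have cc: "W.der ?n (\<lambda>ys. hc ys m) zs \<in> carrier M" if "zs \<in> Ls" for zs
      by (rule W.der_closed_ml[OF hc_ml[OF m] n that refl])
    show ?thesis
      using w v x y bxy hc_closed[OF _ am] cc by (simp add: Cons hc_Cons t6 fin M.M.a_ac)
  qed
qed

end

section \<open>The projection of an extended module onto its top\<close>

context split_extension
begin

fun word_value :: "('l uea, 'v) elt \<Rightarrow> 'l word \<Rightarrow> ('l uea, 'v) elt" where
  "word_value m (Word xs) = hc (rev xs) m"

lemma rev_Ls: "xs \<in> Ls \<Longrightarrow> rev xs \<in> Ls"
  by (simp add: in_lists_conv_set)

lemma word_value_closed: "m \<in> carrier M \<Longrightarrow> word_value m \<in> words C \<rightarrow> carrier M"
  using hc_closed rev_Ls by auto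

lemma word_value_respects:
  assumes m: "m \<in> carrier M"
  shows "respects_relations L M (word_value m)"
  unfolding respects_relations_def
proof (intro conjI ballI allI)
  show "word_value m w \<in> carrier M" if "w \<in> words C" for w
    using word_value_closed[OF m] that by blast
  fix u v x y a assume "u \<in> Ls" "v \<in> Ls" and x: "x \<in> C" and y: "y \<in> C"
  then have uv: "rev u \<in> Ls" "rev v \<in> Ls" by (simp_all add: rev_Ls)
  show "word_value m (Word (u @ (x + y) # v)) = word_value m (Word (u @ x # v)) \<oplus>\<^bsub>M\<^esub> word_value m (Word (u @ y # v))"
    using hc_slot_add[OF m uv(2,1) x y] by simp
  show "word_value m (Word (u @ lscale L a x # v)) = a \<odot>\<^bsub>M\<^esub> word_value m (Word (u @ x # v))"
    using hc_slot_scale[OF m uv(2,1) x] by simp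
  show "word_value m (Word (u @ x # y # v))
    = word_value m (Word (u @ lbracket L x y # v)) \<oplus>\<^bsub>M\<^esub> word_value m (Word (u @ y # x # v))"
    using hc_relation[OF uv(2,1) x y m] by simp
qed

definition tensor_value :: "'l uea \<Rightarrow> ('l uea, 'v) elt \<Rightarrow> ('l uea, 'v) elt" where
  "tensor_value u m = lin_ext M (word_value m) (SOME p. p \<in> u)"

lemma keys_FL: "p \<in> FL \<Longrightarrow> Poly_Mapping.keys p \<subseteq> words C"
  by (simp add: carrier_free_algebra)

lemma tensor_value_class: "p \<in> FL \<Longrightarrow> m \<in> carrier M \<Longrightarrow> tensor_value (cl p) m = lin_ext M (word_value m) p"
  unfolding tensor_value_def
  by (rule lin_ext_uea_class_eq[OF L.lie_algebra_axioms M.lie_module_axioms word_value_respects])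
    (simp_all add: L.uea_class_some)

lemma tensor_value_closed: "p \<in> FL \<Longrightarrow> m \<in> carrier M \<Longrightarrow> tensor_value (cl p) m \<in> carrier M"
  unfolding tensor_value_class by (rule M.lin_ext_closed[OF keys_FL word_value_closed])

lemma tensor_value_add: "p \<in> FL \<Longrightarrow> q \<in> FL \<Longrightarrow> m \<in> carrier M \<Longrightarrow>
    tensor_value (cl p \<oplus>\<^bsub>uea L\<^esub> cl q) m = tensor_value (cl p) m \<oplus>\<^bsub>M\<^esub> tensor_value (cl q) m"
  by (simp add: L.uea_class_simps(1) tensor_value_class free_algebra_closed(4)
      M.lin_ext_add[OF keys_FL keys_FL word_value_closed])

lemma word_value_Cons:
  assumes "p \<in> FL" "m \<in> carrier M" "x \<in> C"
  shows "tensor_value (cl (gen x * p)) m = lin_ext M (\<lambda>w. word_value m (Word [x] + w)) p"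
proof -
  have g: "gen x \<in> FL" by (rule free_algebra_closed(8)[OF assms(3)])
  have "(\<lambda>w. word_value m (Word [x] + w)) \<in> words C \<rightarrow> carrier M"
  proof
    fix w assume "w \<in> words C"
    then obtain xs where w: "w = Word xs" "xs \<in> Ls" by blast
    have "rev xs @ [x] \<in> Ls" using rev_Ls[OF w(2)] assms(3) by simp
    from hc_closed[OF this assms(2)] show "word_value m (Word [x] + w) \<in> carrier M" by (simp add: w)
  qed
  from M.lin_ext_closed[OF keys_FL[OF assms(1)] this]
  show ?thesis
    using assms g unfolding tensor_value_class[OF free_algebra_closed(5)[OF g assms(1)] assms(2)]
    by (simp add: M.lin_ext_mult[OF keys_FL keys_FL word_value_closed])
      (simp add: gen_def M.lin_ext_single M.msimps)
qed

lemma scalar_value: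
  assumes "p \<in> FL" "m \<in> carrier M"
  shows "tensor_value (cl (scalar a * p)) m = a \<odot>\<^bsub>M\<^esub> tensor_value (cl p) m"
proof -
  have g: "scalar a \<in> FL" by (rule free_algebra_closed(3))
  show ?thesis
    using assms g M.lin_ext_closed[OF keys_FL[OF assms(1)] word_value_closed[OF assms(2)]]
    unfolding tensor_value_class[OF free_algebra_closed(5)[OF g assms(1)] assms(2)]
    by (simp add: M.lin_ext_mult[OF keys_FL keys_FL word_value_closed] tensor_value_class)
      (simp add: scalar_def M.lin_ext_single M.msimps)
qed

lemma tensor_value_add_right:
  assumes "p \<in> FL" "m \<in> carrier M" "n \<in> carrier M"
  shows "tensor_value (cl p) (m \<oplus>\<^bsub>M\<^esub> n) = tensor_value (cl p) m \<oplus>\<^bsub>M\<^esub> tensor_value (cl p) n"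
proof -
  note k = keys_FL[OF assms(1)]
  have s: "word_value (m \<oplus>\<^bsub>M\<^esub> n) w = word_value m w \<oplus>\<^bsub>M\<^esub> word_value n w"
      "word_value m w \<in> carrier M" "word_value n w \<in> carrier M" if wC: "w \<in> words C" for w
  proof -
    obtain xs where w: "w = Word xs" "xs \<in> Ls" using wC by blast
    show "word_value (m \<oplus>\<^bsub>M\<^esub> n) w = word_value m w \<oplus>\<^bsub>M\<^esub> word_value n w"
      "word_value m w \<in> carrier M" "word_value n w \<in> carrier M"
      using hc_add[OF rev_Ls[OF w(2)] assms(2,3)] hc_closed[OF rev_Ls[OF w(2)]] assms(2,3) by (simp_all add: w)
  qed
  have "lin_ext M (word_value (m \<oplus>\<^bsub>M\<^esub> n)) p = finsum M (\<lambda>w. Poly_Mapping.lookup p w \<odot>\<^bsub>M\<^esub> word_value m w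
      \<oplus>\<^bsub>M\<^esub> Poly_Mapping.lookup p w \<odot>\<^bsub>M\<^esub> word_value n w) (Poly_Mapping.keys p)"
    unfolding lin_ext_def by (rule M.M.finsum_cong') (use subsetD[OF k] s in \<open>simp_all add: M.msimps\<close>)
  also have "\<dots> = lin_ext M (word_value m) p \<oplus>\<^bsub>M\<^esub> lin_ext M (word_value n) p"
    unfolding lin_ext_def by (rule M.M.finsum_addf) (use subsetD[OF k] s in simp_all)
  finally show ?thesis using assms by (simp add: tensor_value_class)
qed

text \<open>A letter in \<open>P\<close> next to \<open>m\<close> has no part in \<open>N\<close>, so it acts on \<open>m\<close> and leaves the other letters alone.
  This makes the value of a tensor balanced over the enveloping algebra of \<open>P\<close>.\<close>

lemma hc_P_word: "ys \<in> lists (carrier P) \<Longrightarrow> xs \<in> Ls \<Longrightarrow> m \<in> carrier M \<Longrightarrow>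
    hc (rev ys @ xs) m = hc xs (foldr (action M) ys m)"
proof (induction ys arbitrary: m rule: rev_induct)
  case (snoc y ys)
  then have y: "y \<in> carrier P" "y \<in> C" "ys \<in> lists (carrier P)" "rev ys @ xs \<in> Ls"
    using subsetD[OF P_sub] subsetD[OF lists_mono[OF P_sub]] by (simp_all add: rev_Ls)
  have "hc (y # rev ys @ xs) m = hc (rev ys @ xs) (action M y m)"
    using y snoc.prems M.action_closed
    by (simp add: hc_Cons pN_on_P pP_def W.der_zero[OF _ hc_ml] hc_closed)
  then show ?case using snoc.IH[OF y(3) snoc.prems(2), of "action M y m"] y snoc.prems M.action_closed by simp
qed simp

lemma tensor_value_balanced:
  assumes "p \<in> FL" "q \<in> carrier (free_algebra (carrier P))" "m \<in> carrier M"
  shows "tensor_value (cl p \<otimes>\<^bsub>uea L\<^esub> cl q) m = tensor_value (cl p) (uea_action M (uea_class P q) m)"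
proof -
  have q: "q \<in> FL" using assms FP_sub by blast
  have kq: "Poly_Mapping.keys q \<subseteq> words (carrier P)" using assms by (simp add: carrier_free_algebra)
  have wc: "(\<lambda>w. word_action M w m) \<in> words (carrier P) \<rightarrow> carrier M"
  proof
    fix w assume "w \<in> words (carrier P)"
    then obtain xs where w: "w = Word xs" "xs \<in> lists (carrier P)" by blast
    show "word_action M w m \<in> carrier M" using M.foldr_action_closed[OF w(2) assms(3)] by (simp add: w)
  qed
  have c: "lin_ext M (\<lambda>w. word_action M w m) q \<in> carrier M" by (rule M.lin_ext_closed[OF kq wc])
  have inner: "lin_ext M (\<lambda>w. word_value m (v + w)) q = word_value (lin_ext M (\<lambda>w. word_action M w m) q) v"
    if v: "v \<in> words C" for v
  proof -
    obtain xs where xs: "v = Word xs" "rev xs \<in> Ls" using v rev_Ls by blast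
    have "lin_ext M (\<lambda>w. word_value m (v + w)) q = lin_ext M (\<lambda>w. hc (rev xs) (word_action M w m)) q"
    proof (rule M.lin_ext_cong[OF kq])
      fix w assume "w \<in> words (carrier P)"
      then obtain ys where ys: "w = Word ys" "ys \<in> lists (carrier P)" by blast
      show "word_value m (v + w) = hc (rev xs) (word_action M w m)"
        using hc_P_word[OF ys(2) xs(2) assms(3)] by (simp add: xs ys)
      show "hc (rev xs) (word_action M w m) \<in> carrier M"
        using hc_closed[OF xs(2)] M.foldr_action_closed[OF ys(2) assms(3)] by (simp add: ys)
    qed
    also have "\<dots> = hc (rev xs) (lin_ext M (\<lambda>w. word_action M w m) q)"
      by (rule lin_ext_hom[OF M.lie_module_axioms M.lie_module_axioms kq, symmetric])
        (use wc hc_closed[OF xs(2)] hc_add[OF xs(2)] hc_smult[OF xs(2)] in \<open>auto simp del: word_action.simps\<close>)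
    finally show ?thesis by (simp add: xs)
  qed
  have "tensor_value (cl p \<otimes>\<^bsub>uea L\<^esub> cl q) m = lin_ext M (word_value m) (p * q)"
    using assms q by (simp add: L.uea_class_simps(2) tensor_value_class free_algebra_closed(5))
  also have "\<dots> = lin_ext M (\<lambda>v. lin_ext M (\<lambda>w. word_value m (v + w)) q) p"
    by (rule M.lin_ext_mult[OF keys_FL[OF assms(1)] keys_FL[OF q] word_value_closed[OF assms(3)]])
  also have "\<dots> = lin_ext M (word_value (lin_ext M (\<lambda>w. word_action M w m) q)) p"
    by (rule M.lin_ext_cong[OF keys_FL[OF assms(1)]]) (use inner word_value_closed[OF c] in blast)+
  also have "\<dots> = tensor_value (cl p) (uea_action M (uea_class P q) m)"
    unfolding M.uea_action_class[OF assms(2,3)] tensor_value_class[OF assms(1) c] ..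
  finally show ?thesis .
qed

text \<open>The sum over a multiset is taken in a group with a carrier. Off the carrier the step does
  nothing, so that it commutes with itself everywhere and can be folded.\<close>

definition value_step :: "'l uea \<times> ('l uea, 'v) elt \<Rightarrow> ('l uea, 'v) elt \<Rightarrow> ('l uea, 'v) elt" where
  "value_step z t = (if z \<in> carrier (uea L) \<times> carrier M \<and> t \<in> carrier M
     then tensor_value (fst z) (snd z) \<oplus>\<^bsub>M\<^esub> t else t)"

definition sum_value :: "('l uea \<times> ('l uea, 'v) elt) multiset \<Rightarrow> ('l uea, 'v) elt" where
  "sum_value F = fold_mset value_step \<zero>\<^bsub>M\<^esub> F"

lemma tensor_value_carrier: "u \<in> carrier (uea L) \<Longrightarrow> m \<in> carrier M \<Longrightarrow> tensor_value u m \<in> carrier M"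
  unfolding L.carrier_uea using tensor_value_closed by blast

lemma value_step_commute: "comp_fun_commute value_step"
proof (rule comp_fun_commute.intro, rule ext)
  fix y z t
  show "(value_step y \<circ> value_step z) t = (value_step z \<circ> value_step y) t"
    using tensor_value_carrier by (auto simp: value_step_def M.M.a_lcomm)
qed

lemma sum_value_empty [simp]: "sum_value {#} = \<zero>\<^bsub>M\<^esub>"
  by (simp add: sum_value_def)

lemma sum_value_closed: "sum_value F \<in> carrier M"
proof (induction F)
  case (add z F)
  then show ?case using tensor_value_carrier
    unfolding sum_value_def comp_fun_commute.fold_mset_add_mset[OF value_step_commute]
    by (auto simp: value_step_def)
qed simp

lemma sum_value_add_mset: "u \<in> carrier (uea L) \<Longrightarrow> m \<in> carrier M \<Longrightarrow>
    sum_value (add_mset (u, m) F) = tensor_value u m \<oplus>\<^bsub>M\<^esub> sum_value F"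
  using sum_value_closed[of F]
  unfolding sum_value_def comp_fun_commute.fold_mset_add_mset[OF value_step_commute]
  by (simp add: value_step_def)

lemma sum_value_single: "u \<in> carrier (uea L) \<Longrightarrow> m \<in> carrier M \<Longrightarrow> sum_value {#(u, m)#} = tensor_value u m"
  by (simp add: sum_value_add_mset tensor_value_carrier)

lemma sum_value_add: "valid F \<Longrightarrow> sum_value (F + G) = sum_value F \<oplus>\<^bsub>M\<^esub> sum_value G"
proof (induction F)
  case empty
  then show ?case by (simp add: sum_value_closed)
next
  case (add z F)
  obtain u m where z: "z = (u, m)" by force
  then show ?case using add sum_value_closed tensor_value_carrier
    by (simp add: sum_value_add_mset M.M.a_assoc)
qed

lemma sum_value_teq: "F \<approx> G \<Longrightarrow> sum_value F = sum_value G"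
proof (induction rule: teq_induct)
  case (cong F F' G G')
  then show ?case using teq_valid by (simp add: sum_value_add)
next
  case (zero m)
  have "tensor_value (cl 0) m = \<zero>\<^bsub>M\<^esub>" using zero by (simp add: tensor_value_class free_algebra_closed(1))
  then show ?case using zero by (simp add: sum_value_single L.uea_class_zero[symmetric])
next
  case (add_left u v m)
  then obtain p q where "p \<in> FL" "q \<in> FL" "u = cl p" "v = cl q" unfolding L.carrier_uea by blast
  then show ?case using add_left tensor_value_add
    by (simp add: sum_value_single sum_value_add_mset tensor_value_carrier M.M.a_comm)
next
  case (add_right u m n)
  then obtain p where "p \<in> FL" "u = cl p" unfolding L.carrier_uea by blast
  then show ?case using add_right tensor_value_add_right
    by (simp add: sum_value_single sum_value_add_mset tensor_value_carrier M.M.a_comm)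
next
  case (balanced u q m)
  then obtain p where p: "p \<in> FL" "u = cl p" unfolding L.carrier_uea by blast
  have "cl q \<in> carrier (uea L)" using balanced FP_sub cl_closed by blast
  then show ?case using balanced p tensor_value_balanced
    by (simp add: sum_value_single M.uea_action_closed M.uea_class_simps(3)[OF balanced(2,2)])
qed simp_all

text \<open>The projection that splits \<open>m \<mapsto> 1 \<otimes> m\<close>. Its existence shows that \<open>M\<close> embeds into the extended
  module.\<close>

definition top_proj :: "('l uea, 'v) elt \<Rightarrow> ('l uea, 'v) elt" where
  "top_proj s = sum_value (terms s)"

lemma top_proj_cls: "valid F \<Longrightarrow> top_proj (cls F) = sum_value F"
  unfolding top_proj_def using sum_value_teq[OF terms_cls(1)] by simp

lemma top_proj_closed: "top_proj s \<in> carrier M"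
  by (simp add: top_proj_def sum_value_closed)

lemma top_proj_embed: "m \<in> carrier M \<Longrightarrow> top_proj (embed m) = m"
proof -
  assume m: "m \<in> carrier M"
  have "tensor_value (cl 1) m = m"
    using m
    by (simp add: tensor_value_class free_algebra_closed(2)) (simp add: single_one[symmetric] M.lin_ext_single M.msimps zero_word_def del: single_one)
  then show ?thesis using m
    by (simp add: embed_def top_proj_cls sum_value_single L.uea_class_one[symmetric])
qed

lemma top_proj_add: "s \<in> carrier E \<Longrightarrow> t \<in> carrier E \<Longrightarrow> top_proj (s \<oplus>\<^bsub>E\<^esub> t) = top_proj s \<oplus>\<^bsub>M\<^esub> top_proj t"
  by (elim E_cases) (simp add: E_simps top_proj_cls sum_value_add)

lemma top_proj_smult:
  assumes "s \<in> carrier E"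
  shows "top_proj (a \<odot>\<^bsub>E\<^esub> s) = a \<odot>\<^bsub>M\<^esub> top_proj s"
proof -
  obtain F where F: "s = cls F" "valid F" using assms by (metis E_cases)
  have "valid F \<Longrightarrow> sum_value (left_mult L (scalar a) F) = a \<odot>\<^bsub>M\<^esub> sum_value F" for F
  proof (induction F)
    case (add z F)
    obtain u m where z: "z = (u, m)" by force
    then have um: "u \<in> carrier (uea L)" "m \<in> carrier M" "valid F" using add.prems by auto
    then obtain p where p: "p \<in> FL" "u = cl p" unfolding L.carrier_uea by blast
    have g: "scalar a \<in> FL" by (rule free_algebra_closed(3))
    have "tensor_value (cl (scalar a) \<otimes>\<^bsub>uea L\<^esub> u) m = a \<odot>\<^bsub>M\<^esub> tensor_value u m"
      using scalar_value[OF p(1) um(2)] p g by (simp add: L.uea_class_simps(2))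
    then show ?case using um z add.IH[OF um(3)] cl_closed[OF g] sum_value_closed tensor_value_carrier
      by (simp add: sum_value_add_mset M.msimps)
  qed (simp add: M.msimps)
  then show ?thesis using F left_mult_valid[OF F(2) free_algebra_closed(3)]
    by (simp add: E_simps top_proj_cls)
qed

text \<open>The last element of the reversed word is the leftmost letter. It lies in \<open>N\<close>, stays in \<open>N\<close> under the
  brackets with other elements of \<open>N\<close> that pass it, and is discarded in the end.\<close>

lemma hc_last_N: "xs \<in> Ls \<Longrightarrow> n \<in> N \<Longrightarrow> m \<in> carrier M \<Longrightarrow> hc (xs @ [n]) m = \<zero>\<^bsub>M\<^esub>"
proof (induction "length xs" arbitrary: xs n m)
  case 0
  then show ?case using N_sub by (auto simp: hc_Cons pP_def pN_on_N)
next
  case (Suc k)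
  then obtain x ys where x: "xs = x # ys" "x \<in> C" "ys \<in> Ls" "length ys = k" by (cases xs) auto
  have n: "n \<in> C" "[n] \<in> Ls" using Suc.prems N_sub by auto
  have IH: "hc (ys' @ [n']) m' = \<zero>\<^bsub>M\<^esub>"
    if "ys' \<in> Ls" "length ys' = length ys" "n' \<in> N" "m' \<in> carrier M" for ys' n' m'
    using Suc.hyps(1)[of ys' n' m'] that x by simp
  note px = pN_C[OF x(2)]
  have z: "W.der a (\<lambda>_. \<zero>\<^bsub>M\<^esub>) zs = \<zero>\<^bsub>M\<^esub>" for a zs
    by (induction zs) simp_all
  have "W.der (pN x) (\<lambda>ys. hc (ys @ [n]) m) ys = W.der (pN x) (\<lambda>_. \<zero>\<^bsub>M\<^esub>) ys"
    by (rule W.der_cong[OF x(3) px]) (use IH Suc.prems in simp)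
  then have 1: "W.der (pN x) (\<lambda>ys. hc (ys @ [n]) m) ys = \<zero>\<^bsub>M\<^esub>" by (simp only: z)
  have 2: "hc (ys @ [lbracket L n (pN x)]) m = \<zero>\<^bsub>M\<^esub>"
    by (rule IH) (use x Suc.prems N_bracket pN_N in auto)
  have "W.der (pN x) (\<lambda>ys. hc ys m) (ys @ [n]) = \<zero>\<^bsub>M\<^esub>"
    using W.der_append[OF x(3) n(2) px, of "\<lambda>ys. hc ys m"] 1 2 hc_closed Suc.prems(3) by simp
  moreover have "hc (ys @ [n]) (action M (pP x) m) = \<zero>\<^bsub>M\<^esub>"
    by (rule IH) (use x Suc.prems pP_P M.action_closed in auto)
  ultimately show ?case using x n by (simp add: hc_Cons)
qed

lemma top_proj_N:
  assumes n: "n \<in> N" and s: "s \<in> carrier E"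
  shows "top_proj (action E n s) = \<zero>\<^bsub>M\<^esub>"
proof -
  obtain F where F: "s = cls F" "valid F" using s by (metis E_cases)
  have nC: "n \<in> C" using n N_sub by blast
  have g: "gen n \<in> FL" by (rule free_algebra_closed(8)[OF nC])
  have "valid F \<Longrightarrow> sum_value (left_mult L (gen n) F) = \<zero>\<^bsub>M\<^esub>" for F
  proof (induction F)
    case (add z F)
    obtain u m where z: "z = (u, m)" by force
    then have um: "u \<in> carrier (uea L)" "m \<in> carrier M" "valid F" using add.prems by auto
    then obtain p where p: "p \<in> FL" "u = cl p" unfolding L.carrier_uea by blast
    have "tensor_value (cl (gen n * p)) m = \<zero>\<^bsub>M\<^esub>"
      unfolding word_value_Cons[OF p(1) um(2) nC]
    proof (rule M.lin_ext_fun_zero[OF keys_FL[OF p(1)]])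
      fix w assume "w \<in> words C"
      then obtain xs where w: "w = Word xs" "xs \<in> Ls" by blast
      show "word_value m (Word [n] + w) = \<zero>\<^bsub>M\<^esub>" using hc_last_N[OF rev_Ls[OF w(2)] n um(2)] by (simp add: w)
    qed
    then have "tensor_value (cl (gen n) \<otimes>\<^bsub>uea L\<^esub> u) m = \<zero>\<^bsub>M\<^esub>"
      using p g by (simp add: L.uea_class_simps(2))
    then show ?case using um z add.IH[OF um(3)] cl_closed[OF g] by (simp add: sum_value_add_mset)
  qed simp
  then show ?thesis using F left_mult_valid[OF F(2) g] nC by (simp add: E_simps top_proj_cls)
qed

end

section \<open>Graded extensions inherit an irreducible top component\<close>

text \<open>The element \<open>d\<close> acts by zero on \<open>M\<close> and grades the complement \<open>N\<close> by negative integers; \<open>Nh e\<close>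
  consists of elements of degree \<open>-(e + 1)\<close>, so that degree zero does not occur.\<close>

locale graded_extension = split_extension L P M N pN
  for L P :: "'l::ab_group_add lie_alg" and M :: "('l, ('l uea, 'v) elt) lie_rep" and N pN +
  fixes d :: 'l and Nh :: "nat \<Rightarrow> 'l set"
  assumes d_P: "d \<in> carrier P"
    and d_M: "m \<in> carrier M \<Longrightarrow> action M d m = \<zero>\<^bsub>M\<^esub>"
    and Nh_N: "n \<in> Nh e \<Longrightarrow> n \<in> N"
    and Nh_d: "n \<in> Nh e \<Longrightarrow> lbracket L d n = lscale L (- of_nat (Suc e)) n"
    and N_span: "\<lbrakk>0 \<in> Q; \<And>x y. x \<in> Q \<Longrightarrow> y \<in> Q \<Longrightarrow> x + y \<in> Q; \<And>e. Nh e \<subseteq> Q\<rbrakk> \<Longrightarrow> N \<subseteq> Q"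
begin

lemma d_C: "d \<in> C" using d_P P_sub by blast
lemma Nh_C: "n \<in> Nh e \<Longrightarrow> n \<in> C" using Nh_N N_sub by blast

text \<open>What the complement generates from \<open>1 \<otimes> M\<close>. It is everything, because elements of \<open>P\<close> can be moved
  past those of \<open>N\<close> at the cost of brackets, which again split into parts in \<open>P\<close> and in \<open>N\<close>.\<close>

inductive_set negative_span :: "('l uea, 'v) elt set" where
  embed: "m \<in> carrier M \<Longrightarrow> embed m \<in> negative_span"
| add: "s \<in> negative_span \<Longrightarrow> t \<in> negative_span \<Longrightarrow> s \<oplus>\<^bsub>E\<^esub> t \<in> negative_span"
| smult: "s \<in> negative_span \<Longrightarrow> a \<odot>\<^bsub>E\<^esub> s \<in> negative_span"
| act: "n \<in> Nh e \<Longrightarrow> s \<in> negative_span \<Longrightarrow> action E n s \<in> negative_span"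

lemma negative_span_E: "s \<in> negative_span \<Longrightarrow> s \<in> carrier E"
proof (induction rule: negative_span.induct)
  case (embed m)
  then show ?case by (rule embed_closed)
next
  case (act n e s)
  then show ?case using E.action_closed[OF Nh_C] by blast
qed simp_all

lemma negative_span_zero: "\<zero>\<^bsub>E\<^esub> \<in> negative_span"
proof -
  have e: "embed \<zero>\<^bsub>M\<^esub> \<in> negative_span" by (rule negative_span.embed) simp
  from negative_span.smult[OF e, of 0] negative_span_E[OF e] show ?thesis by (simp add: E.msimps)
qed

lemma negative_span_N:
  assumes "n \<in> N" "s \<in> negative_span"
  shows "action E n s \<in> negative_span"
proof -
  let ?Q = "{n \<in> C. \<forall>s\<in>negative_span. action E n s \<in> negative_span}"
  have "N \<subseteq> ?Q"
  proof (rule N_span)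
    show "0 \<in> ?Q" using L.carrier_zero negative_span_E negative_span_zero by simp
    show "x + y \<in> ?Q" if "x \<in> ?Q" "y \<in> ?Q" for x y
      using that L.carrier_add negative_span_E by (simp add: E.add_action negative_span.add)
    show "Nh e \<subseteq> ?Q" for e using Nh_C negative_span.act by blast
  qed
  then show ?thesis using assms by blast
qed

lemma negative_span_P: "s \<in> negative_span \<Longrightarrow> y \<in> carrier P \<Longrightarrow> action E y s \<in> negative_span"
proof (induction arbitrary: y rule: negative_span.induct)
  case (embed m)
  from negative_span.embed[OF M.action_closed[OF embed.prems embed.hyps]]
  show ?case by (simp add: embed_action[OF embed.prems embed.hyps])
next
  case (add s t)
  then show ?case using P_sub negative_span_E by (simp add: E.action_add subset_iff negative_span.add)
next
  case (smult s a)
  then show ?case using P_sub negative_span_E by (simp add: E.action_smult subset_iff negative_span.smult)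
next
  case (act n e s)
  have c: "y \<in> C" "n \<in> C" "s \<in> carrier E" using act P_sub Nh_C negative_span_E by blast+
  let ?z = "lbracket L y n"
  have z: "?z \<in> C" using c L.bracket_closed by simp
  have "action E (pP ?z + pN ?z) s = action E (pP ?z) s \<oplus>\<^bsub>E\<^esub> action E (pN ?z) s"
    by (rule E.add_action[OF pP_C[OF z] pN_C[OF z] c(3)])
  then have "action E ?z s \<in> negative_span"
    using act.IH[OF pP_P[OF z]] negative_span_N[OF pN_N[OF z] act.hyps(2)]
    by (simp add: pN_pP[symmetric] negative_span.add)
  then show ?case
    unfolding E.bracket_action'[OF c, symmetric]
    using negative_span.act[OF act.hyps(1) act.IH[OF act.prems]] by (rule negative_span.add)
qed

lemma negative_span_eq: "negative_span = carrier E"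
proof (rule embed_generates)
  show "stable_subspace E C negative_span"
  proof (rule stable_subspaceI)
    fix x s assume x: "x \<in> C" and s: "s \<in> negative_span"
    have "action E (pP x + pN x) s = action E (pP x) s \<oplus>\<^bsub>E\<^esub> action E (pN x) s"
      by (rule E.add_action[OF pP_C[OF x] pN_C[OF x] negative_span_E[OF s]])
    then show "action E x s \<in> negative_span"
      using negative_span_P[OF s pP_P[OF x]] negative_span_N[OF pN_N[OF x] s]
      by (simp add: pN_pP[symmetric] negative_span.add)
  qed (auto intro: negative_span.intros negative_span_zero negative_span_E)
qed (auto intro: negative_span.embed)

lemma embed_zero: "embed \<zero>\<^bsub>M\<^esub> = \<zero>\<^bsub>E\<^esub>"
  using embed_smult[of "\<zero>\<^bsub>M\<^esub>" 0] embed_closed[of "\<zero>\<^bsub>M\<^esub>"] by (simp add: M.msimps E.msimps)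

text \<open>The elements of degree at least \<open>-r\<close>, described by the operator \<open>d\<close> alone: they are those that
  \<open>d + r\<close>, \<dots>, \<open>d + 1\<close>, applied in this order, bring into \<open>1 \<otimes> M\<close>. In this form
  the sets are visibly increasing in \<open>r\<close> and stable under \<open>d\<close>.\<close>

primrec depth_le :: "nat \<Rightarrow> ('l uea, 'v) elt set" where
  "depth_le 0 = embed ` carrier M"
| "depth_le (Suc r) = {s \<in> carrier E. action E d s \<oplus>\<^bsub>E\<^esub> of_nat (Suc r) \<odot>\<^bsub>E\<^esub> s \<in> depth_le r}"

lemma depth_le_stable: "stable_subspace E {d} (depth_le r)"
proof (induction r)
  case 0
  show ?case
  proof (rule stable_subspaceI)
    show "\<zero>\<^bsub>E\<^esub> \<in> depth_le 0" using embed_zero by force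
    show "m \<oplus>\<^bsub>E\<^esub> n \<in> depth_le 0" if "m \<in> depth_le 0" "n \<in> depth_le 0" for m n
      using that by (auto simp: embed_add[symmetric])
    show "a \<odot>\<^bsub>E\<^esub> m \<in> depth_le 0" if "m \<in> depth_le 0" for a m
      using that by (auto simp: embed_smult[symmetric])
    show "action E x m \<in> depth_le 0" if "x \<in> {d}" "m \<in> depth_le 0" for x m
      using that d_P by (auto simp: embed_action[symmetric] d_M)
  qed (auto intro: embed_closed)
next
  case (Suc r)
  note D = stable_subspaceD[OF Suc]
  note ac = E.action_closed[OF d_C]
  show ?case
  proof (rule stable_subspaceI)
    show "\<zero>\<^bsub>E\<^esub> \<in> depth_le (Suc r)" using D(3) d_C by (simp add: E.msimps)
  next
    fix m n assume mn: "m \<in> depth_le (Suc r)" "n \<in> depth_le (Suc r)"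
    then have c: "m \<in> carrier E" "n \<in> carrier E" by auto
    have "action E d (m \<oplus>\<^bsub>E\<^esub> n) \<oplus>\<^bsub>E\<^esub> of_nat (Suc r) \<odot>\<^bsub>E\<^esub> (m \<oplus>\<^bsub>E\<^esub> n)
      = (action E d m \<oplus>\<^bsub>E\<^esub> of_nat (Suc r) \<odot>\<^bsub>E\<^esub> m) \<oplus>\<^bsub>E\<^esub> (action E d n \<oplus>\<^bsub>E\<^esub> of_nat (Suc r) \<odot>\<^bsub>E\<^esub> n)"
      using c ac by (simp add: E.action_add d_C E.msimps(2) E.M.a_ac)
    then show "m \<oplus>\<^bsub>E\<^esub> n \<in> depth_le (Suc r)" using mn c D(4) by simp
  next
    fix a m assume m: "m \<in> depth_le (Suc r)"
    then have c: "m \<in> carrier E" by auto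
    have "action E d (a \<odot>\<^bsub>E\<^esub> m) \<oplus>\<^bsub>E\<^esub> of_nat (Suc r) \<odot>\<^bsub>E\<^esub> (a \<odot>\<^bsub>E\<^esub> m)
      = a \<odot>\<^bsub>E\<^esub> (action E d m \<oplus>\<^bsub>E\<^esub> of_nat (Suc r) \<odot>\<^bsub>E\<^esub> m)"
      using c ac by (simp add: E.action_smult d_C E.msimps(2) E.msimps(3)[symmetric] mult.commute)
    then show "a \<odot>\<^bsub>E\<^esub> m \<in> depth_le (Suc r)" using m c D(5) by simp
  next
    fix x m assume x: "x \<in> {d}" and m: "m \<in> depth_le (Suc r)"
    then have c: "m \<in> carrier E" by auto
    have "action E d (action E d m) \<oplus>\<^bsub>E\<^esub> of_nat (Suc r) \<odot>\<^bsub>E\<^esub> action E d m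
      = action E d (action E d m \<oplus>\<^bsub>E\<^esub> of_nat (Suc r) \<odot>\<^bsub>E\<^esub> m)"
      using c ac by (simp add: E.action_add E.action_smult d_C)
    then show "action E x m \<in> depth_le (Suc r)" using x m c D(6) ac by simp
  qed auto
qed

lemma depth_le_E: "s \<in> depth_le r \<Longrightarrow> s \<in> carrier E"
  by (rule stable_subspaceD(2)[OF depth_le_stable])

lemma depth_le_Suc: "s \<in> depth_le r \<Longrightarrow> s \<in> depth_le (Suc r)"
  using stable_subspaceD(4-6)[OF depth_le_stable[of r]] depth_le_E by simp

lemma depth_le_mono: "s \<in> depth_le r \<Longrightarrow> r \<le> r' \<Longrightarrow> s \<in> depth_le r'"
  using lift_Suc_mono_le[of depth_le r r'] depth_le_Suc by blast

lemma d_past_N: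
  assumes "n \<in> Nh e" "s \<in> carrier E"
  shows "action E d (action E n s) = action E n (action E d s) \<oplus>\<^bsub>E\<^esub> (- of_nat (Suc e)) \<odot>\<^bsub>E\<^esub> action E n s"
  using E.bracket_action'[OF d_C Nh_C[OF assms(1)] assms(2)] assms Nh_C[OF assms(1)] E.action_closed d_C
  unfolding Nh_d[OF assms(1)] by (simp add: E.scale_action E.M.a_comm)

text \<open>An element of degree \<open>-(e + 1)\<close> commutes with \<open>d + s\<close> up to the shift of \<open>s\<close> by \<open>e + 1\<close>.\<close>

lemma depth_le_N:
  assumes n: "n \<in> Nh e"
  shows "s \<in> depth_le r \<Longrightarrow> action E n s \<in> depth_le (r + Suc e)"
proof (induction r arbitrary: s)
  case 0
  then obtain m where m: "s = embed m" "m \<in> carrier M" by auto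
  have c: "s \<in> carrier E" "action E n s \<in> carrier E" using m embed_closed E.action_closed[OF Nh_C[OF n]] by auto
  have "action E d s = \<zero>\<^bsub>E\<^esub>" using m d_P by (simp add: embed_action[symmetric] d_M embed_zero)
  then have "action E d (action E n s) = (- of_nat (Suc e)) \<odot>\<^bsub>E\<^esub> action E n s"
    using d_past_N[OF n c(1)] c Nh_C[OF n] by simp
  then have "action E d (action E n s) \<oplus>\<^bsub>E\<^esub> of_nat (Suc e) \<odot>\<^bsub>E\<^esub> action E n s
    = (- of_nat (Suc e) + of_nat (Suc e)) \<odot>\<^bsub>E\<^esub> action E n s"
    by (simp only: E.msimps(1)[OF c(2)])
  then have "action E d (action E n s) \<oplus>\<^bsub>E\<^esub> of_nat (Suc e) \<odot>\<^bsub>E\<^esub> action E n s = \<zero>\<^bsub>E\<^esub>"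
    using c by (simp add: E.msimps(5))
  then have "action E n s \<in> depth_le (Suc e)"
    using c stable_subspaceD(3)[OF depth_le_stable] by simp
  then show ?case by simp
next
  case (Suc r)
  then have s: "s \<in> carrier E" and t: "action E d s \<oplus>\<^bsub>E\<^esub> of_nat (Suc r) \<odot>\<^bsub>E\<^esub> s \<in> depth_le r" by auto
  have c: "action E n s \<in> carrier E" "action E n (action E d s) \<in> carrier E" "action E d s \<in> carrier E"
    using s E.action_closed Nh_C[OF n] d_C by auto
  have "action E d (action E n s) \<oplus>\<^bsub>E\<^esub> of_nat (Suc (r + Suc e)) \<odot>\<^bsub>E\<^esub> action E n s
    = action E n (action E d s) \<oplus>\<^bsub>E\<^esub> ((- of_nat (Suc e)) \<odot>\<^bsub>E\<^esub> action E n s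
      \<oplus>\<^bsub>E\<^esub> of_nat (Suc (r + Suc e)) \<odot>\<^bsub>E\<^esub> action E n s)"
    unfolding d_past_N[OF n s] using c by (simp add: E.M.a_assoc)
  also have "(- of_nat (Suc e)) \<odot>\<^bsub>E\<^esub> action E n s \<oplus>\<^bsub>E\<^esub> of_nat (Suc (r + Suc e)) \<odot>\<^bsub>E\<^esub> action E n s
    = (- of_nat (Suc e) + of_nat (Suc (r + Suc e))) \<odot>\<^bsub>E\<^esub> action E n s"
    by (rule E.msimps(1)[OF c(1), symmetric])
  also have "(- of_nat (Suc e) + of_nat (Suc (r + Suc e)) :: complex) = of_nat (Suc r)" by simp
  also have "action E n (action E d s) \<oplus>\<^bsub>E\<^esub> of_nat (Suc r) \<odot>\<^bsub>E\<^esub> action E n s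
    = action E n (action E d s \<oplus>\<^bsub>E\<^esub> of_nat (Suc r) \<odot>\<^bsub>E\<^esub> s)"
    using c s Nh_C[OF n] by (simp add: E.action_add E.action_smult)
  finally show ?case using Suc.IH[OF t] c by simp
qed

lemma depth_le_exhaust: "s \<in> carrier E \<Longrightarrow> \<exists>r. s \<in> depth_le r"
  unfolding negative_span_eq[symmetric]
proof (induction rule: negative_span.induct)
  case (embed m)
  then have "embed m \<in> depth_le 0" by simp
  then show ?case ..
next
  case (add s t)
  then obtain r r' where "s \<in> depth_le r" "t \<in> depth_le r'" by blast
  then have "s \<in> depth_le (max r r')" "t \<in> depth_le (max r r')" using depth_le_mono by auto
  then show ?case using stable_subspaceD(4)[OF depth_le_stable] by blast
next
  case (smult s a)
  then show ?case using stable_subspaceD(5)[OF depth_le_stable] by blast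
next
  case (act n e s)
  then show ?case using depth_le_N by blast
qed

lemma top_proj_d: "s \<in> carrier E \<Longrightarrow> top_proj (action E d s) = \<zero>\<^bsub>M\<^esub>"
  unfolding negative_span_eq[symmetric]
proof (induction rule: negative_span.induct)
  case (embed m)
  then show ?case using d_P by (simp add: embed_action[symmetric] d_M top_proj_embed)
next
  case (add s t)
  then show ?case using negative_span_E E.action_closed d_C by (simp add: E.action_add top_proj_add)
next
  case (smult s a)
  then show ?case using negative_span_E E.action_closed d_C by (simp add: E.action_smult top_proj_smult M.msimps)
next
  case (act n e s)
  have s: "s \<in> carrier E" using act negative_span_E by blast
  note c = E.action_closed[OF Nh_C[OF act.hyps(1)]]
  show ?case unfolding d_past_N[OF act.hyps(1) s]
    using s c E.action_closed[OF d_C s] Nh_N[OF act.hyps(1)]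
    by (simp add: top_proj_add top_proj_smult top_proj_N M.msimps)
qed

text \<open>Since \<open>top_proj\<close> vanishes on the image of \<open>d\<close>, the operator \<open>d + (r + 1)\<close> multiplies the projection
  by \<open>r + 1\<close>. After finitely many such steps, which do not lead out of \<open>W\<close>, only a nonzero multiple of
  \<open>1 \<otimes> top_proj s\<close> is left.\<close>

lemma top_proj_stable:
  assumes W: "stable_subspace E {d} W" and s: "s \<in> W"
  shows "embed (top_proj s) \<in> W"
proof -
  note D = stable_subspaceD[OF W]
  have "s \<in> depth_le r \<Longrightarrow> s \<in> W \<Longrightarrow> embed (top_proj s) \<in> W" for r s
  proof (induction r arbitrary: s)
    case 0
    then show ?case using top_proj_embed by auto
  next
    case (Suc r)
    have sE: "s \<in> carrier E" using Suc by simp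
    let ?t = "action E d s \<oplus>\<^bsub>E\<^esub> of_nat (Suc r) \<odot>\<^bsub>E\<^esub> s"
    have "?t \<in> W" using Suc.prems D by simp
    then have "embed (top_proj ?t) \<in> W" using Suc by simp
    moreover have "top_proj ?t = of_nat (Suc r) \<odot>\<^bsub>M\<^esub> top_proj s"
      using sE E.action_closed[OF d_C sE] top_proj_closed
      by (simp add: top_proj_add top_proj_smult top_proj_d del: of_nat_Suc)
    ultimately have "of_nat (Suc r) \<odot>\<^bsub>E\<^esub> embed (top_proj s) \<in> W"
      using top_proj_closed by (simp add: embed_smult del: of_nat_Suc)
    then have "inverse (of_nat (Suc r)) \<odot>\<^bsub>E\<^esub> (of_nat (Suc r) \<odot>\<^bsub>E\<^esub> embed (top_proj s)) \<in> W" by (rule D(5))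
    moreover have "inverse (of_nat (Suc r)) * of_nat (Suc r) = (1 :: complex)"
      by (rule left_inverse) (simp del: of_nat_Suc)
    ultimately show ?case
      using embed_closed[OF top_proj_closed[of s]] by (simp add: E.msimps(3)[symmetric] E.msimps(4) del: of_nat_Suc)
  qed
  then show ?thesis using depth_le_exhaust s D(2) by blast
qed

text \<open>The new projection is the composite of the projection onto \<open>M\<close> and the old one. A subspace stable
  under \<open>d\<close> and \<open>D\<close> contains its projection to \<open>1 \<otimes> M\<close>, on which only \<open>D\<close> is left to be used.\<close>

lemma extended_top_component:
  assumes "top_component P M H D V0 \<pi>"
  shows "top_component L E H (insert d D) (embed ` V0) (\<lambda>s. embed (\<pi> (top_proj s)))"
proof -
  interpret T: top_component P M H D V0 \<pi> by fact
  have V0c: "v \<in> V0 \<Longrightarrow> v \<in> carrier M" for v using stable_subspaceD(2)[OF T.V0_stable] .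
  note HC = subset_trans[OF T.H P_sub] and DC = subset_trans[OF T.D P_sub]
  have inj: "embed m = embed n \<longleftrightarrow> m = n" if "m \<in> carrier M" "n \<in> carrier M" for m n
    using that top_proj_embed by metis
  have smono: "stable_subspace E S W" if "S \<subseteq> S'" "stable_subspace E S' W" for S S' W
    using that by (auto simp: stable_subspace_def)
  have vimage: "stable_subspace M S {m \<in> carrier M. embed m \<in> W}"
    if "stable_subspace E S W" "S \<subseteq> carrier P" for S W
  proof -
    note d = stable_subspaceD[OF that(1)]
    show ?thesis
      by (rule stable_subspaceI)
        (use d that(2) M.action_closed in \<open>auto simp: embed_add embed_smult embed_action embed_zero subset_iff\<close>)
  qed
  show ?thesis
  proof
    show "H \<subseteq> C" by (rule HC)
    show "insert d D \<subseteq> C" using DC d_C by blast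
    show "stable_subspace E H (embed ` V0)"
    proof (rule stable_subspaceI)
      note d = stable_subspaceD[OF T.V0_stable]
      show "embed ` V0 \<subseteq> carrier E" using V0c embed_closed by blast
      show "\<zero>\<^bsub>E\<^esub> \<in> embed ` V0" using d(3) embed_zero by force
      show "m \<oplus>\<^bsub>E\<^esub> n \<in> embed ` V0" if "m \<in> embed ` V0" "n \<in> embed ` V0" for m n
        using that d(4) V0c by (auto simp: embed_add[symmetric])
      show "a \<odot>\<^bsub>E\<^esub> m \<in> embed ` V0" if "m \<in> embed ` V0" for a m
        using that d(5) V0c by (auto simp: embed_smult[symmetric])
      show "action E x m \<in> embed ` V0" if "x \<in> H" "m \<in> embed ` V0" for x m
        using that d(6) V0c T.H by (auto simp: embed_action[symmetric] subset_iff)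
    qed
    obtain v where "v \<in> V0" "v \<noteq> \<zero>\<^bsub>M\<^esub>" using T.V0_nonzero T.zero_V0 by blast
    then show "embed ` V0 \<noteq> {\<zero>\<^bsub>E\<^esub>}" using inj[OF V0c M.M.zero_closed] embed_zero by auto
  next
    fix W assume W: "stable_subspace E H W" "W \<subseteq> embed ` V0"
    let ?U = "{m \<in> carrier M. embed m \<in> W}"
    have "stable_subspace M H ?U" by (rule vimage[OF W(1) T.H])
    moreover have "?U \<subseteq> V0" using W(2) inj V0c by blast
    ultimately have u: "?U = {\<zero>\<^bsub>M\<^esub>} \<or> ?U = V0" by (rule T.V0_irreducible)
    have WU: "embed ` ?U = W" using W(2) V0c by blast
    show "W = {\<zero>\<^bsub>E\<^esub>} \<or> W = embed ` V0"
      using u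
    proof
      assume "?U = {\<zero>\<^bsub>M\<^esub>}"
      then have "embed ` ?U = embed ` {\<zero>\<^bsub>M\<^esub>}" by (rule arg_cong)
      then show ?thesis using WU embed_zero by simp
    next
      assume "?U = V0"
      then have "embed ` ?U = embed ` V0" by (rule arg_cong)
      then show ?thesis using WU by simp
    qed
  next
    fix W assume W: "stable_subspace E C W" "embed ` V0 \<subseteq> W"
    have "stable_subspace E (carrier P) W" by (rule smono[OF P_sub W(1)])
    then have "{m \<in> carrier M. embed m \<in> W} = carrier M"
      by (intro T.V0_generates vimage) (use W(2) V0c in auto)
    from equalityD2[OF this] have "embed ` carrier M \<subseteq> W" by blast
    then show "W = carrier E" by (rule embed_generates[OF W(1)])
  next
    fix s assume "s \<in> carrier E"
    show "embed (\<pi> (top_proj s)) \<in> embed ` V0" using T.\<pi>_V0 top_proj_closed by blast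
  next
    fix s t assume "s \<in> carrier E" "t \<in> carrier E"
    then show "embed (\<pi> (top_proj (s \<oplus>\<^bsub>E\<^esub> t)))
      = embed (\<pi> (top_proj s)) \<oplus>\<^bsub>E\<^esub> embed (\<pi> (top_proj t))"
      using V0c T.\<pi>_V0 top_proj_closed by (simp add: top_proj_add T.\<pi>_add embed_add)
  next
    fix m assume "m \<in> embed ` V0"
    then show "embed (\<pi> (top_proj m)) = m" using V0c by (auto simp: top_proj_embed T.\<pi>_id)
  next
    fix W s assume W: "stable_subspace E (insert d D) W" "s \<in> W"
    have "embed (top_proj s) \<in> W" by (rule top_proj_stable[OF smono[OF _ W(1)] W(2)]) simp
    moreover have "stable_subspace M D {m \<in> carrier M. embed m \<in> W}"
      by (rule vimage[OF smono[OF _ W(1)] T.D]) blast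
    ultimately show "embed (\<pi> (top_proj s)) \<in> W"
      using T.\<pi>_stable[of "{m \<in> carrier M. embed m \<in> W}" "top_proj s"] top_proj_closed by simp
  qed
qed

end

section \<open>The toroidal Lie algebras\<close>

lemma lookup_pmap: "f 0 = 0 \<Longrightarrow> Poly_Mapping.lookup (Poly_Mapping.map f p) k = f (Poly_Mapping.lookup p k)"
  by (simp add: Poly_Mapping.map.rep_eq when_def)

lemma keys_pmap: "Poly_Mapping.keys (Poly_Mapping.map f p) \<subseteq> Poly_Mapping.keys p"
  by (auto simp: in_keys_iff Poly_Mapping.map.rep_eq when_def)

lemma d_weight_superset:
  assumes "finite A" "Poly_Mapping.keys d \<subseteq> A"
  shows "d_weight d n = (\<Sum>i\<in>A. Poly_Mapping.lookup d i * of_int (Poly_Mapping.lookup n i))"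
  unfolding d_weight_def by (rule sum.mono_neutral_left) (use assms in \<open>auto simp: in_keys_iff\<close>)

lemma d_weight_add: "d_weight (d + d') n = d_weight d n + d_weight d' n"
proof -
  let ?A = "Poly_Mapping.keys d \<union> Poly_Mapping.keys d'"
  have "finite ?A" by simp
  then show ?thesis using keys_add[of d d']
    by (simp add: d_weight_superset[of ?A] lookup_add distrib_right sum.distrib)
qed

lemma d_weight_zero [simp]: "d_weight 0 n = 0"
  by (simp add: d_weight_def)

lemma d_weight_scale: "d_weight (Poly_Mapping.map ((*) a) d) n = a * d_weight d n"
  using keys_pmap[of "(*) a" d]
  by (simp add: d_weight_superset[of "Poly_Mapping.keys d"] lookup_pmap sum_distrib_left mult.assoc)

lemma d_weight_degree: "d_weight d (n + m) = d_weight d n + d_weight d m"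
  by (simp add: d_weight_def lookup_add distrib_left sum.distrib)

lemma d_weight_degree_minus: "d_weight d (- n) = - d_weight d n"
  by (simp add: d_weight_def sum_negf)

text \<open>The bracket is separated into the bracket of loops, the action of the derivations \<open>d\<^sub>i\<close> and the
  central term. Each of them is additive in every argument, which reduces identities to monomials.\<close>

definition loop_bracket ::
    "'g::ab_group_add lie_alg \<Rightarrow> (exponent \<Rightarrow>\<^sub>0 'g) \<Rightarrow> (exponent \<Rightarrow>\<^sub>0 'g) \<Rightarrow> (exponent \<Rightarrow>\<^sub>0 'g)" where
  "loop_bracket g f f' = (\<Sum>n\<in>Poly_Mapping.keys f. \<Sum>m\<in>Poly_Mapping.keys f'. Poly_Mapping.single (n + m)
          (lbracket g (Poly_Mapping.lookup f n) (Poly_Mapping.lookup f' m)))"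

definition degree_action ::
    "'g::ab_group_add lie_alg \<Rightarrow> (nat \<Rightarrow>\<^sub>0 complex) \<Rightarrow> (exponent \<Rightarrow>\<^sub>0 'g) \<Rightarrow> (exponent \<Rightarrow>\<^sub>0 'g)" where
  "degree_action g d f = (\<Sum>m\<in>Poly_Mapping.keys f. Poly_Mapping.single m
          (lscale g (d_weight d m) (Poly_Mapping.lookup f m)))"

definition cocycle ::
    "('g::ab_group_add \<Rightarrow> 'g \<Rightarrow> complex) \<Rightarrow> (exponent \<Rightarrow>\<^sub>0 'g) \<Rightarrow> (exponent \<Rightarrow>\<^sub>0 'g) \<Rightarrow> (nat \<Rightarrow>\<^sub>0 complex)" where
  "cocycle B f f' = (\<Sum>n\<in>Poly_Mapping.keys f. \<Sum>i\<in>Poly_Mapping.keys n. Poly_Mapping.single i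
        (of_int (Poly_Mapping.lookup n i)
          * B (Poly_Mapping.lookup f n) (Poly_Mapping.lookup f' (- n))))"

lemma affine_bracket_eq: "affine_bracket g B (f, c, d) (f', c', d') =
    (loop_bracket g f f' + degree_action g d f' - degree_action g d' f, cocycle B f f', 0)"
  by (simp add: affine_bracket_def loop_bracket_def degree_action_def cocycle_def)

locale affine_algebra = lie_algebra g for g :: "'g::ab_group_add lie_alg" +
  fixes B :: "'g \<Rightarrow> 'g \<Rightarrow> complex"
  assumes form: "invariant_form g B"
begin

abbreviation (input) lk where "lk \<equiv> Poly_Mapping.lookup"
abbreviation (input) kys where "kys \<equiv> Poly_Mapping.keys"
abbreviation (input) sgl where "sgl \<equiv> Poly_Mapping.single"

lemma form_sym: "x \<in> carrier g \<Longrightarrow> y \<in> carrier g \<Longrightarrow> B x y = B y x"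
  and form_add: "x \<in> carrier g \<Longrightarrow> y \<in> carrier g \<Longrightarrow> z \<in> carrier g \<Longrightarrow> B (x + y) z = B x z + B y z"
  and form_scale: "x \<in> carrier g \<Longrightarrow> y \<in> carrier g \<Longrightarrow> B (lscale g a x) y = a * B x y"
  and form_invariant: "x \<in> carrier g \<Longrightarrow> y \<in> carrier g \<Longrightarrow> z \<in> carrier g \<Longrightarrow>
    B (lbracket g x y) z = B x (lbracket g y z)"
  using form unfolding invariant_form_def by blast+

lemma form_add_right: "x \<in> carrier g \<Longrightarrow> y \<in> carrier g \<Longrightarrow> z \<in> carrier g \<Longrightarrow> B z (x + y) = B z x + B z y"
  using form_add form_sym carrier_add by metis

lemma form_scale_right: "x \<in> carrier g \<Longrightarrow> y \<in> carrier g \<Longrightarrow> B y (lscale g a x) = a * B y x"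
  using form_scale form_sym carrier_scale by metis

lemmas bracket_zero' = bracket_zero[OF lie_algebra_axioms]
lemmas form_zero' = form_zero[OF lie_algebra_axioms form]

definition loops :: "exponent set \<Rightarrow> (exponent \<Rightarrow>\<^sub>0 'g) set" where
  "loops K = {f. kys f \<subseteq> K \<and> range (lk f) \<subseteq> carrier g}"

lemma loopsD: "f \<in> loops K \<Longrightarrow> lk f n \<in> carrier g" "f \<in> loops K \<Longrightarrow> n \<in> kys f \<Longrightarrow> n \<in> K"
  by (auto simp: loops_def)

lemma loops_iff: "f \<in> loops K \<longleftrightarrow> (\<forall>n\<in>kys f. n \<in> K \<and> lk f n \<in> carrier g)"
proof -
  have "lk f n \<in> carrier g" if "n \<notin> kys f" for n using that carrier_zero by (simp add: in_keys_iff)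
  then show ?thesis unfolding loops_def by blast
qed

lemma loops_mono: "K \<subseteq> K' \<Longrightarrow> f \<in> loops K \<Longrightarrow> f \<in> loops K'"
  by (auto simp: loops_def)

lemma loops_zero: "0 \<in> loops K"
  by (simp add: loops_iff)

lemma loops_add: "f \<in> loops K \<Longrightarrow> h \<in> loops K \<Longrightarrow> f + h \<in> loops K"
  unfolding loops_def using keys_add[of f h] carrier_add by (auto simp: lookup_add image_subset_iff)

lemma loops_single: "n \<in> K \<Longrightarrow> x \<in> carrier g \<Longrightarrow> sgl n x \<in> loops K"
  by (simp add: loops_iff lookup_single)

text \<open>Identities between additive expressions in Laurent polynomials have to be verified for monomials
  only.\<close>

lemma loops_induct [consumes 1, case_names zero single_add]:
  assumes "f \<in> loops K" and zero: "R 0"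
    and step: "\<And>f n x. f \<in> loops K \<Longrightarrow> n \<in> K \<Longrightarrow> x \<in> carrier g \<Longrightarrow> R f \<Longrightarrow> R (sgl n x + f)"
  shows "R f"
proof -
  have "A \<subseteq> kys f \<Longrightarrow> (\<Sum>n\<in>A. sgl n (lk f n)) \<in> loops K \<and> R (\<Sum>n\<in>A. sgl n (lk f n))" if "finite A" for A
    using that
  proof (induction A)
    case empty
    then show ?case using zero loops_zero by simp
  next
    case (insert n A)
    then have n: "n \<in> K" "lk f n \<in> carrier g" using loopsD[OF assms(1)] by auto
    have "(\<Sum>n\<in>A. sgl n (lk f n)) \<in> loops K" "R (\<Sum>n\<in>A. sgl n (lk f n))" using insert by auto
    then show ?case using insert.hyps step[OF _ n] loops_add[OF loops_single[OF n]] by simp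
  qed
  from this[OF finite_keys subset_refl] show ?thesis using free_poly_eq_sum[of f] by simp
qed

abbreviation (input) lb where "lb \<equiv> loop_bracket g"
abbreviation (input) da where "da \<equiv> degree_action g"
abbreviation (input) co where "co \<equiv> cocycle B"
abbreviation (input) sc where "sc a \<equiv> Poly_Mapping.map (lscale g a)"

lemma lookup_sc: "lk (sc a f) n = lscale g a (lk f n)"
  by (rule lookup_pmap) simp

lemma loops_sc: "f \<in> loops K \<Longrightarrow> sc a f \<in> loops K"
  unfolding loops_def using keys_pmap[of "lscale g a" f] carrier_scale by (auto simp: lookup_sc image_subset_iff)

lemma sc_add: "sc a (f + h) = sc a f + sc a h"
  by (rule poly_mapping_eqI) (simp add: lookup_sc lookup_add scale_right_distrib)

lemma sc_zero: "sc a 0 = 0"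
  by (rule poly_mapping_eqI) (simp add: lookup_sc)

lemma sc_single: "sc a (sgl n x) = sgl n (lscale g a x)"
  by (rule poly_mapping_eqI) (simp add: lookup_sc lookup_single when_def)

lemma lb_superset:
  assumes "f \<in> loops UNIV" "h \<in> loops UNIV" "finite A" "finite A'" "kys f \<subseteq> A" "kys h \<subseteq> A'"
  shows "lb f h = (\<Sum>n\<in>A. \<Sum>m\<in>A'. sgl (n + m) (lbracket g (lk f n) (lk h m)))"
proof -
  have "lb f h = (\<Sum>n\<in>kys f. \<Sum>m\<in>A'. sgl (n + m) (lbracket g (lk f n) (lk h m)))"
    unfolding loop_bracket_def
    by (rule sum.cong[OF refl], rule sum.mono_neutral_left)
      (use assms loopsD(1)[OF assms(1)] in \<open>auto simp: in_keys_iff bracket_zero'\<close>)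
  also have "\<dots> = (\<Sum>n\<in>A. \<Sum>m\<in>A'. sgl (n + m) (lbracket g (lk f n) (lk h m)))"
    by (rule sum.mono_neutral_left)
      (use assms loopsD(1)[OF assms(2)] in \<open>auto simp: in_keys_iff bracket_zero' intro!: sum.neutral\<close>)
  finally show ?thesis .
qed

lemma loops_UNIV: "f \<in> loops K \<Longrightarrow> f \<in> loops UNIV"
  by (rule loops_mono) simp

lemma lb_add_left:
  assumes "f \<in> loops UNIV" "f' \<in> loops UNIV" "h \<in> loops UNIV"
  shows "lb (f + f') h = lb f h + lb f' h"
proof -
  let ?A = "kys f \<union> kys f'"
  have s: "lb u h = (\<Sum>n\<in>?A. \<Sum>m\<in>kys h. sgl (n + m) (lbracket g (lk u n) (lk h m)))"
    if "u \<in> loops UNIV" "kys u \<subseteq> ?A" for u by (rule lb_superset) (use that assms in auto)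
  show ?thesis
    unfolding s[OF loops_add[OF assms(1,2)] keys_add] s[OF assms(1) Un_upper1] s[OF assms(2) Un_upper2]
    by (simp add: lookup_add bracket_add_left loopsD(1)[OF assms(1)] loopsD(1)[OF assms(2)] loopsD(1)[OF assms(3)]
        single_add sum.distrib)
qed

lemma lb_add_right:
  assumes "f \<in> loops UNIV" "f' \<in> loops UNIV" "h \<in> loops UNIV"
  shows "lb h (f + f') = lb h f + lb h f'"
proof -
  let ?A = "kys f \<union> kys f'"
  have s: "lb h u = (\<Sum>n\<in>kys h. \<Sum>m\<in>?A. sgl (n + m) (lbracket g (lk h n) (lk u m)))"
    if "u \<in> loops UNIV" "kys u \<subseteq> ?A" for u by (rule lb_superset) (use that assms in auto)
  show ?thesis
    unfolding s[OF loops_add[OF assms(1,2)] keys_add] s[OF assms(1) Un_upper1] s[OF assms(2) Un_upper2]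
    by (simp add: lookup_add bracket_add_right loopsD(1)[OF assms(1)] loopsD(1)[OF assms(2)] loopsD(1)[OF assms(3)]
        single_add sum.distrib)
qed

lemma lb_zero [simp]: "lb 0 h = 0" "lb h 0 = 0"
  by (simp_all add: loop_bracket_def)

lemma lb_single: "x \<in> carrier g \<Longrightarrow> y \<in> carrier g \<Longrightarrow> lb (sgl n x) (sgl m y) = sgl (n + m) (lbracket g x y)"
  using lb_superset[of "sgl n x" "sgl m y" "{n}" "{m}"] by (simp add: loops_single lookup_single)

lemma lb_loops:
  assumes "f \<in> loops K" "h \<in> loops K'" "\<And>n m. n \<in> K \<Longrightarrow> m \<in> K' \<Longrightarrow> n + m \<in> K''"
  shows "lb f h \<in> loops K''"
  using assms(1)
proof (induction rule: loops_induct)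
  case zero
  then show ?case by (simp add: loops_zero)
next
  case (single_add f n x)
  have "lb (sgl n x) h \<in> loops K''" using assms(2)
  proof (induction rule: loops_induct)
    case zero
    then show ?case by (simp add: loops_zero)
  next
    case (single_add h m y)
    then show ?case using \<open>n \<in> K\<close> \<open>x \<in> carrier g\<close> assms(3) bracket_closed
      by (simp add: lb_add_right[OF loops_single[OF UNIV_I] loops_UNIV loops_single[OF UNIV_I]] lb_single
          loops_add loops_single)
  qed
  then show ?case using single_add
    by (simp add: lb_add_left[OF loops_single[OF UNIV_I] loops_UNIV loops_UNIV[OF assms(2)]] loops_add)
qed

lemma da_lookup: "lk (da d f) m = lscale g (d_weight d m) (lk f m)"
proof -
  have "lk (da d f) m = (\<Sum>n\<in>kys f. if n = m then lscale g (d_weight d n) (lk f n) else 0)"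
    unfolding degree_action_def lookup_sum by (rule sum.cong) (auto simp: lookup_single when_def)
  then show ?thesis by (simp add: in_keys_iff)
qed

lemma da_loops: "f \<in> loops K \<Longrightarrow> da d f \<in> loops K"
  unfolding loops_iff using carrier_scale loopsD[of f]
  by (auto simp: da_lookup in_keys_iff loops_iff)

lemma da_add: "da d (f + h) = da d f + da d h"
  by (rule poly_mapping_eqI) (simp add: da_lookup lookup_add scale_right_distrib)

lemma da_add_left: "da (d + d') f = da d f + da d' f"
  by (rule poly_mapping_eqI) (simp add: da_lookup lookup_add d_weight_add scale_left_distrib)

lemma da_zero [simp]: "da 0 f = 0" "da d 0 = 0"
  by (rule poly_mapping_eqI; simp add: da_lookup)+

lemma da_single: "da d (sgl n x) = sgl n (lscale g (d_weight d n) x)"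
  by (rule poly_mapping_eqI) (simp add: da_lookup lookup_single when_def)

lemma da_sc: "da d (sc a f) = sc a (da d f)" "da (Poly_Mapping.map ((*) a) d) f = sc a (da d f)"
  by (rule poly_mapping_eqI; simp add: da_lookup lookup_sc d_weight_scale mult.commute)+

lemma da_commute: "da d (da d' f) = da d' (da d f)"
  by (rule poly_mapping_eqI) (simp add: da_lookup mult.commute)

lemma co_lookup: "lk (co f h) i = (\<Sum>n\<in>kys f. of_int (lk n i) * B (lk f n) (lk h (- n)))"
proof -
  have "lk (\<Sum>j\<in>kys n. sgl j (of_int (lk n j) * b)) i = of_int (lk n i) * b" for n and b :: complex
  proof -
    have "lk (\<Sum>j\<in>kys n. sgl j (of_int (lk n j) * b)) i = (\<Sum>j\<in>kys n. if j = i then of_int (lk n j) * b else 0)"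
      unfolding lookup_sum by (rule sum.cong) (auto simp: lookup_single when_def)
    then show ?thesis by (simp add: in_keys_iff)
  qed
  then show ?thesis unfolding cocycle_def lookup_sum by simp
qed

lemma co_superset:
  assumes "finite A" "kys f \<subseteq> A" "h \<in> loops UNIV"
  shows "lk (co f h) i = (\<Sum>n\<in>A. of_int (lk n i) * B (lk f n) (lk h (- n)))"
  unfolding co_lookup
  by (rule sum.mono_neutral_left) (use assms loopsD(1)[OF assms(3)] in \<open>auto simp: in_keys_iff form_zero'\<close>)

lemma co_add_left:
  assumes "f \<in> loops UNIV" "f' \<in> loops UNIV" "h \<in> loops UNIV"
  shows "co (f + f') h = co f h + co f' h"
proof (rule poly_mapping_eqI)
  fix i
  let ?A = "kys f \<union> kys f'"
  have s: "lk (co u h) i = (\<Sum>n\<in>?A. of_int (lk n i) * B (lk u n) (lk h (- n)))" if "kys u \<subseteq> ?A" for u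
    by (rule co_superset) (use that assms in auto)
  show "lk (co (f + f') h) i = lk (co f h + co f' h) i"
    unfolding lookup_add s[OF keys_add] s[OF Un_upper1] s[OF Un_upper2]
    by (simp add: lookup_add form_add loopsD(1)[OF assms(1)] loopsD(1)[OF assms(2)] loopsD(1)[OF assms(3)]
        distrib_left sum.distrib)
qed

lemma co_add_right:
  assumes "f \<in> loops UNIV" "f' \<in> loops UNIV" "h \<in> loops UNIV"
  shows "co h (f + f') = co h f + co h f'"
  by (rule poly_mapping_eqI)
    (simp add: co_lookup lookup_add form_add_right loopsD(1)[OF assms(1)] loopsD(1)[OF assms(2)]
      loopsD(1)[OF assms(3)] distrib_left sum.distrib)

lemma co_zero [simp]: "co 0 h = 0"
  by (simp add: cocycle_def)

lemma co_zero_right: "f \<in> loops UNIV \<Longrightarrow> co f 0 = 0"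
  by (rule poly_mapping_eqI) (simp add: co_lookup loopsD(1) form_zero')

lemma co_single: "x \<in> carrier g \<Longrightarrow> y \<in> carrier g \<Longrightarrow>
    lk (co (sgl n x) (sgl m y)) i = (if n + m = 0 then of_int (lk n i) * B x y else 0)"
proof -
  assume x: "x \<in> carrier g" and y: "y \<in> carrier g"
  have e: "m = - n \<longleftrightarrow> n + m = 0" by (metis add_eq_0_iff)
  have "lk (co (sgl n x) (sgl m y)) i = (\<Sum>j\<in>{n}. of_int (lk j i) * B (lk (sgl n x) j) (lk (sgl m y) (- j)))"
    by (rule co_superset) (use y in \<open>auto intro: loops_single\<close>)
  then show ?thesis using x by (simp add: lookup_single when_def e form_zero')
qed

lemma co_sc: "f \<in> loops UNIV \<Longrightarrow> h \<in> loops UNIV \<Longrightarrow> co (sc a f) h = Poly_Mapping.map ((*) a) (co f h)"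
  "f \<in> loops UNIV \<Longrightarrow> h \<in> loops UNIV \<Longrightarrow> co f (sc a h) = Poly_Mapping.map ((*) a) (co f h)"
proof -
  assume f: "f \<in> loops UNIV" and h: "h \<in> loops UNIV"
  show "co (sc a f) h = Poly_Mapping.map ((*) a) (co f h)"
  proof (rule poly_mapping_eqI)
    fix i
    show "lk (co (sc a f) h) i = lk (Poly_Mapping.map ((*) a) (co f h)) i"
      by (subst co_superset[of "kys f" "sc a f" h, OF finite_keys keys_pmap h])
        (simp add: lookup_pmap co_lookup lookup_sc form_scale loopsD(1)[OF f] loopsD(1)[OF h] sum_distrib_left mult.left_commute)
  qed
  show "co f (sc a h) = Poly_Mapping.map ((*) a) (co f h)"
    by (rule poly_mapping_eqI)
      (simp add: co_lookup lookup_pmap lookup_sc form_scale_right loopsD(1)[OF f] loopsD(1)[OF h]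
        sum_distrib_left mult.left_commute)
qed

lemma lb_sc: "f \<in> loops UNIV \<Longrightarrow> h \<in> loops UNIV \<Longrightarrow> lb (sc a f) h = sc a (lb f h)"
  "f \<in> loops UNIV \<Longrightarrow> h \<in> loops UNIV \<Longrightarrow> lb f (sc a h) = sc a (lb f h)"
proof -
  assume f: "f \<in> loops UNIV" and h: "h \<in> loops UNIV"
  have s: "lb (sc a f) h = (\<Sum>n\<in>kys f. \<Sum>m\<in>kys h. sgl (n + m) (lbracket g (lk (sc a f) n) (lk h m)))"
    by (rule lb_superset[OF loops_sc[OF f] h finite_keys finite_keys keys_pmap subset_refl])
  have s': "lb f (sc a h) = (\<Sum>n\<in>kys f. \<Sum>m\<in>kys h. sgl (n + m) (lbracket g (lk f n) (lk (sc a h) m)))"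
    by (rule lb_superset[OF f loops_sc[OF h] finite_keys finite_keys subset_refl keys_pmap])
  have sum: "sc a (sum F A) = (\<Sum>x\<in>A. sc a (F x))" if "finite A" for F and A :: "exponent set"
    using that by (induction A) (simp_all add: sc_add sc_zero)
  show "lb (sc a f) h = sc a (lb f h)" "lb f (sc a h) = sc a (lb f h)"
    unfolding s s' unfolding loop_bracket_def
    by (simp_all add: sum sc_single lookup_sc bracket_scale_left bracket_scale_right loopsD(1)[OF f] loopsD(1)[OF h])
qed

lemmas lbs = lb_add_left[OF loops_single[OF UNIV_I]] lb_add_right[OF loops_single[OF UNIV_I]]
lemmas cos = co_add_left[OF loops_single[OF UNIV_I]] co_add_right[OF loops_single[OF UNIV_I]]

lemma lb_swap:
  assumes "f \<in> loops UNIV" "h \<in> loops UNIV"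
  shows "lb f h + lb h f = 0"
  using assms(1)
proof (induction rule: loops_induct)
  case (single_add f n x)
  have "lb (sgl n x) h + lb h (sgl n x) = 0" using assms(2)
  proof (induction rule: loops_induct)
    case (single_add h m y)
    have e: "lbracket g x y + lbracket g y x = 0" using bracket_swap[of x y] \<open>x \<in> carrier g\<close> single_add by simp
    have a: "lb (sgl n x) (sgl m y + h) = sgl (n + m) (lbracket g x y) + lb (sgl n x) h"
      "lb (sgl m y + h) (sgl n x) = sgl (n + m) (lbracket g y x) + lb h (sgl n x)"
      using single_add \<open>x \<in> carrier g\<close> by (simp_all add: lbs loops_single lb_single add.commute[of m n])
    have "sgl (n + m) (lbracket g x y) + sgl (n + m) (lbracket g y x) = 0"
      unfolding Poly_Mapping.single_add[symmetric] e by simp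
    then have "(sgl (n + m) (lbracket g x y) + sgl (n + m) (lbracket g y x)) + (lb (sgl n x) h + lb h (sgl n x)) = 0"
      using single_add.IH by simp
    then show ?case unfolding a by (simp add: algebra_simps)
  qed simp
  moreover have "lb (sgl n x + f) h + lb h (sgl n x + f) = (lb (sgl n x) h + lb h (sgl n x)) + (lb f h + lb h f)"
    using single_add assms by (simp add: lbs)
  ultimately show ?case using single_add by simp
qed simp

lemma lb_self: "f \<in> loops UNIV \<Longrightarrow> lb f f = 0"
proof (induction rule: loops_induct)
  case (single_add f n x)
  have s: "sgl n x \<in> loops UNIV" using single_add loops_single by blast
  have "lb (sgl n x + f) (sgl n x + f) = lb (sgl n x) (sgl n x) + (lb (sgl n x) f + lb f (sgl n x)) + lb f f"
    using single_add s loops_add[OF s single_add(1)] by (simp add: lbs)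
  then show ?case using single_add lb_swap[OF s single_add(1)] by (simp add: lb_single bracket_self)
qed simp

lemma co_swap:
  assumes "f \<in> loops UNIV" "h \<in> loops UNIV"
  shows "co f h + co h f = 0"
  using assms(1)
proof (induction rule: loops_induct)
  case zero
  then show ?case using assms by (simp add: co_zero_right)
next
  case (single_add f n x)
  have "co (sgl n x) h + co h (sgl n x) = 0" using assms(2)
  proof (induction rule: loops_induct)
    case zero
    then show ?case using \<open>x \<in> carrier g\<close> by (simp add: co_zero_right loops_single)
  next
    case (single_add h m y)
    have e: "co (sgl n x) (sgl m y) + co (sgl m y) (sgl n x) = 0"
    proof (rule poly_mapping_eqI)
      fix i
      have "of_int (lk n i) + of_int (lk m i) = (0 :: complex)" if "n + m = 0"
        using arg_cong[OF that, of "\<lambda>p. of_int (lk p i) :: complex"] by (simp add: lookup_add)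
      then show "lk (co (sgl n x) (sgl m y) + co (sgl m y) (sgl n x)) i = lk 0 i"
        using single_add \<open>x \<in> carrier g\<close> form_sym[of x y]
        by (simp add: lookup_add co_single add.commute flip: distrib_right)
    qed
    have "co (sgl n x) (sgl m y + h) + co (sgl m y + h) (sgl n x)
      = (co (sgl n x) (sgl m y) + co (sgl m y) (sgl n x)) + (co (sgl n x) h + co h (sgl n x))"
      using single_add \<open>x \<in> carrier g\<close> by (simp add: cos loops_single)
    then show ?case using single_add e by simp
  qed
  moreover have "co (sgl n x + f) h + co h (sgl n x + f) = (co (sgl n x) h + co h (sgl n x)) + (co f h + co h f)"
    using single_add assms by (simp add: cos)
  ultimately show ?case using single_add by simp
qed

lemma co_self: "f \<in> loops UNIV \<Longrightarrow> co f f = 0"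
proof (rule poly_mapping_eqI)
  fix i assume "f \<in> loops UNIV"
  from arg_cong[OF co_swap[OF this this], of "\<lambda>p. lk p i"]
  have "lk (co f f) i + lk (co f f) i = 0" by (simp only: lookup_add lookup_zero)
  then show "lk (co f f) i = lk 0 i" by simp
qed

lemma da_derivation:
  assumes "f \<in> loops UNIV" "h \<in> loops UNIV"
  shows "da d (lb f h) = lb (da d f) h + lb f (da d h)"
  using assms(1)
proof (induction rule: loops_induct)
  case (single_add f n x)
  have "da d (lb (sgl n x) h) = lb (da d (sgl n x)) h + lb (sgl n x) (da d h)" using assms(2)
  proof (induction rule: loops_induct)
    case (single_add h m y)
    have c: "lscale g (d_weight d n) x \<in> carrier g" "lscale g (d_weight d m) y \<in> carrier g"
      using single_add \<open>x \<in> carrier g\<close> carrier_scale by auto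
    show ?case using single_add \<open>x \<in> carrier g\<close> c da_loops[of h UNIV d]
      by (simp add: lbs loops_single da_add da_single lb_single d_weight_degree scale_left_distrib
          bracket_scale_left bracket_scale_right Poly_Mapping.single_add)
  qed simp
  then show ?case using single_add assms da_loops[of f UNIV d] da_loops[of h UNIV d]
    da_loops[OF loops_single[OF UNIV_I single_add(3)], of d n]
    by (simp add: lb_add_left loops_single da_add)
qed simp

lemma co_derivation:
  assumes "f \<in> loops UNIV" "h \<in> loops UNIV"
  shows "co (da d f) h + co f (da d h) = 0"
proof (rule poly_mapping_eqI)
  fix i
  have k: "kys (da d f) \<subseteq> kys f" by (auto simp: in_keys_iff da_lookup)
  show "lk (co (da d f) h + co f (da d h)) i = lk 0 i"
    unfolding lookup_add co_superset[OF finite_keys k assms(2)] co_superset[OF finite_keys subset_refl da_loops[OF assms(2)]]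
      sum.distrib[symmetric]
    by (simp add: da_lookup form_scale form_scale_right loopsD(1)[OF assms(1)] loopsD(1)[OF assms(2)]
        d_weight_degree_minus algebra_simps del: scale_minus_left)
qed

text \<open>Both Jacobi identities below are of this kind: a cyclic expression that is additive in its
  first argument is additive in all three, so that it suffices to test monomials.\<close>

lemma cyclic_additive_zero:
  fixes J :: "(exponent \<Rightarrow>\<^sub>0 'g) \<Rightarrow> (exponent \<Rightarrow>\<^sub>0 'g) \<Rightarrow> (exponent \<Rightarrow>\<^sub>0 'g) \<Rightarrow> 'b::ab_group_add"
  assumes add: "\<And>f f' h k. f \<in> loops UNIV \<Longrightarrow> f' \<in> loops UNIV \<Longrightarrow> h \<in> loops UNIV \<Longrightarrow> k \<in> loops UNIV \<Longrightarrow>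
      J (f + f') h k = J f h k + J f' h k"
    and rot: "\<And>f h k. J f h k = J h k f"
    and monomials: "\<And>n m q x y z. x \<in> carrier g \<Longrightarrow> y \<in> carrier g \<Longrightarrow> z \<in> carrier g \<Longrightarrow>
      J (sgl n x) (sgl m y) (sgl q z) = 0"
    and fhk: "f \<in> loops UNIV" "h \<in> loops UNIV" "k \<in> loops UNIV"
  shows "J f h k = 0"
proof -
  have rot': "J f h k = J k f h" for f h k using rot[of k f h] by simp
  have sU: "x \<in> carrier g \<Longrightarrow> sgl n x \<in> loops UNIV" for x n by (simp add: loops_single)
  have zero: "J 0 h k = 0" if "h \<in> loops UNIV" "k \<in> loops UNIV" for h k
    using add[OF loops_zero loops_zero that] by simp
  have one: "J (sgl n x) (sgl m y) k = 0" if "x \<in> carrier g" "y \<in> carrier g" "k \<in> loops UNIV" for n m x y k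
    using that(3)
  proof (induction rule: loops_induct)
    case zero
    show ?case unfolding rot'[of _ _ 0] by (rule \<open>\<And>k h. h \<in> loops UNIV \<Longrightarrow> k \<in> loops UNIV \<Longrightarrow> J 0 h k = 0\<close>[OF sU sU, OF that(1,2)])
  next
    case (single_add k q z)
    have "J (sgl q z + k) (sgl n x) (sgl m y) = J (sgl q z) (sgl n x) (sgl m y) + J k (sgl n x) (sgl m y)"
      by (rule add) (use single_add that sU in auto)
    then show ?case using single_add.IH monomials[OF single_add(3) that(1,2), of q n m]
      by (simp only: rot'[of "sgl n x" "sgl m y"] add_0_left)
  qed
  have two: "J (sgl n x) h k = 0" if "x \<in> carrier g" "h \<in> loops UNIV" "k \<in> loops UNIV" for n x h k
    using that(2)
  proof (induction rule: loops_induct)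
    case zero
    show ?case unfolding rot[of _ 0] by (rule \<open>\<And>k h. h \<in> loops UNIV \<Longrightarrow> k \<in> loops UNIV \<Longrightarrow> J 0 h k = 0\<close>[OF that(3) sU[OF that(1)]])
  next
    case (single_add h m y)
    have "J (sgl m y + h) k (sgl n x) = J (sgl m y) k (sgl n x) + J h k (sgl n x)"
      by (rule add) (use single_add that sU in auto)
    then show ?case using single_add.IH one[OF that(1) single_add(3) that(3), of n m]
      by (simp only: rot[of "sgl n x"] add_0_left)
  qed
  show ?thesis using fhk(1)
  proof (induction rule: loops_induct)
    case zero
    show ?case by (rule \<open>\<And>k h. h \<in> loops UNIV \<Longrightarrow> k \<in> loops UNIV \<Longrightarrow> J 0 h k = 0\<close>[OF fhk(2,3)])
  next
    case (single_add f n x)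
    have "J (sgl n x + f) h k = J (sgl n x) h k + J f h k"
      by (rule add) (use single_add fhk sU in auto)
    then show ?case using single_add two[OF single_add(3) fhk(2,3)] by simp
  qed
qed

lemma lb_jacobi:
  assumes "f \<in> loops UNIV" "h \<in> loops UNIV" "k \<in> loops UNIV"
  shows "lb f (lb h k) + lb h (lb k f) + lb k (lb f h) = 0"
proof (rule cyclic_additive_zero[OF _ _ _ assms])
  have lU: "u \<in> loops UNIV \<Longrightarrow> v \<in> loops UNIV \<Longrightarrow> lb u v \<in> loops UNIV" for u v by (rule lb_loops) auto
  show "lb (f + f') (lb h k) + lb h (lb k (f + f')) + lb k (lb (f + f') h)
      = lb f (lb h k) + lb h (lb k f) + lb k (lb f h) + (lb f' (lb h k) + lb h (lb k f') + lb k (lb f' h))"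
    if "f \<in> loops UNIV" "f' \<in> loops UNIV" "h \<in> loops UNIV" "k \<in> loops UNIV" for f f' h k
    using that by (simp add: lb_add_left lb_add_right lU algebra_simps)
  show "lb (sgl n x) (lb (sgl m y) (sgl q z)) + lb (sgl m y) (lb (sgl q z) (sgl n x))
      + lb (sgl q z) (lb (sgl n x) (sgl m y)) = 0"
    if "x \<in> carrier g" "y \<in> carrier g" "z \<in> carrier g" for n m q x y z
  proof -
    have d: "m + (q + n) = n + (m + q)" "q + (n + m) = n + (m + q)" by (simp_all add: algebra_simps)
    show ?thesis using that jacobi[OF that]
      by (simp add: lb_single bracket_closed d flip: Poly_Mapping.single_add)
  qed
qed (simp add: add.commute add.left_commute)

text \<open>On monomials of degrees \<open>n\<close>, \<open>m\<close>, \<open>q\<close> the invariance of the form turns the sum into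
  \<open>(n + m + q)\<^sub>i B(x, [y, z])\<close>, which vanishes because the cocycle is supported in total degree zero.\<close>

lemma co_jacobi:
  assumes "f \<in> loops UNIV" "h \<in> loops UNIV" "k \<in> loops UNIV"
  shows "co f (lb h k) + co h (lb k f) + co k (lb f h) = 0"
proof (rule cyclic_additive_zero[OF _ _ _ assms])
  have lU: "u \<in> loops UNIV \<Longrightarrow> v \<in> loops UNIV \<Longrightarrow> lb u v \<in> loops UNIV" for u v by (rule lb_loops) auto
  show "co (f + f') (lb h k) + co h (lb k (f + f')) + co k (lb (f + f') h)
      = co f (lb h k) + co h (lb k f) + co k (lb f h) + (co f' (lb h k) + co h (lb k f') + co k (lb f' h))"
    if "f \<in> loops UNIV" "f' \<in> loops UNIV" "h \<in> loops UNIV" "k \<in> loops UNIV" for f f' h k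
    using that by (simp add: lb_add_left lb_add_right co_add_left co_add_right lU algebra_simps)
  show "co (sgl n x) (lb (sgl m y) (sgl q z)) + co (sgl m y) (lb (sgl q z) (sgl n x))
      + co (sgl q z) (lb (sgl n x) (sgl m y)) = 0" (is "?J = 0")
    if "x \<in> carrier g" "y \<in> carrier g" "z \<in> carrier g" for n m q x y z
  proof (rule poly_mapping_eqI)
    fix i
    have d: "m + (q + n) = n + (m + q)" "q + (n + m) = n + (m + q)" by (simp_all add: algebra_simps)
    have i: "of_int (lk n i) + of_int (lk m i) + of_int (lk q i) = (0 :: complex)" if "n + (m + q) = 0"
      using arg_cong[OF that, of "\<lambda>p. of_int (lk p i) :: complex"] by (simp add: lookup_add add.assoc)
    have b: "B y (lbracket g z x) = B x (lbracket g y z)" "B z (lbracket g x y) = B x (lbracket g y z)"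
      using that form_invariant[of y z x] form_invariant[of x y z]
        form_sym[of "lbracket g y z" x] form_sym[of "lbracket g x y" z] bracket_closed by auto
    have "lk ?J i
      = (if n + (m + q) = 0 then (of_int (lk n i) + of_int (lk m i) + of_int (lk q i)) * B x (lbracket g y z) else 0)"
      using that by (simp add: lookup_add lb_single bracket_closed co_single d b distrib_right)
    then show "lk ?J i = lk 0 i" using i by simp
  qed
qed (simp add: add.commute add.left_commute)

lemma affine_vector_space: "vector_space (affine_scale g)"
proof
  fix a b and x y :: "'g affine"
  note pm = poly_mapping_eqI
  obtain f c d where x: "x = (f, c, d)" by (metis prod_cases3)
  obtain f' c' d' where y: "y = (f', c', d')" by (metis prod_cases3)
  show "affine_scale g a (x + y) = affine_scale g a x + affine_scale g a y"
    unfolding x y affine_scale_def by (auto intro!: pm simp: lookup_pmap lookup_add scale_right_distrib distrib_left)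
  show "affine_scale g (a + b) x = affine_scale g a x + affine_scale g b x"
    unfolding x affine_scale_def by (auto intro!: pm simp: lookup_pmap lookup_add scale_left_distrib distrib_right)
  show "affine_scale g a (affine_scale g b x) = affine_scale g (a * b) x"
    unfolding x affine_scale_def by (auto intro!: pm simp: lookup_pmap mult.assoc)
  show "affine_scale g 1 x = x"
    unfolding x affine_scale_def by (auto intro!: pm simp: lookup_pmap)
qed

definition degrees :: "nat \<Rightarrow> exponent set" where
  "degrees k = {n. kys n \<subseteq> {1..k}}"

lemma degrees_add: "n \<in> degrees k \<Longrightarrow> m \<in> degrees k \<Longrightarrow> n + m \<in> degrees k"
  unfolding degrees_def using keys_add[of n m] by blast

lemma carrier_ghat: "(f, c, d) \<in> carrier (ghat g B k) \<longleftrightarrow>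
    f \<in> loops (degrees k) \<and> kys c \<subseteq> {1..k} \<and> kys d \<subseteq> {1..k}"
  by (auto simp: ghat_def loops_iff degrees_def)

lemma ghat_simps [simp]: "lscale (ghat g B k) = affine_scale g" "lbracket (ghat g B k) = affine_bracket g B"
  by (simp_all add: ghat_def)

lemma co_keys:
  assumes "f \<in> loops (degrees k)"
  shows "kys (co f h) \<subseteq> {1..k}"
proof
  fix i assume i: "i \<in> kys (co f h)"
  have "\<exists>n\<in>kys f. lk n i \<noteq> 0"
  proof (rule ccontr)
    assume "\<not> (\<exists>n\<in>kys f. lk n i \<noteq> 0)"
    then have "lk (co f h) i = 0" unfolding co_lookup by (intro sum.neutral) auto
    then show False using i by (simp add: in_keys_iff)
  qed
  then show "i \<in> {1..k}" using loopsD(2)[OF assms] by (auto simp: degrees_def in_keys_iff subset_iff)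
qed

lemma loops_uminus: "f \<in> loops K \<Longrightarrow> - f \<in> loops K"
  using loops_sc[of f K "-1"] by (simp add: poly_mapping_eqI[of "- f" "sc (-1) f"] lookup_sc)

lemma loops_diff: "f \<in> loops K \<Longrightarrow> h \<in> loops K \<Longrightarrow> f - h \<in> loops K"
  using loops_add[OF _ loops_uminus, of f K h] by simp

text \<open>In the Jacobi identity the terms with two derivations cancel as derivations commute, those with one
  because derivations respect the loop bracket and the cocycle, and the rest are the two Jacobi
  identities above.\<close>

lemma affine_lie_algebra: "lie_algebra (ghat g B k)"
proof -
  interpret V: vector_space "lscale (ghat g B k)" by (simp add: affine_vector_space)
  note lU = loops_UNIV[of _ "degrees k"]
  have lbU: "u \<in> loops UNIV \<Longrightarrow> v \<in> loops UNIV \<Longrightarrow> lb u v \<in> loops UNIV" for u v by (rule lb_loops) auto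
  show ?thesis
  proof
    show "V.subspace (carrier (ghat g B k))"
    proof (rule V.subspaceI)
      show "0 \<in> carrier (ghat g B k)" by (simp add: zero_prod_def carrier_ghat loops_zero)
      fix x y :: "'g affine" and a assume x: "x \<in> carrier (ghat g B k)"
      obtain f c d where e: "x = (f, c, d)" by (metis prod_cases3)
      obtain f' c' d' where e': "y = (f', c', d')" by (metis prod_cases3)
      show "lscale (ghat g B k) a x \<in> carrier (ghat g B k)"
        using x loops_sc keys_pmap[of "(*) a" c] keys_pmap[of "(*) a" d]
        unfolding e by (auto simp: affine_scale_def carrier_ghat)
      show "x + y \<in> carrier (ghat g B k)" if "y \<in> carrier (ghat g B k)"
        using x that loops_add keys_add[of c c'] keys_add[of d d']
        unfolding e e' by (auto simp: carrier_ghat)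
    qed
    fix x y z :: "'g affine" and a
    assume x: "x \<in> carrier (ghat g B k)"
    obtain f c d where e: "x = (f, c, d)" by (metis prod_cases3)
    obtain f' c' d' where e': "y = (f', c', d')" by (metis prod_cases3)
    obtain f'' c'' d'' where e'': "z = (f'', c'', d'')" by (metis prod_cases3)
    have f: "f \<in> loops (degrees k)" "f \<in> loops UNIV" using x lU unfolding e by (auto simp: carrier_ghat)
    show "lbracket (ghat g B k) x x = 0"
      using f by (simp add: e affine_bracket_eq lb_self co_self zero_prod_def)
    assume y: "y \<in> carrier (ghat g B k)"
    have f': "f' \<in> loops (degrees k)" "f' \<in> loops UNIV" using y lU unfolding e' by (auto simp: carrier_ghat)
    show "lbracket (ghat g B k) x y \<in> carrier (ghat g B k)"
      using lb_loops[OF f(1) f'(1), of "degrees k"] degrees_add da_loops[OF f(1)] da_loops[OF f'(1)] co_keys[OF f(1)]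
      by (simp add: e e' affine_bracket_eq carrier_ghat loops_add loops_diff)
    show "lbracket (ghat g B k) (lscale (ghat g B k) a x) y = lscale (ghat g B k) a (lbracket (ghat g B k) x y)"
    proof -
      have m: "sc a (u - v) = sc a u - sc a v" for u v
        by (rule poly_mapping_eqI) (simp add: lookup_sc lookup_minus scale_right_diff_distrib)
      show ?thesis unfolding e e' ghat_simps affine_scale_def prod.case affine_bracket_eq
        using f f' by (simp add: lb_sc co_sc da_sc sc_add m) (simp add: poly_mapping_eqI lookup_pmap)
    qed
    show "lbracket (ghat g B k) x (lscale (ghat g B k) a y) = lscale (ghat g B k) a (lbracket (ghat g B k) x y)"
    proof -
      have m: "sc a (u - v) = sc a u - sc a v" for u v
        by (rule poly_mapping_eqI) (simp add: lookup_sc lookup_minus scale_right_diff_distrib)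
      show ?thesis unfolding e e' ghat_simps affine_scale_def prod.case affine_bracket_eq
        using f f' by (simp add: lb_sc co_sc da_sc sc_add m) (simp add: poly_mapping_eqI lookup_pmap)
    qed
    assume z: "z \<in> carrier (ghat g B k)"
    have f'': "f'' \<in> loops (degrees k)" "f'' \<in> loops UNIV" using z lU unfolding e'' by (auto simp: carrier_ghat)
    show "lbracket (ghat g B k) (x + y) z = lbracket (ghat g B k) x z + lbracket (ghat g B k) y z"
      using f f' f'' by (simp add: e e' e'' affine_bracket_eq lb_add_left co_add_left da_add da_add_left)
    show "lbracket (ghat g B k) x (y + z) = lbracket (ghat g B k) x y + lbracket (ghat g B k) x z"
      using f f' f'' by (simp add: e e' e'' affine_bracket_eq lb_add_right co_add_right da_add da_add_left)
    have s: "lb u (v - w) = lb u v - lb u w" "co u (v - w) = co u v - co u w"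
      if "u \<in> loops UNIV" "v \<in> loops UNIV" "w \<in> loops UNIV" for u v w
      using lb_add_right[OF loops_diff[OF that(2,3)] that(3,1)] co_add_right[OF loops_diff[OF that(2,3)] that(3,1)]
      by simp_all
    have ds: "da d (v - w) = da d v - da d w" for d v w
      using da_add[of d "v - w" w] by simp
    have L: "lb u (da d v) = - lb (da d v) u" "co u (da d v) = - co (da d v) u"
      if "u \<in> loops UNIV" "v \<in> loops UNIV" for u v d
      using lb_swap[OF that(1) da_loops[OF that(2)]] co_swap[OF that(1) da_loops[OF that(2)]]
      by (simp_all add: eq_neg_iff_add_eq_0)
    have C: "co (da d u) v = co (da d v) u" if "u \<in> loops UNIV" "v \<in> loops UNIV" for u v d
      using co_derivation[OF that, of d] L(2)[OF that, of d] by simp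
    have T: "lb u (lb v w + da e w - da e' v) + da e0 (lb v w + da e w - da e' v) - da 0 u
      = lb u (lb v w) - lb (da e w) u + lb (da e' v) u + lb (da e0 v) w - lb (da e0 w) v
        + da e0 (da e w) - da e0 (da e' v)"
      if "u \<in> loops UNIV" "v \<in> loops UNIV" "w \<in> loops UNIV" for u v w e e' e0
    proof -
      note t = that da_loops[OF that(1)] da_loops[OF that(2)] da_loops[OF that(3)] lbU[OF that(2,3)]
      have "lb u (lb v w + da e w - da e' v) = lb u (lb v w) - lb (da e w) u + lb (da e' v) u"
        using t L(1)[OF that(1,2)] L(1)[OF that(1,3)] by (simp add: s loops_add lb_add_right)
      moreover have "da e0 (lb v w + da e w - da e' v)
        = lb (da e0 v) w - lb (da e0 w) v + da e0 (da e w) - da e0 (da e' v)"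
        using t L(1)[OF that(2,3)] by (simp add: ds da_add da_derivation)
      ultimately show ?thesis by simp
    qed
    have S: "co u (lb v w + da e w - da e' v) = co u (lb v w) - co (da e w) u + co (da e' v) u"
      if "u \<in> loops UNIV" "v \<in> loops UNIV" "w \<in> loops UNIV" for u v w e e'
      using that da_loops[OF that(2)] da_loops[OF that(3)] lbU[OF that(2,3)] L(2)[OF that(1,2)] L(2)[OF that(1,3)]
      by (simp add: s loops_add co_add_right)
    have "(lb f (lb f' f'') - lb (da d' f'') f + lb (da d'' f') f + lb (da d f') f'' - lb (da d f'') f'
        + da d (da d' f'') - da d (da d'' f'))
      + (lb f' (lb f'' f) - lb (da d'' f) f' + lb (da d f'') f' + lb (da d' f'') f - lb (da d' f) f''
        + da d' (da d'' f) - da d' (da d f''))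
      + (lb f'' (lb f f') - lb (da d f') f'' + lb (da d' f) f'' + lb (da d'' f) f' - lb (da d'' f') f
        + da d'' (da d f') - da d'' (da d' f))
      = lb f (lb f' f'') + lb f' (lb f'' f) + lb f'' (lb f f')"
      unfolding da_commute[of d' d] da_commute[of d'' d] da_commute[of d'' d'] by (simp add: algebra_simps)
    moreover have "(co f (lb f' f'') - co (da d' f'') f + co (da d'' f') f)
      + (co f' (lb f'' f) - co (da d'' f) f' + co (da d f'') f')
      + (co f'' (lb f f') - co (da d f') f'' + co (da d' f) f'')
      = co f (lb f' f'') + co f' (lb f'' f) + co f'' (lb f f')"
      unfolding C[OF f''(2) f(2)] C[OF f'(2) f(2)] C[OF f''(2) f'(2)] by (simp add: algebra_simps)
    ultimately show "lbracket (ghat g B k) x (lbracket (ghat g B k) y z) + lbracket (ghat g B k) y (lbracket (ghat g B k) z x)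
      + lbracket (ghat g B k) z (lbracket (ghat g B k) x y) = 0"
      unfolding e e' e'' ghat_simps affine_bracket_eq T[OF f(2) f'(2) f''(2)] T[OF f'(2) f''(2) f(2)]
        T[OF f''(2) f(2) f'(2)] S[OF f(2) f'(2) f''(2)] S[OF f'(2) f''(2) f(2)] S[OF f''(2) f(2) f'(2)] add_Pair
      using lb_jacobi[OF f(2) f'(2) f''(2)] co_jacobi[OF f(2) f'(2) f''(2)] by (simp only: zero_prod_def add_0_left)
  qed
qed

end

section \<open>Induction from level \<open>k\<close> to level \<open>k + 1\<close>\<close>

lemma lie_subalgebra:
  assumes "lie_algebra L" "Modules.module.subspace (lscale L) S" "S \<subseteq> carrier L"
    and "\<And>x y. x \<in> S \<Longrightarrow> y \<in> S \<Longrightarrow> lbracket L x y \<in> S"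
  shows "lie_algebra (L\<lparr>carrier := S\<rparr>)"
proof -
  interpret L: lie_algebra L by fact
  interpret V: vector_space "lscale (L\<lparr>carrier := S\<rparr>)" by (simp add: L.vector_space_axioms)
  show ?thesis
    by unfold_locales
      (use assms(2-4) in \<open>auto simp: subset_iff L.bracket_add_left L.bracket_add_right L.bracket_scale_left
        L.bracket_scale_right L.bracket_self L.jacobi\<close>)
qed

context affine_algebra
begin

definition restrict_degrees :: "exponent set \<Rightarrow> (exponent \<Rightarrow>\<^sub>0 'g) \<Rightarrow> (exponent \<Rightarrow>\<^sub>0 'g)" where
  "restrict_degrees K f = (\<Sum>n\<in>{n \<in> kys f. n \<in> K}. sgl n (lk f n))"

lemma restrict_lookup: "lk (restrict_degrees K f) n = (if n \<in> K then lk f n else 0)"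
proof -
  have "lk (restrict_degrees K f) n = (\<Sum>m\<in>{n \<in> kys f. n \<in> K}. if m = n then lk f m else 0)"
    unfolding restrict_degrees_def lookup_sum by (rule sum.cong) (auto simp: lookup_single when_def)
  then show ?thesis by (auto simp: in_keys_iff)
qed

lemma restrict_add: "restrict_degrees K (f + h) = restrict_degrees K f + restrict_degrees K h"
  by (rule poly_mapping_eqI) (simp add: restrict_lookup lookup_add)

lemma restrict_sc: "restrict_degrees K (sc a f) = sc a (restrict_degrees K f)"
  by (rule poly_mapping_eqI) (simp add: restrict_lookup lookup_sc)

lemma restrict_zero [simp]: "restrict_degrees K 0 = 0"
  by (rule poly_mapping_eqI) (simp add: restrict_lookup)

lemma restrict_single: "restrict_degrees K (sgl n x) = (if n \<in> K then sgl n x else 0)"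
  by (rule poly_mapping_eqI) (auto simp: restrict_lookup lookup_single when_def)

lemma restrict_loops: "f \<in> loops K' \<Longrightarrow> restrict_degrees K f \<in> loops (K' \<inter> K)"
  unfolding loops_iff by (auto simp: in_keys_iff restrict_lookup split: if_splits)

lemma loops_outside: "f \<in> loops K \<Longrightarrow> n \<notin> K \<Longrightarrow> lk f n = 0"
  using loopsD(2)[of f K n] by (auto simp: in_keys_iff)

lemma restrict_id: "f \<in> loops K \<Longrightarrow> restrict_degrees K f = f"
  by (rule poly_mapping_eqI) (simp add: restrict_lookup loops_outside)

definition zero_in :: "nat \<Rightarrow> exponent set" where "zero_in k = {n. lk n k = 0}"
definition neg_in :: "nat \<Rightarrow> exponent set" where "neg_in k = {n. lk n k < 0}"
definition nonneg_in :: "nat \<Rightarrow> exponent set" where "nonneg_in k = {n. 0 \<le> lk n k}"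

lemma degrees_Suc: "degrees (Suc k) \<inter> zero_in (Suc k) = degrees k"
proof
  show "degrees k \<subseteq> degrees (Suc k) \<inter> zero_in (Suc k)"
  proof
    fix n assume n: "n \<in> degrees k"
    then have "Suc k \<notin> kys n" by (auto simp: degrees_def)
    then show "n \<in> degrees (Suc k) \<inter> zero_in (Suc k)" using n by (auto simp: degrees_def zero_in_def in_keys_iff)
  qed
  show "degrees (Suc k) \<inter> zero_in (Suc k) \<subseteq> degrees k"
  proof
    fix n assume n: "n \<in> degrees (Suc k) \<inter> zero_in (Suc k)"
    then have "Suc k \<notin> kys n" "kys n \<subseteq> {1..Suc k}" by (auto simp: degrees_def zero_in_def in_keys_iff)
    then have "kys n \<subseteq> {1..Suc k} - {Suc k}" by blast
    then show "n \<in> degrees k" by (auto simp: degrees_def)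
  qed
qed

lemma carrier_ghat_plus: "(f, c, d) \<in> carrier (ghat_plus g B k) \<longleftrightarrow>
    f \<in> loops (degrees k \<inter> nonneg_in k) \<and> kys c \<subseteq> {1..k} \<and> kys d \<subseteq> {1..k}"
  by (auto simp: ghat_plus_def carrier_ghat loops_iff nonneg_in_def)

lemma ghat_plus_simps [simp]: "lscale (ghat_plus g B k) = affine_scale g" "lbracket (ghat_plus g B k) = affine_bracket g B"
  by (simp_all add: ghat_plus_def)

lemma ghat_plus_sub: "carrier (ghat_plus g B k) \<subseteq> carrier (ghat g B k)"
  by (auto simp: ghat_plus_def)

lemma ghat_plus_lie_algebra: "lie_algebra (ghat_plus g B k)"
proof -
  interpret L: lie_algebra "ghat g B k" by (rule affine_lie_algebra)
  have eq: "ghat_plus g B k = (ghat g B k)\<lparr>carrier := carrier (ghat_plus g B k)\<rparr>"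
    by (simp add: ghat_plus_def)
  show ?thesis
  proof (subst eq, rule lie_subalgebra[OF affine_lie_algebra])
    show "carrier (ghat_plus g B k) \<subseteq> carrier (ghat g B k)" by (rule ghat_plus_sub)
    show "L.subspace (carrier (ghat_plus g B k))"
    proof (rule L.subspaceI)
      show "0 \<in> carrier (ghat_plus g B k)" by (simp add: zero_prod_def carrier_ghat_plus loops_zero)
      fix x y :: "'g affine" and a assume x: "x \<in> carrier (ghat_plus g B k)"
      obtain f c d where e: "x = (f, c, d)" by (metis prod_cases3)
      obtain f' c' d' where e': "y = (f', c', d')" by (metis prod_cases3)
      show "lscale (ghat g B k) a x \<in> carrier (ghat_plus g B k)"
        using x loops_sc keys_pmap[of "(*) a" c] keys_pmap[of "(*) a" d]
        unfolding e by (auto simp: affine_scale_def carrier_ghat_plus)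
      show "x + y \<in> carrier (ghat_plus g B k)" if "y \<in> carrier (ghat_plus g B k)"
        using x that loops_add keys_add[of c c'] keys_add[of d d']
        unfolding e e' by (auto simp: carrier_ghat_plus)
    qed
    fix x y assume x: "x \<in> carrier (ghat_plus g B k)" and y: "y \<in> carrier (ghat_plus g B k)"
    obtain f c d where e: "x = (f, c, d)" by (metis prod_cases3)
    obtain f' c' d' where e': "y = (f', c', d')" by (metis prod_cases3)
    have f: "f \<in> loops (degrees k \<inter> nonneg_in k)" "f' \<in> loops (degrees k \<inter> nonneg_in k)" "f \<in> loops (degrees k)"
      using x y loops_mono[of "degrees k \<inter> nonneg_in k" "degrees k"] unfolding e e' by (auto simp: carrier_ghat_plus)
    have "lb f f' \<in> loops (degrees k \<inter> nonneg_in k)"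
      by (rule lb_loops[OF f(1,2)]) (use degrees_add in \<open>auto simp: nonneg_in_def lookup_add\<close>)
    then show "lbracket (ghat g B k) x y \<in> carrier (ghat_plus g B k)"
      using f co_keys[OF f(3)] da_loops
      by (simp add: e e' affine_bracket_eq carrier_ghat_plus loops_add loops_diff)
  qed
qed

text \<open>The extension of a module from level \<open>k - 1\<close> is the pull-back along this map, twisted by the
  value of the central element \<open>c\<^sub>k\<close>.\<close>

definition top_part :: "nat \<Rightarrow> 'g affine \<Rightarrow> 'g affine" where
  "top_part k = (\<lambda>(f, c, d). (restrict_degrees (zero_in k) f, Poly_Mapping.update k 0 c, Poly_Mapping.update k 0 d))"

definition central_part :: "nat \<Rightarrow> 'g affine \<Rightarrow> complex" where
  "central_part k = (\<lambda>(f, c, d). lk c k)"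

lemma extend_to_plus_simps [simp]:
  "carrier (extend_to_plus k a M) = carrier M" "\<zero>\<^bsub>extend_to_plus k a M\<^esub> = \<zero>\<^bsub>M\<^esub>"
  "m \<oplus>\<^bsub>extend_to_plus k a M\<^esub> n = m \<oplus>\<^bsub>M\<^esub> n" "b \<odot>\<^bsub>extend_to_plus k a M\<^esub> m = b \<odot>\<^bsub>M\<^esub> m"
  by (simp_all add: extend_to_plus_def)

lemma extend_to_plus_action:
  "action (extend_to_plus k a M) y m = action M (top_part k y) m \<oplus>\<^bsub>M\<^esub> (a * central_part k y) \<odot>\<^bsub>M\<^esub> m"
  by (simp add: extend_to_plus_def top_part_def central_part_def restrict_degrees_def zero_in_def split: prod.split)

lemma update_add: "Poly_Mapping.update k 0 (c + c') = Poly_Mapping.update k 0 c + Poly_Mapping.update k (0::complex) c'"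
  by (rule poly_mapping_eqI) (simp add: lookup_update lookup_add)

lemma update_scale: "Poly_Mapping.update k 0 (Poly_Mapping.map ((*) a) c) = Poly_Mapping.map ((*) a) (Poly_Mapping.update k (0::complex) c)"
  by (rule poly_mapping_eqI) (simp add: lookup_update lookup_pmap)

lemma update_keys: "kys c \<subseteq> {1..Suc k} \<Longrightarrow> kys (Poly_Mapping.update (Suc k) (0::complex) c) \<subseteq> {1..k}"
proof
  fix i assume "kys c \<subseteq> {1..Suc k}" "i \<in> kys (Poly_Mapping.update (Suc k) 0 c)"
  then have "i \<noteq> Suc k" "i \<in> {1..Suc k}" by (auto simp: in_keys_iff lookup_update split: if_splits)
  then show "i \<in> {1..k}" by simp
qed

lemma top_part_add: "top_part k (x + y) = top_part k x + top_part k y"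
  by (cases x; cases y) (simp add: top_part_def restrict_add update_add)

lemma top_part_scale: "top_part k (affine_scale g a x) = affine_scale g a (top_part k x)"
  by (cases x) (simp add: top_part_def affine_scale_def restrict_sc update_scale)

lemma top_part_closed: "x \<in> carrier (ghat_plus g B (Suc k)) \<Longrightarrow> top_part (Suc k) x \<in> carrier (ghat g B k)"
proof -
  assume x: "x \<in> carrier (ghat_plus g B (Suc k))"
  obtain f c d where e: "x = (f, c, d)" by (metis prod_cases3)
  have "f \<in> loops (degrees (Suc k))"
    using x loops_mono[of "degrees (Suc k) \<inter> nonneg_in (Suc k)" "degrees (Suc k)"] by (auto simp: e carrier_ghat_plus)
  then show ?thesis using x restrict_loops[of f "degrees (Suc k)" "zero_in (Suc k)"]
    unfolding e top_part_def using update_keys[of c k] update_keys[of d k]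
    by (simp add: carrier_ghat carrier_ghat_plus degrees_Suc)
qed

lemma central_part_simps:
  "central_part k (x + y) = central_part k x + central_part k y"
  "central_part k (affine_scale g a x) = a * central_part k x"
  by (cases x; cases y; simp add: central_part_def lookup_add affine_scale_def lookup_pmap)+

lemma d_weight_update:
  assumes "lk n k = 0"
  shows "d_weight (Poly_Mapping.update k 0 d) n = d_weight d n"
proof -
  have "kys (Poly_Mapping.update k 0 d) \<subseteq> kys d" by (auto simp: in_keys_iff lookup_update split: if_splits)
  then have "d_weight (Poly_Mapping.update k 0 d) n
      = (\<Sum>i\<in>kys d. lk (Poly_Mapping.update k 0 d) i * of_int (lk n i))"
    by (rule d_weight_superset[OF finite_keys])
  also have "\<dots> = d_weight d n" unfolding d_weight_def
    by (rule sum.cong) (use assms in \<open>auto simp: lookup_update\<close>)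
  finally show ?thesis .
qed

text \<open>Degrees that are nonnegative in \<open>t\<^sub>k\<close> add up to zero only if both are zero. Hence passing to the part
  of degree zero respects the brackets on the nonnegative part, and no multiple of \<open>c\<^sub>k\<close> arises.\<close>

lemma restrict_lb:
  assumes "f \<in> loops (nonneg_in k)" "h \<in> loops (nonneg_in k)"
  shows "restrict_degrees (zero_in k) (lb f h) = lb (restrict_degrees (zero_in k) f) (restrict_degrees (zero_in k) h)"
  using assms(1)
proof (induction rule: loops_induct)
  case (single_add f n x)
  let ?r = "restrict_degrees (zero_in k)"
  have rU: "u \<in> loops K \<Longrightarrow> ?r u \<in> loops UNIV" for u K using restrict_loops loops_UNIV by blast
  have sU: "x \<in> carrier g \<Longrightarrow> sgl n x \<in> loops UNIV" for n x by (simp add: loops_single)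
  have "?r (lb (sgl n x) h) = lb (?r (sgl n x)) (?r h)" using assms(2)
  proof (induction rule: loops_induct)
    case (single_add h m y)
    have "n + m \<in> zero_in k \<longleftrightarrow> n \<in> zero_in k \<and> m \<in> zero_in k"
      using single_add \<open>n \<in> nonneg_in k\<close> by (auto simp: zero_in_def nonneg_in_def lookup_add)
    then have "?r (lb (sgl n x) (sgl m y)) = lb (?r (sgl n x)) (?r (sgl m y))"
      using single_add \<open>x \<in> carrier g\<close> by (simp add: lb_single restrict_single)
    moreover have "?r (lb (sgl n x) (sgl m y + h)) = ?r (lb (sgl n x) (sgl m y)) + ?r (lb (sgl n x) h)"
      using single_add \<open>x \<in> carrier g\<close> loops_UNIV by (simp add: lb_add_right sU restrict_add)
    moreover have "lb (?r (sgl n x)) (?r (sgl m y + h)) = lb (?r (sgl n x)) (?r (sgl m y)) + lb (?r (sgl n x)) (?r h)"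
      unfolding restrict_add
      by (rule lb_add_right) (use rU sU single_add \<open>x \<in> carrier g\<close> in blast)+
    ultimately show ?case using single_add by simp
  qed simp
  moreover have "?r (lb (sgl n x + f) h) = ?r (lb (sgl n x) h) + ?r (lb f h)"
    using single_add assms(2) loops_UNIV by (simp add: lb_add_left sU restrict_add)
  moreover have "lb (?r (sgl n x + f)) (?r h) = lb (?r (sgl n x)) (?r h) + lb (?r f) (?r h)"
    unfolding restrict_add by (rule lb_add_left) (use rU sU single_add assms(2) in blast)+
  ultimately show ?case using single_add by simp
qed simp

lemma restrict_co:
  assumes f: "f \<in> loops (nonneg_in k)" and h: "h \<in> loops (nonneg_in k)"
  shows "lk (co f h) k = 0"
    and "Poly_Mapping.update k 0 (co f h) = co (restrict_degrees (zero_in k) f) (restrict_degrees (zero_in k) h)"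
proof -
  let ?r = "restrict_degrees (zero_in k)"
  note hU = loops_UNIV[OF h]
  have rU: "?r h \<in> loops UNIV" using restrict_loops[OF h] loops_UNIV by blast
  have kr: "kys (?r f) \<subseteq> kys f" by (auto simp: in_keys_iff restrict_lookup split: if_splits)
  have z: "lk h (- n) = 0" if "n \<in> kys f" "n \<notin> zero_in k" for n
  proof -
    have "- n \<notin> nonneg_in k" using that(2) loopsD(2)[OF f that(1)] by (auto simp: nonneg_in_def zero_in_def)
    then show ?thesis using loopsD(2)[OF h] by (auto simp: in_keys_iff)
  qed
  have zi: "- n \<in> zero_in k \<longleftrightarrow> n \<in> zero_in k" for n by (simp add: zero_in_def)
  have term_zero: "of_int (lk n k) * B (lk f n) (lk h (- n)) = 0" if "n \<in> kys f" for n
    using z[OF that] loopsD(1)[OF f] by (cases "n \<in> zero_in k") (auto simp: zero_in_def form_zero')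
  show k0: "lk (co f h) k = 0"
    unfolding co_lookup by (rule sum.neutral) (use term_zero in blast)
  have eq: "lk (co (?r f) (?r h)) i = lk (co f h) i" for i
  proof -
    have "lk (co (?r f) (?r h)) i = (\<Sum>n\<in>kys f. of_int (lk n i) * B (lk (?r f) n) (lk (?r h) (- n)))"
      by (rule co_superset[OF finite_keys kr rU])
    also have "\<dots> = lk (co f h) i" unfolding co_lookup
      by (rule sum.cong) (use z loopsD(1)[OF f] in \<open>auto simp: restrict_lookup zi form_zero' carrier_zero\<close>)
    finally show ?thesis .
  qed
  show "Poly_Mapping.update k 0 (co f h) = co (?r f) (?r h)"
    by (rule poly_mapping_eqI) (auto simp: lookup_update eq k0)
qed

lemma top_part_bracket:
  assumes "x \<in> carrier (ghat_plus g B k)" "y \<in> carrier (ghat_plus g B k)"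
  shows "top_part k (affine_bracket g B x y) = affine_bracket g B (top_part k x) (top_part k y)"
    and "central_part k (affine_bracket g B x y) = 0"
proof -
  obtain f c d where e: "x = (f, c, d)" by (metis prod_cases3)
  obtain f' c' d' where e': "y = (f', c', d')" by (metis prod_cases3)
  have f: "f \<in> loops (nonneg_in k)" "f' \<in> loops (nonneg_in k)"
    using assms loops_mono[of "degrees k \<inter> nonneg_in k" "nonneg_in k"] unfolding e e' by (auto simp: carrier_ghat_plus)
  let ?r = "restrict_degrees (zero_in k)"
  have r_diff: "?r (u - v) = ?r u - ?r v" for u v using restrict_add[of "zero_in k" "u - v" v] by simp
  have da: "?r (da d u) = da (Poly_Mapping.update k 0 d) (?r u)" for d u
    by (rule poly_mapping_eqI) (auto simp: restrict_lookup da_lookup d_weight_update zero_in_def)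
  have u0: "Poly_Mapping.update k 0 (0 :: nat \<Rightarrow>\<^sub>0 complex) = 0"
    by (rule poly_mapping_eqI) (simp add: lookup_update)
  show "top_part k (affine_bracket g B x y) = affine_bracket g B (top_part k x) (top_part k y)"
    by (simp add: e e' top_part_def affine_bracket_eq restrict_lb[OF f] restrict_co(2)[OF f] r_diff restrict_add da u0)
  show "central_part k (affine_bracket g B x y) = 0"
    by (simp add: e e' central_part_def affine_bracket_eq restrict_co(1)[OF f])
qed

lemma extend_to_plus_lie_module:
  assumes "lie_module (ghat g B k) M"
  shows "lie_module (ghat_plus g B (Suc k)) (extend_to_plus (Suc k) a M)"
proof -
  interpret M: lie_module "ghat g B k" M by fact
  interpret P: lie_algebra "ghat_plus g B (Suc k)" by (rule ghat_plus_lie_algebra)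
  note cl = top_part_closed
  note ac = M.action_closed[OF cl]
  show ?thesis
  proof (rule lie_moduleI[OF ghat_plus_lie_algebra])
    fix x y m n b
    assume "x \<in> carrier (ghat_plus g B (Suc k))"
    note x = this cl[OF this] ac[OF this]
    assume "m \<in> carrier (extend_to_plus (Suc k) a M)"
    then have m: "m \<in> carrier M" by simp
    show "action (extend_to_plus (Suc k) a M) x m \<in> carrier (extend_to_plus (Suc k) a M)"
      using x m by (simp add: extend_to_plus_action)
    show "action (extend_to_plus (Suc k) a M) x (b \<odot>\<^bsub>extend_to_plus (Suc k) a M\<^esub> m)
      = b \<odot>\<^bsub>extend_to_plus (Suc k) a M\<^esub> action (extend_to_plus (Suc k) a M) x m"
      using x m by (simp add: extend_to_plus_action M.action_smult M.msimps(2) M.msimps(3)[symmetric] mult.commute)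
    show "action (extend_to_plus (Suc k) a M) (lscale (ghat_plus g B (Suc k)) b x) m
      = b \<odot>\<^bsub>extend_to_plus (Suc k) a M\<^esub> action (extend_to_plus (Suc k) a M) x m"
      using x m M.scale_action[OF x(2) m, of b]
      by (simp add: extend_to_plus_action top_part_scale central_part_simps M.msimps(2) M.msimps(3)[symmetric] mult.left_commute)
    show "action (extend_to_plus (Suc k) a M) x (m \<oplus>\<^bsub>extend_to_plus (Suc k) a M\<^esub> n)
      = action (extend_to_plus (Suc k) a M) x m \<oplus>\<^bsub>extend_to_plus (Suc k) a M\<^esub> action (extend_to_plus (Suc k) a M) x n"
      if "n \<in> carrier (extend_to_plus (Suc k) a M)"
      using x m that by (simp add: extend_to_plus_action M.action_add M.msimps(2) M.M.a_ac)
    assume "y \<in> carrier (ghat_plus g B (Suc k))"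
    note y = this cl[OF this] ac[OF this]
    show "action (extend_to_plus (Suc k) a M) (x + y) m
      = action (extend_to_plus (Suc k) a M) x m \<oplus>\<^bsub>extend_to_plus (Suc k) a M\<^esub> action (extend_to_plus (Suc k) a M) y m"
      using x y m by (simp add: extend_to_plus_action top_part_add central_part_simps M.add_action distrib_left
          M.msimps(1) M.M.a_ac)
    have b: "action M (affine_bracket g B (top_part (Suc k) x) (top_part (Suc k) y)) m
        \<oplus>\<^bsub>M\<^esub> action M (top_part (Suc k) y) (action M (top_part (Suc k) x) m)
      = action M (top_part (Suc k) x) (action M (top_part (Suc k) y) m)"
      using M.bracket_action'[OF x(2) y(2) m] by simp
    have bc: "action M (affine_bracket g B (top_part (Suc k) x) (top_part (Suc k) y)) m \<in> carrier M"
      using M.action_closed[OF M.bracket_closed[OF x(2) y(2)] m] by simp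
    show "action (extend_to_plus (Suc k) a M) (lbracket (ghat_plus g B (Suc k)) x y) m
      \<oplus>\<^bsub>extend_to_plus (Suc k) a M\<^esub> action (extend_to_plus (Suc k) a M) y (action (extend_to_plus (Suc k) a M) x m)
      = action (extend_to_plus (Suc k) a M) x (action (extend_to_plus (Suc k) a M) y m)"
      using x y m bc
      by (simp add: extend_to_plus_action top_part_bracket[OF x(1) y(1)] M.action_add M.action_smult M.msimps(2)
          M.msimps(5) M.msimps(3)[symmetric] mult.commute b[symmetric] M.M.a_ac)
  qed (auto simp: M.msimps M.M.a_ac)
qed

definition negative_part :: "nat \<Rightarrow> 'g affine set" where
  "negative_part k = {(f, 0, 0) | f. f \<in> loops (degrees k \<inter> neg_in k)}"

definition negative_proj :: "nat \<Rightarrow> 'g affine \<Rightarrow> 'g affine" where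
  "negative_proj k = (\<lambda>(f, c, d). (restrict_degrees (neg_in k) f, 0, 0))"

definition negative_homogeneous :: "nat \<Rightarrow> nat \<Rightarrow> 'g affine set" where
  "negative_homogeneous k e = {(sgl n x, 0, 0) | n x. n \<in> degrees k \<and> lk n k = - int (Suc e) \<and> x \<in> carrier g}"

definition degree_derivation :: "nat \<Rightarrow> 'g affine" where
  "degree_derivation i = (0, 0, Poly_Mapping.single i 1)"

text \<open>The complement of the nonnegative part consists of the loops of negative degree in \<open>t\<^sub>k\<close>. It is a
  subalgebra, as the cocycle vanishes on degrees of equal sign, and it is graded by \<open>d\<^sub>k\<close>.\<close>

lemma graded:
  fixes M :: "('g affine, ('g affine uea, 'v) elt) lie_rep"
  assumes "lie_module (ghat g B k) M"
  shows "graded_extension (ghat g B (Suc k)) (ghat_plus g B (Suc k)) (extend_to_plus (Suc k) a M)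
    (negative_part (Suc k)) (negative_proj (Suc k)) (degree_derivation (Suc k)) (negative_homogeneous (Suc k))"
proof -
  let ?K = "Suc k"
  let ?P = "ghat_plus g B ?K"
  interpret M0: lie_module "ghat g B k" M by fact
  interpret L: lie_algebra "ghat g B ?K" by (rule affine_lie_algebra)
  interpret M: lie_module ?P "extend_to_plus ?K a M" by (rule extend_to_plus_lie_module[OF assms])
  have neg_mono: "f \<in> loops (degrees ?K \<inter> neg_in ?K) \<Longrightarrow> f \<in> loops K" if "degrees ?K \<inter> neg_in ?K \<subseteq> K" for f K
    by (rule loops_mono[OF that])
  show ?thesis
  proof
    show "carrier ?P \<subseteq> carrier (ghat g B ?K)" by (rule ghat_plus_sub)
    show "lscale ?P = lscale (ghat g B ?K)" "lbracket ?P = lbracket (ghat g B ?K)" by simp_all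
    show "negative_part ?K \<subseteq> carrier (ghat g B ?K)"
      using neg_mono[of "degrees ?K"] by (auto simp: negative_part_def carrier_ghat)
  next
    fix x y assume "x \<in> negative_part ?K" "y \<in> negative_part ?K"
    then obtain f h where e: "x = (f, 0, 0)" "y = (h, 0, 0)"
      and f: "f \<in> loops (degrees ?K \<inter> neg_in ?K)" and h: "h \<in> loops (degrees ?K \<inter> neg_in ?K)"
      by (auto simp: negative_part_def)
    have "lb f h \<in> loops (degrees ?K \<inter> neg_in ?K)"
      by (rule lb_loops[OF f h]) (use degrees_add in \<open>auto simp: neg_in_def lookup_add\<close>)
    moreover have "co f h = 0"
    proof (rule poly_mapping_eqI)
      fix i
      have "lk h (- n) = 0" if "n \<in> kys f" for n
        using loopsD(2)[OF f that] loopsD(2)[OF h, of "- n"] by (auto simp: neg_in_def in_keys_iff)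
      then show "lk (co f h) i = lk 0 i" using loopsD(1)[OF f] by (simp add: co_lookup form_zero')
    qed
    ultimately show "lbracket (ghat g B ?K) x y \<in> negative_part ?K"
      by (simp add: e affine_bracket_eq negative_part_def)
  next
    fix x assume x: "x \<in> carrier (ghat g B ?K)"
    obtain f c d where e: "x = (f, c, d)" by (metis prod_cases3)
    have f: "f \<in> loops (degrees ?K)" using x by (simp add: e carrier_ghat)
    show "negative_proj ?K x \<in> negative_part ?K"
      using restrict_loops[OF f] by (simp add: e negative_proj_def negative_part_def)
    have "f - restrict_degrees (neg_in ?K) f = restrict_degrees (nonneg_in ?K) f"
      by (rule poly_mapping_eqI) (auto simp: restrict_lookup lookup_minus neg_in_def nonneg_in_def)
    then show "x - negative_proj ?K x \<in> carrier ?P"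
      using x restrict_loops[OF f] by (simp add: e negative_proj_def carrier_ghat_plus carrier_ghat)
  next
    fix x assume "x \<in> negative_part ?K"
    then show "negative_proj ?K x = x"
      using neg_mono[of "neg_in ?K"] by (auto simp: negative_part_def negative_proj_def restrict_id)
  next
    fix x assume x: "x \<in> carrier ?P"
    obtain f c d where e: "x = (f, c, d)" by (metis prod_cases3)
    have f: "f \<in> loops (degrees ?K \<inter> nonneg_in ?K)" using x by (simp add: e carrier_ghat_plus)
    have "restrict_degrees (neg_in ?K) f = 0"
      by (rule poly_mapping_eqI)
        (use loops_outside[OF f] in \<open>auto simp: restrict_lookup neg_in_def nonneg_in_def\<close>)
    then show "negative_proj ?K x = 0" by (simp add: e negative_proj_def zero_prod_def)
  next
    fix x y :: "'g affine" and b
    show "negative_proj ?K (lscale (ghat g B ?K) b x + y) = lscale (ghat g B ?K) b (negative_proj ?K x) + negative_proj ?K y"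
      by (cases x; cases y)
        (simp add: negative_proj_def affine_scale_def restrict_add restrict_sc poly_mapping_eqI lookup_pmap)
  next
    show "degree_derivation ?K \<in> carrier ?P"
      by (simp add: degree_derivation_def carrier_ghat_plus loops_zero)
  next
    fix m assume "m \<in> carrier (extend_to_plus ?K a M)"
    then have m: "m \<in> carrier M" by simp
    have "top_part ?K (degree_derivation ?K) = 0"
      by (auto intro!: poly_mapping_eqI simp: top_part_def degree_derivation_def zero_prod_def lookup_update lookup_single when_def)
    then show "action (extend_to_plus ?K a M) (degree_derivation ?K) m = \<zero>\<^bsub>extend_to_plus ?K a M\<^esub>"
      using m by (simp add: extend_to_plus_action central_part_def degree_derivation_def M0.msimps)
  next
    fix x e assume "x \<in> negative_homogeneous ?K e"
    then obtain n y where x: "x = (sgl n y, 0, 0)" "n \<in> degrees ?K" "lk n ?K = - int (Suc e)" "y \<in> carrier g"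
      by (auto simp: negative_homogeneous_def)
    show "x \<in> negative_part ?K" using x by (auto simp: negative_part_def neg_in_def intro!: loops_single)
    show "lbracket (ghat g B ?K) (degree_derivation ?K) x = lscale (ghat g B ?K) (- of_nat (Suc e)) x"
    proof -
      have z: "Poly_Mapping.map ((*) b) 0 = (0 :: nat \<Rightarrow>\<^sub>0 complex)" for b :: complex
        by (rule poly_mapping_eqI) (simp add: lookup_pmap)
      have "lscale g (of_int (lk n ?K)) y = lscale g (- of_nat (Suc e)) y" unfolding x(3) by simp
      then show ?thesis
        unfolding degree_derivation_def x(1) ghat_simps affine_bracket_d_loop[OF lie_algebra_axioms x(4)]
        by (simp only: affine_scale_def prod.case sc_single z)
    qed
  next
    fix Q :: "'g affine set"
    assume Q: "0 \<in> Q" "\<And>x y. x \<in> Q \<Longrightarrow> y \<in> Q \<Longrightarrow> x + y \<in> Q" "\<And>e. negative_homogeneous ?K e \<subseteq> Q"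
    show "negative_part ?K \<subseteq> Q"
    proof
      fix x assume "x \<in> negative_part ?K"
      then obtain f where x: "x = (f, 0, 0)" "f \<in> loops (degrees ?K \<inter> neg_in ?K)" by (auto simp: negative_part_def)
      have "(f, 0, 0) \<in> Q" using x(2)
      proof (induction rule: loops_induct)
        case zero
        then show ?case using Q(1) by (simp add: zero_prod_def)
      next
        case (single_add f n y)
        have "lk n ?K = - int (Suc (nat (- lk n ?K) - 1))" using single_add(2) by (auto simp: neg_in_def)
        then have "(sgl n y, 0, 0) \<in> negative_homogeneous ?K (nat (- lk n ?K) - 1)"
          using single_add by (auto simp: negative_homogeneous_def)
        then have "(sgl n y, 0, 0) \<in> Q" using Q(3) by blast
        from Q(2)[OF this single_add.IH] show ?case by simp
      qed
      then show "x \<in> Q" using x by simp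
    qed
  qed
qed

end

section \<open>The modules \<open>E\<close> and their irreducible quotients\<close>

lemma top_componentI:
  assumes "lie_module L M" "H \<subseteq> carrier L" "D \<subseteq> carrier L" "stable_subspace M H V0" "V0 \<noteq> {\<zero>\<^bsub>M\<^esub>}"
    and "\<And>W. stable_subspace M H W \<Longrightarrow> W \<subseteq> V0 \<Longrightarrow> W = {\<zero>\<^bsub>M\<^esub>} \<or> W = V0"
    and "\<And>W. stable_subspace M (carrier L) W \<Longrightarrow> V0 \<subseteq> W \<Longrightarrow> W = carrier M"
    and "\<And>m. m \<in> carrier M \<Longrightarrow> \<pi> m \<in> V0"
    and "\<And>m n. m \<in> carrier M \<Longrightarrow> n \<in> carrier M \<Longrightarrow> \<pi> (m \<oplus>\<^bsub>M\<^esub> n) = \<pi> m \<oplus>\<^bsub>M\<^esub> \<pi> n"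
    and "\<And>m. m \<in> V0 \<Longrightarrow> \<pi> m = m"
    and "\<And>W m. stable_subspace M D W \<Longrightarrow> m \<in> W \<Longrightarrow> \<pi> m \<in> W"
  shows "top_component L M H D V0 \<pi>"
  by (intro top_component.intro top_component_axioms.intro) (fact assms)+

context affine_algebra
begin

definition constant_loops :: "'g affine set" where
  "constant_loops = {(sgl 0 x, 0, 0) | x. x \<in> carrier g}"

definition degree_derivations :: "nat \<Rightarrow> 'g affine set" where
  "degree_derivations k = degree_derivation ` {1..k}"

text \<open>The top component of every \<open>E\<close> is a copy of \<open>V(\<Lambda>)\<close>, irreducible under \<open>g\<close>, and it is split off by
  the derivations \<open>d\<^sub>1\<close>, \<dots>, \<open>d\<^sub>k\<close>.\<close>

definition has_top :: "nat \<Rightarrow> ('g affine, 'e) lie_rep \<Rightarrow> bool" where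
  "has_top k M \<longleftrightarrow> (\<exists>V0 \<pi>. top_component (ghat g B k) M constant_loops (degree_derivations k) V0 \<pi>)"

lemma has_top_lie_module: "has_top k M \<Longrightarrow> lie_module (ghat g B k) M"
  unfolding has_top_def top_component_def by blast

lemma degree_derivations_Suc:
  "degree_derivations (Suc k) = insert (degree_derivation (Suc k)) (degree_derivations k)"
  by (simp add: degree_derivations_def atLeastAtMostSuc_conv)

lemma ghat_in_plus:
  assumes "x \<in> carrier (ghat g B k)"
  shows "x \<in> carrier (ghat_plus g B (Suc k))" "top_part (Suc k) x = x" "central_part (Suc k) x = 0"
proof -
  obtain f c d where e: "x = (f, c, d)" by (metis prod_cases3)
  have f: "f \<in> loops (degrees k)" and c: "kys c \<subseteq> {1..k}" "kys d \<subseteq> {1..k}"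
    using assms by (auto simp: e carrier_ghat)
  have "f \<in> loops (degrees (Suc k) \<inter> nonneg_in (Suc k))"
  proof (rule loops_mono[OF _ f], rule subsetI)
    fix n assume "n \<in> degrees k"
    then have "n \<in> degrees (Suc k) \<inter> zero_in (Suc k)" unfolding degrees_Suc .
    then show "n \<in> degrees (Suc k) \<inter> nonneg_in (Suc k)" by (simp add: zero_in_def nonneg_in_def)
  qed
  moreover have "{1..k} \<subseteq> {1..Suc k}" by auto
  ultimately show "x \<in> carrier (ghat_plus g B (Suc k))"
    using c by (simp only: e carrier_ghat_plus) blast
  have z: "lk c (Suc k) = 0" "lk d (Suc k) = 0" using c by (auto simp: in_keys_iff)
  have u: "Poly_Mapping.update (Suc k) 0 b = b" if "lk b (Suc k) = 0" for b :: "nat \<Rightarrow>\<^sub>0 complex"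
    by (rule poly_mapping_eqI) (use that in \<open>auto simp: lookup_update\<close>)
  have "f \<in> loops (zero_in (Suc k))" by (rule loops_mono[OF _ f]) (use degrees_Suc[of k] in blast)
  then show "top_part (Suc k) x = x" "central_part (Suc k) x = 0"
    using z by (simp_all add: e top_part_def central_part_def restrict_id u)
qed

lemma extend_to_plus_action_ghat:
  assumes "lie_module (ghat g B k) M" "x \<in> carrier (ghat g B k)" "m \<in> carrier M"
  shows "action (extend_to_plus (Suc k) a M) x m = action M x m"
proof -
  interpret M: lie_module "ghat g B k" M by fact
  show ?thesis using M.action_closed[OF assms(2,3)] assms(3)
    by (simp add: extend_to_plus_action ghat_in_plus[OF assms(2)] M.msimps)
qed

lemma stable_extend_iff:
  assumes M: "lie_module (ghat g B k) M" and S: "S \<subseteq> carrier (ghat g B k)"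
  shows "stable_subspace (extend_to_plus (Suc k) a M) S W \<longleftrightarrow> stable_subspace M S W"
  using extend_to_plus_action_ghat[OF M subsetD[OF S]]
  by (auto simp: stable_subspace_def linear_subspace_def subset_iff)

text \<open>Elements of the algebra of level \<open>k\<close> act on the extension of \<open>M\<close> to the nonnegative part as they do
  on \<open>M\<close>, so the top component of \<open>M\<close> is also one over the nonnegative part, and passes to the induced
  module.\<close>

lemma induced_has_top:
  fixes M :: "('g affine, ('g affine uea, 'v) elt) lie_rep"
  assumes "has_top k M"
  shows "has_top (Suc k) (induced_module g B (Suc k) a M)"
proof -
  obtain V0 \<pi> where T: "top_component (ghat g B k) M constant_loops (degree_derivations k) V0 \<pi>"
    using assms by (auto simp: has_top_def)
  interpret T: top_component "ghat g B k" M constant_loops "degree_derivations k" V0 \<pi> by (rule T)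
  note M = T.lie_module_axioms
  let ?M = "extend_to_plus (Suc k) a M"
  interpret G: graded_extension "ghat g B (Suc k)" "ghat_plus g B (Suc k)" ?M "negative_part (Suc k)"
    "negative_proj (Suc k)" "degree_derivation (Suc k)" "negative_homogeneous (Suc k)"
    by (rule graded[OF M])
  have sub: "carrier (ghat g B k) \<subseteq> carrier (ghat_plus g B (Suc k))" using ghat_in_plus by blast
  note iff = stable_extend_iff[OF M]
  have "top_component (ghat_plus g B (Suc k)) ?M constant_loops (degree_derivations k) V0 \<pi>"
  proof (rule top_componentI)
    show "lie_module (ghat_plus g B (Suc k)) ?M" by (rule G.M.lie_module_axioms)
    show "constant_loops \<subseteq> carrier (ghat_plus g B (Suc k))" using T.H sub by blast
    show "degree_derivations k \<subseteq> carrier (ghat_plus g B (Suc k))" using T.D sub by blast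
    show "stable_subspace ?M constant_loops V0" using T.V0_stable iff[OF T.H] by blast
    show "V0 \<noteq> {\<zero>\<^bsub>?M\<^esub>}" using T.V0_nonzero by simp
    show "W = {\<zero>\<^bsub>?M\<^esub>} \<or> W = V0" if "stable_subspace ?M constant_loops W" "W \<subseteq> V0" for W
      using T.V0_irreducible that iff[OF T.H] by simp
    show "W = carrier ?M" if W: "stable_subspace ?M (carrier (ghat_plus g B (Suc k))) W" "V0 \<subseteq> W" for W
    proof -
      have "stable_subspace ?M (carrier (ghat g B k)) W" using W(1) sub by (auto simp: stable_subspace_def)
      then show ?thesis using T.V0_generates[OF _ W(2)] iff[OF subset_refl] by simp
    qed
    show "\<pi> m \<in> W" if "stable_subspace ?M (degree_derivations k) W" "m \<in> W" for W m
      using T.\<pi>_stable that iff[OF T.D] by blast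
  qed (simp_all add: T.\<pi>_V0 T.\<pi>_add T.\<pi>_id)
  from G.extended_top_component[OF this] show ?thesis
    unfolding has_top_def induced_module_def degree_derivations_Suc by blast
qed

lemma induced_hom:
  fixes M M' :: "('g affine, ('g affine uea, 'v) elt) lie_rep"
  assumes M: "lie_module (ghat g B k) M" and M': "lie_module (ghat g B k) M'"
    and \<psi>: "lie_hom (ghat g B k) M M' \<psi>" and surj: "carrier M' = \<psi> ` carrier M"
  shows "\<exists>\<chi>. lie_hom (ghat g B (Suc k)) (induced_module g B (Suc k) a M) (induced_module g B (Suc k) a M') \<chi> \<and>
    carrier (induced_module g B (Suc k) a M') = \<chi> ` carrier (induced_module g B (Suc k) a M)"
  unfolding induced_module_def
proof (rule extend_scalars_hom)
  show "scalar_extension (ghat g B (Suc k)) (ghat_plus g B (Suc k)) (extend_to_plus (Suc k) a M)"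
    using graded[OF M, of a] by (simp add: graded_extension_def split_extension_def)
  show "scalar_extension (ghat g B (Suc k)) (ghat_plus g B (Suc k)) (extend_to_plus (Suc k) a M')"
    using graded[OF M', of a] by (simp add: graded_extension_def split_extension_def)
  show "carrier (extend_to_plus (Suc k) a M') = \<psi> ` carrier (extend_to_plus (Suc k) a M)" using surj by simp
  interpret M: lie_module "ghat g B k" M by (rule M)
  note h = lie_homD[OF \<psi>]
  show "lie_hom (ghat_plus g B (Suc k)) (extend_to_plus (Suc k) a M) (extend_to_plus (Suc k) a M') \<psi>"
    unfolding lie_hom_def using h top_part_closed M.action_closed
    by (auto simp: extend_to_plus_action)
qed

lemma ghat_zero:
  "(f, c, d) \<in> carrier (ghat g B 0) \<longleftrightarrow> f \<in> loops {0} \<and> c = 0 \<and> d = 0"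
proof -
  have "degrees 0 = {0}" by (auto simp: degrees_def)
  then show ?thesis by (simp add: carrier_ghat)
qed

text \<open>At level zero there are no derivations; the module is its own top.\<close>

lemma level_zero_has_top:
  fixes V :: "('g, 'v) lie_rep"
  assumes irr: "irreducible_lie_module g V"
  shows "has_top 0 (level_zero_module V :: ('g affine, ('u, 'v) elt) lie_rep)"
proof -
  have V: "lie_module g V" and nz: "carrier V \<noteq> {\<zero>\<^bsub>V\<^esub>}"
    and sub: "\<And>W. stable_subspace V (carrier g) W \<Longrightarrow> W = {\<zero>\<^bsub>V\<^esub>} \<or> W = carrier V"
    using irr by (auto simp: irreducible_lie_module_def lie_module.lie_submodule_iff)
  interpret V: lie_module g V by (rule V)
  let ?M = "level_zero_module V :: ('g affine, ('u, 'v) elt) lie_rep"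
  have simps: "carrier ?M = Base ` carrier V" "\<zero>\<^bsub>?M\<^esub> = Base \<zero>\<^bsub>V\<^esub>"
    "Base v \<oplus>\<^bsub>?M\<^esub> Base w = Base (v \<oplus>\<^bsub>V\<^esub> w)" "b \<odot>\<^bsub>?M\<^esub> Base v = Base (b \<odot>\<^bsub>V\<^esub> v)"
    "action ?M (f, c, d) (Base v) = Base (action V (lk f 0) v)" for v w b f c d
    by (simp_all add: level_zero_module_def)
  have lb0: "lk (lb f h) 0 = lbracket g (lk f 0) (lk h 0)" if "f \<in> loops {0}" "h \<in> loops {0}" for f h
    using that lb_superset[OF loops_UNIV loops_UNIV, of f "{0}" h "{0}" "{0}" "{0}"] by (simp add: loops_def lookup_single)
  have lc: "lk f 0 \<in> carrier g" if "f \<in> loops {0}" for f using loopsD(1)[OF that] .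
  have M: "lie_module (ghat g B 0) ?M"
  proof (rule lie_moduleI[OF affine_lie_algebra])
    fix x y m n b
    assume x: "x \<in> carrier (ghat g B 0)" and m: "m \<in> carrier ?M"
    obtain f where f: "x = (f, 0, 0)" "f \<in> loops {0}" using x by (metis ghat_zero prod_cases3)
    obtain v where v: "m = Base v" "v \<in> carrier V" using m by (auto simp: simps)
    show "action ?M x m \<in> carrier ?M" using lc[OF f(2)] v by (simp add: f v simps V.action_closed)
    show "action ?M x (b \<odot>\<^bsub>?M\<^esub> m) = b \<odot>\<^bsub>?M\<^esub> action ?M x m"
      using lc[OF f(2)] v by (simp add: f v simps V.action_smult)
    show "action ?M (lscale (ghat g B 0) b x) m = b \<odot>\<^bsub>?M\<^esub> action ?M x m"
      using lc[OF f(2)] v by (simp add: f v simps affine_scale_def lookup_sc V.scale_action)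
    show "action ?M x (m \<oplus>\<^bsub>?M\<^esub> n) = action ?M x m \<oplus>\<^bsub>?M\<^esub> action ?M x n" if n: "n \<in> carrier ?M"
    proof -
      obtain w where w: "n = Base w" "w \<in> carrier V" using n by (auto simp: simps)
      show ?thesis using lc[OF f(2)] v w by (simp add: f v w simps V.action_add)
    qed
    assume y: "y \<in> carrier (ghat g B 0)"
    obtain h where h: "y = (h, 0, 0)" "h \<in> loops {0}" using y by (metis ghat_zero prod_cases3)
    show "action ?M (x + y) m = action ?M x m \<oplus>\<^bsub>?M\<^esub> action ?M y m"
      using lc[OF f(2)] lc[OF h(2)] v by (simp add: f h v simps lookup_add V.add_action)
    show "action ?M (lbracket (ghat g B 0) x y) m \<oplus>\<^bsub>?M\<^esub> action ?M y (action ?M x m) = action ?M x (action ?M y m)"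
      using lc[OF f(2)] lc[OF h(2)] v lb0[OF f(2) h(2)]
      by (simp add: f h v simps affine_bracket_eq V.bracket_action')
  qed (auto simp: simps V.msimps V.M.a_ac)
  have const: "constant_loops \<subseteq> carrier (ghat g B 0)"
    by (auto simp: constant_loops_def ghat_zero intro: loops_single)
  interpret M: lie_module "ghat g B 0" ?M by (rule M)
  have gen: "stable_subspace V (carrier g) {v \<in> carrier V. Base v \<in> W}" if W: "stable_subspace ?M constant_loops W" for W
  proof -
    note d = stable_subspaceD[OF W]
    show ?thesis
    proof (rule stable_subspaceI)
      fix x v assume x: "x \<in> carrier g" and v: "v \<in> {v \<in> carrier V. Base v \<in> W}"
      have "(sgl 0 x, 0, 0) \<in> constant_loops" using x by (auto simp: constant_loops_def)
      from d(6)[OF this, of "Base v"] v x show "action V x v \<in> {v \<in> carrier V. Base v \<in> W}"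
        by (simp add: simps lookup_single V.action_closed)
    next
      show "m \<oplus>\<^bsub>V\<^esub> n \<in> {v \<in> carrier V. Base v \<in> W}"
        if "m \<in> {v \<in> carrier V. Base v \<in> W}" "n \<in> {v \<in> carrier V. Base v \<in> W}" for m n
        using that d(4)[of "Base m" "Base n"] by (simp add: simps)
      show "b \<odot>\<^bsub>V\<^esub> m \<in> {v \<in> carrier V. Base v \<in> W}" if "m \<in> {v \<in> carrier V. Base v \<in> W}" for b m
        using that d(5)[of "Base m" b] by (simp add: simps)
    qed (use d(3) in \<open>auto simp: simps\<close>)
  qed
  have whole: "W = {\<zero>\<^bsub>?M\<^esub>} \<or> W = carrier ?M" if W: "stable_subspace ?M constant_loops W" for W
  proof -
    have e: "Base ` {v \<in> carrier V. Base v \<in> W} = W"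
      using stable_subspaceD(1)[OF W] unfolding simps by blast
    from sub[OF gen[OF W]] show ?thesis
    proof
      assume "{v \<in> carrier V. Base v \<in> W} = {\<zero>\<^bsub>V\<^esub>}"
      from arg_cong[OF this, of "(`) (Base :: 'v \<Rightarrow> ('u, 'v) elt)"] show ?thesis using e by (simp add: simps)
    next
      assume "{v \<in> carrier V. Base v \<in> W} = carrier V"
      from arg_cong[OF this, of "(`) (Base :: 'v \<Rightarrow> ('u, 'v) elt)"] show ?thesis using e by (simp add: simps)
    qed
  qed
  have "top_component (ghat g B 0) ?M constant_loops (degree_derivations 0) (carrier ?M) (\<lambda>m. m)"
  proof (rule top_componentI[OF M const])
    show "degree_derivations 0 \<subseteq> carrier (ghat g B 0)" by (simp add: degree_derivations_def)
    show "stable_subspace ?M constant_loops (carrier ?M)" by (rule M.stable_carrier[OF const])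
    obtain v where "v \<in> carrier V" "v \<noteq> \<zero>\<^bsub>V\<^esub>" using nz V.M.zero_closed by blast
    then show "carrier ?M \<noteq> {\<zero>\<^bsub>?M\<^esub>}" by (auto simp: simps)
    show "W = carrier ?M" if "stable_subspace ?M (carrier (ghat g B 0)) W" "carrier ?M \<subseteq> W" for W
      using that stable_subspaceD(1) by blast
  qed (use whole in auto)
  then show ?thesis unfolding has_top_def by blast
qed

text \<open>Induction preserves surjections, and the irreducible quotient at level \<open>j\<close> is a quotient of the
  module with index \<open>0\<close>; so that module maps onto all the others.\<close>

lemma E_module_has_top:
  fixes V :: "('g, 'v) lie_rep"
  assumes irr: "irreducible_lie_module g V"
  shows "j \<le> k \<Longrightarrow> has_top k (E_module g B h p V j k) \<and>
    (\<exists>\<psi>. lie_hom (ghat g B k) (E_module g B h p V 0 k) (E_module g B h p V j k) \<psi> \<and>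
      carrier (E_module g B h p V j k) = \<psi> ` carrier (E_module g B h p V 0 k))"
proof (induction k arbitrary: j)
  case 0
  have "lie_hom (ghat g B 0) (level_zero_module V) (level_zero_module V) (\<lambda>m. m)"
    by (simp add: lie_hom_def)
  then show ?case using level_zero_has_top[OF irr] by auto
next
  case (Suc k)
  let ?E = "E_module g B h p V"
  let ?a = "- of_nat (p ^ Suc k) - h"
  let ?Ind = "induced_module g B (Suc k) ?a"
  have E0: "?E 0 (Suc k) = ?Ind (?E 0 k)" by simp
  have top0: "has_top (Suc k) (?E 0 (Suc k))" unfolding E0 using Suc.IH[OF le0] by (blast intro: induced_has_top)
  show ?case
  proof (cases "j \<le> k")
    case True
    then have Ej: "?E j (Suc k) = ?Ind (?E j k)" by simp
    obtain \<psi> where \<psi>: "lie_hom (ghat g B k) (?E 0 k) (?E j k) \<psi>" "carrier (?E j k) = \<psi> ` carrier (?E 0 k)"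
      using Suc.IH[OF True] by blast
    have top: "has_top k (?E 0 k)" "has_top k (?E j k)" using Suc.IH[OF le0] Suc.IH[OF True] by blast+
    show ?thesis unfolding E0 Ej
      by (rule conjI[OF induced_has_top[OF top(2)]
            induced_hom[OF has_top_lie_module[OF top(1)] has_top_lie_module[OF top(2)] \<psi>]])
  next
    case False
    then have j: "j = Suc k" using Suc.prems by simp
    obtain V0 \<pi> where "top_component (ghat g B (Suc k)) (?E 0 (Suc k)) constant_loops (degree_derivations (Suc k)) V0 \<pi>"
      using top0 by (auto simp: has_top_def)
    then interpret T: top_component "ghat g B (Suc k)" "?E 0 (Suc k)" constant_loops "degree_derivations (Suc k)" V0 \<pi> .
    have Ej: "?E j (Suc k) = quotient_module (?E 0 (Suc k)) (maximal_submodule (ghat g B (Suc k)) (?E 0 (Suc k)))"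
      unfolding T.sum_proper_submodules_eq[symmetric] j by (simp add: Let_def)
    show ?thesis unfolding Ej has_top_def
      using T.quotient_top_component quotient_module_hom[OF T.lie_module_axioms T.maximal_submodule_stable]
      by (auto simp: quotient_module_def)
  qed
qed

end

theorem lemma4:
  fixes g :: "'g::ab_group_add lie_alg"
    and T :: "'g set"
    and \<Delta> :: "('g \<Rightarrow> complex) set"
    and \<theta> \<Lambda> :: "'g \<Rightarrow> complex"
    and B :: "'g \<Rightarrow> 'g \<Rightarrow> complex"
    and V :: "('g, 'v) lie_rep"
    and p k :: nat
  assumes "simple_lie_algebra g"
    and "cartan_subalgebra g T"
    and "root_base g T \<Delta>"
    and "highest_root g T \<Delta> \<theta>"
    and "normalized_form g T \<theta> B"
    and "prime p"
    and "\<Lambda> \<in> dominant_integral g T \<Delta> B"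
    and "irreducible_highest_weight g T \<Delta> \<Lambda> V"
    and "k \<ge> 1"
  shows "let E = E_module g B (dual_coxeter g T \<Delta> \<theta> B) p V in
    \<forall>j<k. has_unique_irreducible_quotient (ghat g B k) (E j k) \<and>
    (\<forall>N. lie_submodule (ghat g B k) (E j k) N \<and>
        irreducible_lie_module (ghat g B k) (quotient_module (E j k) N) \<longrightarrow>
      lie_module_iso (ghat g B k) (quotient_module (E j k) N) (E k k))"
proof -
  interpret affine_algebra g B
    using assms(1,5) by (simp add: affine_algebra_def affine_algebra_axioms_def simple_lie_algebra_def normalized_form_def)
  have irr: "irreducible_lie_module g V" using assms(8) by (simp add: irreducible_highest_weight_def)
  define E where "E = E_module g B (dual_coxeter g T \<Delta> \<theta> B) p V"
  let ?L = "ghat g B k"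
  have top: "has_top k (E j k)" if "j \<le> k" for j unfolding E_def using E_module_has_top[OF irr that] by blast
  obtain V0 \<pi> where "top_component ?L (E 0 k) constant_loops (degree_derivations k) V0 \<pi>"
    using top[of 0] by (auto simp: has_top_def)
  then interpret T0: top_component ?L "E 0 k" constant_loops "degree_derivations k" V0 \<pi> .
  obtain k' where k': "k = Suc k'" using assms(9) by (cases k) auto
  have Ekk: "E k k = quotient_module (E 0 k) (maximal_submodule ?L (E 0 k))"
    unfolding T0.sum_proper_submodules_eq[symmetric] unfolding E_def k' by (simp add: Let_def)
  have "has_unique_irreducible_quotient ?L (E j k) \<and>
    (\<forall>N. lie_submodule ?L (E j k) N \<and> irreducible_lie_module ?L (quotient_module (E j k) N) \<longrightarrow>
      lie_module_iso ?L (quotient_module (E j k) N) (E k k))" if j: "j < k" for j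
  proof -
    obtain V0' \<pi>' where "top_component ?L (E j k) constant_loops (degree_derivations k) V0' \<pi>'"
      using top[of j] j by (auto simp: has_top_def)
    then interpret Tj: top_component ?L "E j k" constant_loops "degree_derivations k" V0' \<pi>' .
    obtain \<psi> where \<psi>: "lie_hom ?L (E 0 k) (E j k) \<psi>" "carrier (E j k) = \<psi> ` carrier (E 0 k)"
      unfolding E_def using E_module_has_top[OF irr less_imp_le[OF j]] by blast
    have "lie_module_iso ?L (quotient_module (E j k) N) (E k k)"
      if N: "lie_submodule ?L (E j k) N" "irreducible_lie_module ?L (quotient_module (E j k) N)" for N
    proof -
      have hom: "lie_hom ?L (E j k) (quotient_module (E j k) N) (coset_rep (E j k) N)"
        using quotient_module_hom[OF Tj.lie_module_axioms] N(1) unfolding Tj.lie_submodule_iff by blast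
      show ?thesis unfolding Ekk
        by (rule T0.irreducible_quotient_iso[OF lie_hom_comp[OF \<psi>(1) hom] N(2)])
          (simp add: quotient_module_def \<psi>(2) image_comp)
    qed
    then show ?thesis using Tj.unique_irreducible_quotient by blast
  qed
  then show ?thesis unfolding E_def[symmetric] Let_def by blast
qed

end
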